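(* A simple chain datalog program $\Pi$ (i.e. one in which each rule contains at most two body atoms) over a database instance with at most $N$ tuples per EDB relation can be evaluated in time $O\bigl((f(\Pi))^2\cdot|\Pi|\cdot N^{2\,\mathsf{ew}(\Pi)}\bigr)$.
   Context: Datalog. Standard positive datalog programs: finite sets of rules $q(\bar s)\gets p_1(\bar s_1),\dots,p_\mu(\bar s_\mu)$ whose terms are variables or constants; $|\Pi|$ is the number of rules. A predicate is IDB if it is the head predicate of a rule with non-empty body, otherwise EDB. Evaluating means computing all IDB relations of the least fixpoint. "$\_$" denotes a fresh existentially quantified variable. Edge-cover width and $f(\Pi)$. Let $\Pi'$ be the output of the following algorithm on $\Pi$. Here $q_\rho$ denotes a new predicate for an IDB predicate $q$ and a rule $\rho$ (adornment) with head predicate $q$ and only EDB body atoms. Start with $\Pi'=\emptyset$. Repeat until a fixpoint: for each rule $R: q(\bar s)\gets \bigwedge_{i=1}^{l}p_i(\bar s_i)\wedge\mathcal E$ of $\Pi$ ($p_i$ IDB, $\mathcal E$ a conjunction of EDB atoms, $l\ge0$), and each choice $(\rho_1,\dots,\rho_l)$ such that for each $i$ some rule of $\Pi'$ has head atom ${p_i}_{\rho_i}(\bar v_i)$: rename these head atoms with their adornments to ${p_i}_{\rho_i'}(\bar v_i')$, $\rho_i'=p_i(\bar v_i')\gets\mathcal B_i$, so that they and $R$ are pairwise variable-disjoint; let $\sigma$ be a simultaneous mgu of the pairs $(\bar s_i,\bar v_i')$ (skip if none); let $\rho=g_{\mathsf{out}}\bigl(q(\sigma(\bar s))\gets\bigwedge_i\sigma(\mathcal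 B_i)\wedge\sigma(\mathcal E)\bigr)$; add the rule $q_\rho(\sigma(\bar s))\gets\bigwedge_i{p_i}_{\rho_i}(\sigma(\bar s_i))\wedge\sigma(\mathcal E)$ to $\Pi'$ unless an identical rule up to variable renaming is already present. The function $g_{\mathsf{out}}$ replaces each body argument not occurring in the head by $\_$ and then removes each body atom $e(\bar t)$ for which another body atom $e(\bar t')$ satisfies, for each position $i$, $t_i=t_i'$ or $t_i=\_$ (keeping one of identical atoms); in particular atoms with only $\_$ are removed. For an adornment $\rho: q(\bar s)\gets e_1(\bar t_1),\dots,e_\mu(\bar t_\mu)$, $\mathsf{ew}(q_\rho)$ is the minimum of $\sum_i x_i$ over $0\le x_i\le1$ assigned to the hyperedges $\mathsf{vars}(\bar t_i)$ such that each $v\in\mathsf{vars}(\bar s)$ is covered with total weight at least $1$ (fractional edge cover). $\mathsf{ew}(\Pi)$ is the maximum of $\mathsf{ew}(q_\rho)$ over all $q_\rho$ in $\Pi'$. $f(\Pi)$, which depends only on $\Pi$, is the maximum over IDB predicates $q$ of $\Pi$ of the number of different adornments $\rho$ (up to variable renaming) with $q_\rho$ in $\Pi'$; thus every IDB relation has size at most $f(\Pi)\cdot N^{\mathsf{ew}(\Pi)}$.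
   Formalization: The O-constant may depend on a bound on the predicate arities; N ≥ 1 is assumed; and when ew(Π) < 1 (that is, ew(Π) = 0), where the stated bound fails because the input must be read, the term (1+|Π|)·N² is added to the bound. *)

theory Defs
  imports Complex_Main
begin

section \<open>Positive datalog\<close>

datatype trm = Var nat | Cst nat

type_synonym atom = "nat \<times> trm list"
type_synonym fact = "nat \<times> nat list"

datatype rule = Rule (rhead: atom) (rbody: "atom list")

fun trm_vars :: "trm \<Rightarrow> nat set" where
  "trm_vars (Var x) = {x}"
| "trm_vars (Cst c) = {}"

definition args_vars :: "trm list \<Rightarrow> nat set" where
  "args_vars ts = (\<Union>t\<in>set ts. trm_vars t)"

definition rule_vars :: "rule \<Rightarrow> nat set" where
  "rule_vars R = (\<Union>a\<in>set (rhead R # rbody R). args_vars (snd a))"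

definition predicates :: "rule set \<Rightarrow> nat set" where
  "predicates \<Pi> = (\<Union>R\<in>\<Pi>. fst ` set (rhead R # rbody R))"

definition idb :: "rule set \<Rightarrow> nat set" where
  "idb \<Pi> = {fst (rhead R) | R. R \<in> \<Pi> \<and> rbody R \<noteq> []}"

definition edb :: "rule set \<Rightarrow> nat set" where
  "edb \<Pi> = predicates \<Pi> - idb \<Pi>"

text \<open>\<open>ar\<close> gives the arity of each predicate.  The last condition is range restriction
  (safety); without it the least fixpoint need not be finite and an edge cover of the head
  variables need not exist.\<close>

definition datalog_program :: "(nat \<Rightarrow> nat) \<Rightarrow> rule set \<Rightarrow> bool" where
  "datalog_program ar \<Pi> \<longleftrightarrow> finite \<Pi> \<and>
     (\<forall>R\<in>\<Pi>. (\<forall>a\<in>set (rhead R # rbody R). length (snd a) = ar (fst a)) \<and>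
            args_vars (snd (rhead R)) \<subseteq> (\<Union>a\<in>set (rbody R). args_vars (snd a)))"

definition simple_chain :: "rule set \<Rightarrow> bool" where
  "simple_chain \<Pi> \<longleftrightarrow> (\<forall>R\<in>\<Pi>. length (rbody R) \<le> 2)"

definition database :: "(nat \<Rightarrow> nat) \<Rightarrow> rule set \<Rightarrow> fact set \<Rightarrow> bool" where
  "database ar \<Pi> D \<longleftrightarrow> finite D \<and> (\<forall>(p, xs)\<in>D. p \<in> edb \<Pi> \<and> length xs = ar p)"

text \<open>A program may contain rules with empty body for an EDB predicate; these tuples belong to
  the EDB relation as well.\<close>

definition edb_relation :: "rule set \<Rightarrow> fact set \<Rightarrow> nat \<Rightarrow> nat list set" where
  "edb_relation \<Pi> D e = {xs. (e, xs) \<in> D \<or> Rule (e, map Cst xs) [] \<in> \<Pi>}"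

fun ground_trm :: "(nat \<Rightarrow> nat) \<Rightarrow> trm \<Rightarrow> nat" where
  "ground_trm \<theta> (Var x) = \<theta> x"
| "ground_trm \<theta> (Cst c) = c"

definition ground_atom :: "(nat \<Rightarrow> nat) \<Rightarrow> atom \<Rightarrow> fact" where
  "ground_atom \<theta> a = (fst a, map (ground_trm \<theta>) (snd a))"

inductive_set least_fixpoint :: "rule set \<Rightarrow> fact set \<Rightarrow> fact set"
  for \<Pi> :: "rule set" and D :: "fact set" where
  database_fact: "f \<in> D \<Longrightarrow> f \<in> least_fixpoint \<Pi> D"
| rule_instance: "\<lbrakk>R \<in> \<Pi>; \<forall>a\<in>set (rbody R). ground_atom \<theta> a \<in> least_fixpoint \<Pi> D\<rbrakk>
    \<Longrightarrow> ground_atom \<theta> (rhead R) \<in> least_fixpoint \<Pi> D"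

definition idb_facts :: "rule set \<Rightarrow> fact set \<Rightarrow> fact set" where
  "idb_facts \<Pi> D = {f \<in> least_fixpoint \<Pi> D. fst f \<in> idb \<Pi>}"


section \<open>Substitutions and most general unifiers\<close>

fun subst_trm :: "(nat \<Rightarrow> trm) \<Rightarrow> trm \<Rightarrow> trm" where
  "subst_trm \<sigma> (Var x) = \<sigma> x"
| "subst_trm \<sigma> (Cst c) = Cst c"

definition unifier :: "(nat \<Rightarrow> trm) \<Rightarrow> (trm list \<times> trm list) list \<Rightarrow> bool" where
  "unifier \<sigma> E \<longleftrightarrow> (\<forall>(ss, ts)\<in>set E. map (subst_trm \<sigma>) ss = map (subst_trm \<sigma>) ts)"

definition is_mgu :: "(nat \<Rightarrow> trm) \<Rightarrow> (trm list \<times> trm list) list \<Rightarrow> bool" where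
  "is_mgu \<sigma> E \<longleftrightarrow> unifier \<sigma> E \<and>
     (\<forall>\<tau>. unifier \<tau> E \<longrightarrow> (\<exists>\<delta>. \<forall>x. \<tau> x = subst_trm \<delta> (\<sigma> x)))"


section \<open>Adornments\<close>

text \<open>Body arguments of adornments are terms or the placeholder \<open>_\<close>, represented by \<open>None\<close>.
  A body is a conjunction, hence a set.  As the head of an adornment \<open>\<rho>\<close> contains the
  predicate \<open>q\<close>, the adorned predicate \<open>q\<^sub>\<rho>\<close> is represented by \<open>\<rho>\<close> itself.\<close>

type_synonym aatom = "nat \<times> trm option list"
type_synonym adornment = "atom \<times> aatom set"

definition lift_atom :: "atom \<Rightarrow> aatom" where
  "lift_atom a = (fst a, map Some (snd a))"

definition subst_aatom :: "(nat \<Rightarrow> trm) \<Rightarrow> aatom \<Rightarrow> aatom" where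
  "subst_aatom \<sigma> a = (fst a, map (map_option (subst_trm \<sigma>)) (snd a))"

definition aatom_vars :: "aatom \<Rightarrow> nat set" where
  "aatom_vars a = (\<Union>t \<in> {t. Some t \<in> set (snd a)}. trm_vars t)"

definition head_vars :: "adornment \<Rightarrow> nat set" where
  "head_vars \<rho> = args_vars (snd (fst \<rho>))"

definition adornment_vars :: "adornment \<Rightarrow> nat set" where
  "adornment_vars \<rho> = head_vars \<rho> \<union> (\<Union>a\<in>snd \<rho>. aatom_vars a)"

definition subst_adornment :: "(nat \<Rightarrow> trm) \<Rightarrow> adornment \<Rightarrow> adornment" where
  "subst_adornment \<sigma> \<rho> =
     ((fst (fst \<rho>), map (subst_trm \<sigma>) (snd (fst \<rho>))), subst_aatom \<sigma> ` snd \<rho>)"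

definition variant :: "adornment \<Rightarrow> adornment \<Rightarrow> bool" where
  "variant \<rho> \<rho>' \<longleftrightarrow> (\<exists>\<pi>. bij \<pi> \<and> \<rho>' = subst_adornment (Var \<circ> \<pi>) \<rho>)"

definition hide_args :: "trm list \<Rightarrow> aatom \<Rightarrow> aatom" where
  "hide_args ss a =
     (fst a, map (\<lambda>t. case t of Some u \<Rightarrow> if u \<in> set ss then Some u else None | None \<Rightarrow> None) (snd a))"

definition subsumed :: "aatom \<Rightarrow> aatom \<Rightarrow> bool" where
  "subsumed a a' \<longleftrightarrow> fst a = fst a' \<and> list_all2 (\<lambda>t t'. t = t' \<or> t = None) (snd a) (snd a')"

text \<open>Body arguments that do not occur in the head, constants included, are hidden.  Atoms with
  only \<open>_\<close> are removed even if no other body atom has the same predicate.\<close>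

definition g_out :: "atom \<Rightarrow> aatom set \<Rightarrow> adornment" where
  "g_out h B = (let B' = hide_args (snd h) ` B in
     (h, {a \<in> B'. \<not> set (snd a) \<subseteq> {None} \<and> \<not> (\<exists>a'\<in>B'. a' \<noteq> a \<and> subsumed a a')}))"

text \<open>A rule of \<open>\<Pi>'\<close>: the adorned head predicate, whose head atom is the head of the adornment,
  the adorned IDB body atoms, and the EDB body atoms.\<close>

datatype adorned_rule =
  ARule (ar_head: adornment) (ar_idb: "(adornment \<times> trm list) list") (ar_edb: "atom list")

text \<open>The program \<open>\<Pi>'\<close>.  Rather than one representative of each rule, it contains the results
  for every choice of the fresh renamings and of the mgu; these choices only lead to variants,
  and adornments are counted modulo \<open>variant\<close> below.\<close>

inductive_set adorned_program :: "rule set \<Rightarrow> adorned_rule set" for \<Pi> :: "rule set" where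
  "\<lbrakk>R \<in> \<Pi>; rhead R = (q, ss); q \<in> idb \<Pi>;
    Is = filter (\<lambda>a. fst a \<in> idb \<Pi>) (rbody R);
    Es = filter (\<lambda>a. fst a \<notin> idb \<Pi>) (rbody R);
    length \<rho>s = length Is; length \<rho>s' = length Is;
    \<forall>i<length Is. (\<exists>R'. R' \<in> adorned_program \<Pi> \<and> ar_head R' = \<rho>s ! i) \<and> fst (fst (\<rho>s ! i)) = fst (Is ! i);
    \<forall>i<length Is. variant (\<rho>s ! i) (\<rho>s' ! i) \<and> adornment_vars (\<rho>s' ! i) \<inter> rule_vars R = {};
    \<forall>i<length Is. \<forall>j<length Is. i \<noteq> j \<longrightarrow> adornment_vars (\<rho>s' ! i) \<inter> adornment_vars (\<rho>s' ! j) = {};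
    is_mgu \<sigma> (zip (map snd Is) (map (snd \<circ> fst) \<rho>s'));
    \<rho> = g_out (q, map (subst_trm \<sigma>) ss)
          (subst_aatom \<sigma> ` ((\<Union>\<rho>'\<in>set \<rho>s'. snd \<rho>') \<union> lift_atom ` set Es))\<rbrakk>
   \<Longrightarrow> ARule \<rho> (zip \<rho>s (map (map (subst_trm \<sigma>) \<circ> snd) Is))
         (map (\<lambda>a. (fst a, map (subst_trm \<sigma>) (snd a))) Es) \<in> adorned_program \<Pi>"

definition adornments :: "rule set \<Rightarrow> adornment set" where
  "adornments \<Pi> = ar_head ` adorned_program \<Pi>"

text \<open>The quantities \<open>ew(q\<^sub>\<rho>)\<close>, \<open>ew(\<Pi>)\<close> and \<open>f(\<Pi>)\<close>.  The infimum below is attained.  The element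
  \<open>0\<close> in the maxima only matters if they range over the empty set.\<close>

definition fractional_edge_cover :: "adornment \<Rightarrow> (aatom \<Rightarrow> real) \<Rightarrow> bool" where
  "fractional_edge_cover \<rho> x \<longleftrightarrow> (\<forall>a\<in>snd \<rho>. 0 \<le> x a \<and> x a \<le> 1) \<and>
     (\<forall>v\<in>head_vars \<rho>. 1 \<le> (\<Sum>a\<in>{a\<in>snd \<rho>. v \<in> aatom_vars a}. x a))"

definition ew_adornment :: "adornment \<Rightarrow> real" where
  "ew_adornment \<rho> = Inf {\<Sum>a\<in>snd \<rho>. x a | x. fractional_edge_cover \<rho> x}"

definition ew :: "rule set \<Rightarrow> real" where
  "ew \<Pi> = Max (insert 0 (ew_adornment ` adornments \<Pi>))"

definition num_adornments :: "rule set \<Rightarrow> nat \<Rightarrow> nat" where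
  "num_adornments \<Pi> q =
     card ({\<rho> \<in> adornments \<Pi>. fst (fst \<rho>) = q} // {(\<rho>, \<rho>'). variant \<rho> \<rho>'})"

definition max_adornments :: "rule set \<Rightarrow> nat" where
  "max_adornments \<Pi> = Max (insert 0 (num_adornments \<Pi> ` idb \<Pi>))"


section \<open>Random access machines\<close>

text \<open>A structured unit-cost RAM: registers and an indirectly addressed memory hold natural
  numbers, all initially \<open>0\<close>; input is read from, and output written to, a sequential tape.
  The only arithmetic is addition and truncated subtraction; reading past the end of the input yields \<open>0\<close>.  Every instruction and every test
  takes one time step.\<close>

datatype ram =
    Skip
  | Set nat nat
  | Add nat nat nat
  | Sub nat nat nat
  | Load nat nat
  | Store nat nat
  | Read nat
  | Write nat
  | Seq ram ram
  | If nat ram ram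
  | While nat ram

record ram_state =
  reg :: "nat \<Rightarrow> nat"
  mem :: "nat \<Rightarrow> nat"
  inp :: "nat list"
  out :: "nat list"

inductive ram_exec :: "ram \<Rightarrow> ram_state \<Rightarrow> nat \<Rightarrow> ram_state \<Rightarrow> bool" where
  "ram_exec Skip s 1 s"
| "ram_exec (Set r n) s 1 (s\<lparr>reg := (reg s)(r := n)\<rparr>)"
| "ram_exec (Add r i j) s 1 (s\<lparr>reg := (reg s)(r := reg s i + reg s j)\<rparr>)"
| "ram_exec (Sub r i j) s 1 (s\<lparr>reg := (reg s)(r := reg s i - reg s j)\<rparr>)"
| "ram_exec (Load r i) s 1 (s\<lparr>reg := (reg s)(r := mem s (reg s i))\<rparr>)"
| "ram_exec (Store i r) s 1 (s\<lparr>mem := (mem s)(reg s i := reg s r)\<rparr>)"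
| "inp s = x # xs \<Longrightarrow> ram_exec (Read r) s 1 (s\<lparr>reg := (reg s)(r := x), inp := xs\<rparr>)"
| "inp s = [] \<Longrightarrow> ram_exec (Read r) s 1 (s\<lparr>reg := (reg s)(r := 0)\<rparr>)"
| "ram_exec (Write r) s 1 (s\<lparr>out := out s @ [reg s r]\<rparr>)"
| "\<lbrakk>ram_exec M1 s t1 s'; ram_exec M2 s' t2 s''\<rbrakk> \<Longrightarrow> ram_exec (Seq M1 M2) s (t1 + t2) s''"
| "\<lbrakk>reg s r \<noteq> 0; ram_exec M1 s t s'\<rbrakk> \<Longrightarrow> ram_exec (If r M1 M2) s (1 + t) s'"
| "\<lbrakk>reg s r = 0; ram_exec M2 s t s'\<rbrakk> \<Longrightarrow> ram_exec (If r M1 M2) s (1 + t) s'"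
| "reg s r = 0 \<Longrightarrow> ram_exec (While r M) s 1 s"
| "\<lbrakk>reg s r \<noteq> 0; ram_exec M s t1 s'; ram_exec (While r M) s' t2 s''\<rbrakk>
    \<Longrightarrow> ram_exec (While r M) s (1 + t1 + t2) s''"

definition initial_state :: "nat list \<Rightarrow> ram_state" where
  "initial_state xs = \<lparr>reg = (\<lambda>_. 0), mem = (\<lambda>_. 0), inp = xs, out = []\<rparr>"

fun encode_trm :: "trm \<Rightarrow> nat list" where
  "encode_trm (Var x) = [0, x]"
| "encode_trm (Cst c) = [1, c]"

definition encode_atom :: "atom \<Rightarrow> nat list" where
  "encode_atom a = fst a # length (snd a) # concat (map encode_trm (snd a))"

definition encode_rule :: "rule \<Rightarrow> nat list" where
  "encode_rule R = encode_atom (rhead R) @ length (rbody R) # concat (map encode_atom (rbody R))"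

definition encode_fact :: "fact \<Rightarrow> nat list" where
  "encode_fact f = fst f # length (snd f) # snd f"

definition encode_input :: "rule list \<Rightarrow> fact list \<Rightarrow> nat list" where
  "encode_input Rs Ds = length Rs # concat (map encode_rule Rs) @
     length Ds # concat (map encode_fact Ds)"

text \<open>The machine receives program and database in an arbitrary order and must output every fact
  of the IDB relations exactly once, in any order.\<close>

definition evaluates_in_time :: "ram \<Rightarrow> rule set \<Rightarrow> fact set \<Rightarrow> real \<Rightarrow> bool" where
  "evaluates_in_time M \<Pi> D T \<longleftrightarrow>
     (\<forall>Rs Ds. distinct Rs \<and> set Rs = \<Pi> \<and> distinct Ds \<and> set Ds = D \<longrightarrow>
       (\<exists>t s fs. ram_exec M (initial_state (encode_input Rs Ds)) t s \<and> real t \<le> T \<and>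
          distinct fs \<and> set fs = idb_facts \<Pi> D \<and> out s = concat (map encode_fact fs)))"

end

theory Submission
  imports Defs
begin

text \<open>Every derived IDB fact is an instance of some adornment: following a derivation, the mgu of the
  algorithm computing the adorned program is more general than the substitution used in the
  derivation.  By the Atserias--Grohe--Marx bound the instances of one adornment number at most
  \<open>N\<close> to the power of its fractional edge cover number, and there are only finitely many adornments up
  to renaming, so each IDB relation has at most \<open>f(\<Pi>) N\<^sup>e\<^sup>w\<close> tuples.

  The machine pads every rule to exactly two body atoms and, for each newly derived fact,
  combines it with all facts known so far for the other body atom.  So each rule costs at most the product of
  the sizes of two relations.  Arithmetic has no multiplication, hence facts are stored as hash-consed lists:
  nodes are multiples of a number \<open>B\<close> larger than every input token, and the list with head
  \<open>v\<close> and tail node \<open>n\<close> is looked up at address \<open>n + v\<close>.  Equality of facts is then equality of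
  nodes, and testing whether a fact is new takes constant time for bounded arity.\<close>

section \<open>Joins and fractional edge covers\<close>

text \<open>The claimed bound counts derived tuples only, while a machine must also read and store
  the EDB relations. If \<open>1 \<le> ew \<Pi>\<close>, an adornment exists, so
  \<open>f \<ge> 1\<close> and \<open>N \<le> f * N powr ew\<close>; EDB relations then obey the
  bound for IDB relations and lower-order terms are absorbed. A cover of a nonempty set of head
  variables has weight at least 1, so \<open>ew \<Pi> < 1\<close> means that every adornment has a
  ground head; \<open>N powr (2 * ew \<Pi>)\<close> is then 1 and does not even pay for reading the
  input, hence the extra term in \<open>N\<close>. The square comes from the two body atoms, whose
  relations both have at most \<open>max N (f * N powr ew)\<close> tuples. The constant depends on
  the largest arity because matching, storing and printing a fact take time linear in it. The
  hypergraph bound is stated for sets of valuations instead of joins: constants, repeated variables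
  and hidden arguments then cause no trouble, as an atom merely limits the number of restrictions to
  its variables. Adornments are formed with arbitrary renamings, so counting them requires canonical
  variable names.\<close>

lemma weighted_geometric_mean_le:
  fixes p w :: "'a \<Rightarrow> real"
  assumes "finite A" "\<And>a. a \<in> A \<Longrightarrow> 0 < p a" "\<And>a. a \<in> A \<Longrightarrow> 0 \<le> w a" "sum w A = 1"
  shows "(\<Prod>a\<in>A. p a powr w a) \<le> (\<Sum>a\<in>A. w a * p a)"
proof -
  \<comment> \<open>The logarithm is estimated by its tangent at the weighted mean \<open>s\<close>;
    as the weights sum to 1, the linear terms cancel and only \<open>ln s\<close> remains.\<close>
  define s where "s = (\<Sum>a\<in>A. w a * p a)"
  obtain b where b: "b \<in> A" "w b \<noteq> 0" using assms(4) by (metis sum.neutral zero_neq_one)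
  have "0 < w b * p b" using assms(2,3)[OF b(1)] b(2) by simp
  also have "\<dots> \<le> s"
    unfolding s_def using b(1) assms(1)
    by (intro member_le_sum) (use assms(2,3) in \<open>auto simp: less_imp_le\<close>)
  finally have s: "0 < s" .
  have "(\<Prod>a\<in>A. p a powr w a) = exp (\<Sum>a\<in>A. w a * ln (p a))"
    unfolding exp_sum[OF assms(1)]
  proof (rule prod.cong[OF refl])
    fix a assume "a \<in> A"
    then have "p a \<noteq> 0" using assms(2) by force
    then show "p a powr w a = exp (w a * ln (p a))" by (simp add: powr_def)
  qed
  also have "(\<Sum>a\<in>A. w a * ln (p a)) \<le> (\<Sum>a\<in>A. w a * (ln s + (p a / s - 1)))"
  proof (intro sum_mono mult_left_mono)
    fix a assume a: "a \<in> A"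
    have "ln (p a / s) \<le> p a / s - 1" using assms(2)[OF a] s by (intro ln_le_minus_one) simp
    then show "ln (p a) \<le> ln s + (p a / s - 1)" using assms(2)[OF a] s by (simp add: ln_div)
  qed (rule assms(3))
  also have "\<dots> = (\<Sum>a\<in>A. w a) * (ln s - 1) + (\<Sum>a\<in>A. w a * p a) / s"
    by (simp add: sum_distrib_left sum_divide_distrib sum.distrib sum_subtractf algebra_simps)
  also have "\<dots> = ln s" using assms(4) s by (simp add: s_def[symmetric])
  finally show ?thesis using s by (simp add: s_def[symmetric])
qed

text \<open>The exponents may add up to more than one because all factors are at most one after
  normalisation.  Positivity avoids the junk value \<open>0 powr 0 = 0\<close>.\<close>

lemma hoelder_sum:
  fixes n :: "'a \<Rightarrow> 'c \<Rightarrow> real"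
  assumes fin: "finite A" "finite C" and pos: "\<And>a c. a \<in> A \<Longrightarrow> c \<in> C \<Longrightarrow> 0 < n a c"
    and x: "\<And>a. a \<in> A \<Longrightarrow> 0 \<le> x a" "1 \<le> sum x A"
  shows "(\<Sum>c\<in>C. \<Prod>a\<in>A. n a c powr x a) \<le> (\<Prod>a\<in>A. (\<Sum>c\<in>C. n a c) powr x a)"
proof (cases "C = {}")
  case True
  then show ?thesis by (simp add: prod_nonneg)
next
  case False
  define M where "M a = (\<Sum>c\<in>C. n a c)" for a
  \<comment> \<open>Dividing by the total exponent \<open>X\<close> gives weights with sum 1, as the
    inequality between the means requires.\<close>
  define X where "X = sum x A"
  have M: "0 < M a" if "a \<in> A" for a unfolding M_def using fin False pos that by (intro sum_pos) auto
  have le: "n a c \<le> M a" if "a \<in> A" "c \<in> C" for a c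
    unfolding M_def using fin that pos by (intro member_le_sum) (auto intro: less_imp_le)
  have "(\<Sum>c\<in>C. \<Prod>a\<in>A. (n a c / M a) powr x a) \<le> (\<Sum>c\<in>C. \<Sum>a\<in>A. (x a / X) * (n a c / M a))"
  proof (rule sum_mono)
    fix c assume c: "c \<in> C"
    have p: "0 < n a c / M a" "n a c / M a \<le> 1" if "a \<in> A" for a
      using pos[OF that c] M[OF that] le[OF that c] by auto
    have "(\<Prod>a\<in>A. (n a c / M a) powr x a) \<le> (\<Prod>a\<in>A. (n a c / M a) powr (x a / X))"
    proof (intro prod_mono conjI)
      fix a assume a: "a \<in> A"
      have "x a / X \<le> x a" using mult_left_mono[OF x(2) x(1)[OF a]] x(2) by (simp add: X_def divide_le_eq)
      then show "(n a c / M a) powr x a \<le> (n a c / M a) powr (x a / X)"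
        using p[OF a] by (intro powr_mono') auto
    qed auto
    also have "\<dots> \<le> (\<Sum>a\<in>A. (x a / X) * (n a c / M a))"
      using p x fin by (intro weighted_geometric_mean_le) (auto simp: X_def sum_divide_distrib[symmetric])
    finally show "(\<Prod>a\<in>A. (n a c / M a) powr x a) \<le> (\<Sum>a\<in>A. (x a / X) * (n a c / M a))" .
  qed
  also have "\<dots> = (\<Sum>a\<in>A. \<Sum>c\<in>C. (x a / X) * (n a c / M a))" by (rule sum.swap)
  also have "\<dots> = (\<Sum>a\<in>A. x a / X)"
  proof (rule sum.cong[OF refl])
    fix a assume a: "a \<in> A"
    have "(\<Sum>c\<in>C. (x a / X) * (n a c / M a)) = (x a / X) * (M a / M a)"
      by (simp add: M_def sum_distrib_left[symmetric] sum_divide_distrib[symmetric])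
    then show "(\<Sum>c\<in>C. (x a / X) * (n a c / M a)) = x a / X" using M[OF a] by simp
  qed
  also have "\<dots> = 1" using x(2) by (simp add: X_def sum_divide_distrib[symmetric])
  finally have one: "(\<Sum>c\<in>C. \<Prod>a\<in>A. (n a c / M a) powr x a) \<le> 1" .
  have "(\<Sum>c\<in>C. \<Prod>a\<in>A. n a c powr x a) = (\<Sum>c\<in>C. (\<Prod>a\<in>A. (n a c / M a) powr x a) * (\<Prod>a\<in>A. M a powr x a))"
  proof (rule sum.cong[OF refl])
    fix c assume c: "c \<in> C"
    have "n a c powr x a = (n a c / M a) powr x a * M a powr x a" if "a \<in> A" for a
      using pos[OF that c] M[OF that] by (simp add: powr_mult[symmetric])
    then show "(\<Prod>a\<in>A. n a c powr x a) = (\<Prod>a\<in>A. (n a c / M a) powr x a) * (\<Prod>a\<in>A. M a powr x a)"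
      by (simp add: prod.distrib[symmetric])
  qed
  also have "\<dots> = (\<Sum>c\<in>C. \<Prod>a\<in>A. (n a c / M a) powr x a) * (\<Prod>a\<in>A. M a powr x a)"
    by (simp add: sum_distrib_right)
  also have "\<dots> \<le> 1 * (\<Prod>a\<in>A. M a powr x a)" by (intro mult_right_mono one prod_nonneg) auto
  finally show ?thesis by (simp add: M_def)
qed

text \<open>The projection of a valuation to the vertices in \<open>S\<close>. The default value 0
  keeps it a total function, so that projections can be compared and counted as functions.\<close>

definition cut :: "nat set \<Rightarrow> (nat \<Rightarrow> nat) \<Rightarrow> nat \<Rightarrow> nat" where
  "cut S f = (\<lambda>v. if v \<in> S then f v else 0)"

text \<open>The induction splits \<open>T\<close> by the value at a vertex \<open>v\<close>.  Along an edge containing \<open>v\<close> the cuts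
  of different parts are disjoint, so Hoelder's inequality recombines the bounds for the parts.\<close>

lemma agm_bound:
  fixes x :: "'a \<Rightarrow> real" and S :: "'a \<Rightarrow> nat set"
  assumes "finite V" "finite T" "T \<noteq> {}" "finite A"
    and "\<And>f g. f \<in> T \<Longrightarrow> g \<in> T \<Longrightarrow> (\<And>v. v \<in> V \<Longrightarrow> f v = g v) \<Longrightarrow> f = g"
    and "\<And>a. a \<in> A \<Longrightarrow> 0 \<le> x a"
    and "\<And>v. v \<in> V \<Longrightarrow> 1 \<le> (\<Sum>a\<in>{a\<in>A. v \<in> S a}. x a)"
  shows "real (card T) \<le> (\<Prod>a\<in>A. real (card (cut (S a) ` T)) powr x a)"
  using assms
proof (induction V arbitrary: T rule: finite_induct)
  \<comment> \<open>Functions in \<open>T\<close> agree on the empty vertex set and hence coincide: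
    \<open>T\<close> and all its projections have one element.\<close>
  case empty
  then obtain f where "T = {f}" by blast
  then show ?case by simp
next
  case (insert v V)
  note T = insert.prems(1,2) and A = insert.prems(3) and x = insert.prems(5)
  define C where "C = (\<lambda>f. f v) ` T"
  define Tc where "Tc c = {f\<in>T. f v = c}" for c
  define n where "n a c = real (card (cut (S a) ` Tc c))" for a c
  define M where "M a = real (card (cut (S a) ` T))" for a
  have fC: "finite C" using T by (simp add: C_def)
  have Tc: "finite (Tc c)" for c using T by (simp add: Tc_def)
  have ne: "Tc c \<noteq> {}" if "c \<in> C" for c using that by (auto simp: C_def Tc_def)
  have IH: "real (card (Tc c)) \<le> (\<Prod>a\<in>A. n a c powr x a)" if "c \<in> C" for c
    unfolding n_def
  proof (rule insert.IH[OF Tc ne[OF that] A])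
    show "f = g" if "f \<in> Tc c" "g \<in> Tc c" "\<And>u. u \<in> V \<Longrightarrow> f u = g u" for f g
      using that by (intro insert.prems(4)) (auto simp: Tc_def)
  qed (use insert.prems in auto)
  have n0: "0 < n a c" if "c \<in> C" for a c
    using ne[OF that] Tc by (simp add: n_def card_gt_0_iff)
  have M0: "0 \<le> M a" for a by (simp add: M_def)
  have nM: "n a c \<le> M a" for a c
    unfolding n_def M_def using T by (auto intro!: card_mono simp: Tc_def)
  have sumM: "(\<Sum>c\<in>C. n a c) = M a" if "v \<in> S a" for a
  proof -
    have "cut (S a) ` T = (\<Union>c\<in>C. cut (S a) ` Tc c)" by (auto simp: C_def Tc_def)
    moreover have "card (\<Union>c\<in>C. cut (S a) ` Tc c) = (\<Sum>c\<in>C. card (cut (S a) ` Tc c))"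
    proof (rule card_UN_disjoint[OF fC])
      show "\<forall>c\<in>C. \<forall>d\<in>C. c \<noteq> d \<longrightarrow> cut (S a) ` Tc c \<inter> cut (S a) ` Tc d = {}"
        using that by (auto simp: cut_def Tc_def dest!: fun_cong[of _ _ v])
    qed (use Tc in auto)
    ultimately show ?thesis by (simp add: n_def M_def)
  qed
  let ?A1 = "{a\<in>A. v \<in> S a}" and ?A0 = "{a\<in>A. v \<notin> S a}"
  have split: "(\<Prod>a\<in>A. g a) = (\<Prod>a\<in>?A0. g a) * (\<Prod>a\<in>?A1. g a)" for g :: "'a \<Rightarrow> real"
    using A by (subst prod.union_disjoint[symmetric]) (auto intro!: prod.cong)
  have "card T = (\<Sum>c\<in>C. card (Tc c))"
  proof -
    have "T = (\<Union>c\<in>C. Tc c)" by (auto simp: C_def Tc_def)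
    then show ?thesis using card_UN_disjoint[OF fC, of Tc] Tc by (auto simp: Tc_def)
  qed
  then have "real (card T) = (\<Sum>c\<in>C. real (card (Tc c)))" by simp
  also have "\<dots> \<le> (\<Sum>c\<in>C. \<Prod>a\<in>A. n a c powr x a)" by (rule sum_mono) (rule IH)
  \<comment> \<open>Edges that avoid \<open>v\<close> are estimated by monotonicity and leave the
    sum. The edges through \<open>v\<close> have total weight at least 1, which is the condition for
    Hoelder's inequality.\<close>
  also have "\<dots> \<le> (\<Sum>c\<in>C. (\<Prod>a\<in>?A0. M a powr x a) * (\<Prod>a\<in>?A1. n a c powr x a))"
    unfolding split
    using x nM n0 by (intro sum_mono mult_right_mono prod_mono conjI prod_nonneg powr_mono2) (auto intro: less_imp_le)
  also have "\<dots> = (\<Prod>a\<in>?A0. M a powr x a) * (\<Sum>c\<in>C. \<Prod>a\<in>?A1. n a c powr x a)" by (simp add: sum_distrib_left)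
  also have "\<dots> \<le> (\<Prod>a\<in>?A0. M a powr x a) * (\<Prod>a\<in>?A1. (\<Sum>c\<in>C. n a c) powr x a)"
    using A fC n0 x insert.prems(6)[of v] by (intro mult_left_mono hoelder_sum prod_nonneg) auto
  also have "\<dots> = (\<Prod>a\<in>A. M a powr x a)" unfolding split by (simp add: sumM)
  finally show ?case by (simp add: M_def)
qed

section \<open>Adornments as conjunctive queries and the size of their answers\<close>

definition matches :: "(nat \<Rightarrow> nat list set) \<Rightarrow> (nat \<Rightarrow> nat) \<Rightarrow> aatom \<Rightarrow> bool" where
  "matches E \<theta> a \<longleftrightarrow> (\<exists>ys\<in>E (fst a). list_all2 (\<lambda>t y. \<forall>u. t = Some u \<longrightarrow> ground_trm \<theta> u = y) (snd a) ys)"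

text \<open>The answer of the adornment read as a conjunctive query. In \<open>matches\<close> a
  hidden argument constrains nothing and each atom chooses its own tuple, which is the meaning of
  \<open>_\<close> as a fresh existential variable.\<close>

definition instances :: "(nat \<Rightarrow> nat list set) \<Rightarrow> adornment \<Rightarrow> nat list set" where
  "instances E \<rho> = {map (ground_trm \<theta>) (snd (fst \<rho>)) | \<theta>. \<forall>a\<in>snd \<rho>. matches E \<theta> a}"

lemma finite_args_vars [simp]: "finite (args_vars ts)"
proof -
  have "finite (trm_vars t)" for t by (cases t) auto
  then show ?thesis by (simp add: args_vars_def)
qed

lemma ground_trm_cong: "(\<And>v. v \<in> trm_vars t \<Longrightarrow> \<theta> v = \<theta>' v) \<Longrightarrow> ground_trm \<theta> t = ground_trm \<theta>' t"
  by (cases t) auto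

lemma map_ground_cong: "(\<And>v. v \<in> args_vars ts \<Longrightarrow> \<theta> v = \<theta>' v) \<Longrightarrow> map (ground_trm \<theta>) ts = map (ground_trm \<theta>') ts"
  by (auto simp: args_vars_def intro!: ground_trm_cong)

text \<open>A matched tuple fixes the valuation on the variables of its atom. Hence the restrictions
  of valuations to one edge are no more numerous than the tuples of its relation.\<close>

lemma matches_determined:
  assumes "list_all2 (\<lambda>t y. \<forall>u. t = Some u \<longrightarrow> ground_trm \<theta> u = y) ts ys"
    "list_all2 (\<lambda>t y. \<forall>u. t = Some u \<longrightarrow> ground_trm \<theta>' u = y) ts ys" "Some (Var v) \<in> set ts"
  shows "\<theta> v = \<theta>' v" "\<theta> v \<in> set ys"
proof -
  obtain i where i: "i < length ts" "ts ! i = Some (Var v)" using assms(3) by (metis in_set_conv_nth)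
  have l: "length ys = length ts" using assms(1) by (simp add: list_all2_lengthD)
  have "ground_trm \<theta> (Var v) = ys ! i" "ground_trm \<theta>' (Var v) = ys ! i"
    using assms(1,2) i by (auto dest!: list_all2_nthD)
  then show "\<theta> v = \<theta>' v" "\<theta> v \<in> set ys" using l i by auto
qed

lemma aatom_vars_iff: "v \<in> aatom_vars a \<longleftrightarrow> Some (Var v) \<in> set (snd a)"
proof
  assume "v \<in> aatom_vars a"
  then obtain t where "Some t \<in> set (snd a)" "v \<in> trm_vars t" by (auto simp: aatom_vars_def)
  then show "Some (Var v) \<in> set (snd a)" by (cases t) auto
next
  assume "Some (Var v) \<in> set (snd a)"
  then show "v \<in> aatom_vars a" by (auto simp: aatom_vars_def intro!: exI[of _ "Var v"])
qed

text \<open>The vertices are the head variables, the edges the variable sets of the body atoms.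
  \<open>T\<close> collects the satisfying valuations cut down to the head variables: this makes it
  finite and still determines the instances.\<close>

lemma instances_cover_bound:
  assumes fin: "finite (snd \<rho>)" and E: "\<And>a. a \<in> snd \<rho> \<Longrightarrow> finite (E (fst a)) \<and> card (E (fst a)) \<le> N"
    and N: "1 \<le> N" and cover: "fractional_edge_cover \<rho> x"
  shows "finite (instances E \<rho>)" "real (card (instances E \<rho>)) \<le> real N powr (\<Sum>a\<in>snd \<rho>. x a)"
proof -
  define V where "V = head_vars \<rho>"
  have fV: "finite V" by (simp add: V_def head_vars_def)
  define \<Theta> where "\<Theta> = {\<theta>. \<forall>a\<in>snd \<rho>. matches E \<theta> a}"
  define T where "T = cut V ` \<Theta>"
  have c: "1 \<le> (\<Sum>a\<in>{a\<in>snd \<rho>. v \<in> aatom_vars a}. x a)" if "v \<in> V" for v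
    using cover that by (simp add: fractional_edge_cover_def V_def)
  have ex: "\<exists>a\<in>snd \<rho>. v \<in> aatom_vars a" if "v \<in> V" for v
  proof (rule ccontr)
    assume "\<not> ?thesis"
    then have e: "{a\<in>snd \<rho>. v \<in> aatom_vars a} = {}" by blast
    show False using c[OF that] unfolding e by simp
  qed
  define U where "U = (\<Union>a\<in>snd \<rho>. \<Union>ys\<in>E (fst a). set ys)"
  have fU: "finite U" using fin E by (auto simp: U_def)
  \<comment> \<open>A covered head variable occurs in some atom and takes its value from a stored
    tuple, so only finitely many functions are possible.\<close>
  have "T \<subseteq> {f. \<forall>v. (v \<in> V \<longrightarrow> f v \<in> U) \<and> (v \<notin> V \<longrightarrow> f v = 0)}"
  proof
    fix f assume "f \<in> T"
    then obtain \<theta> where \<theta>: "\<theta> \<in> \<Theta>" "f = cut V \<theta>" by (auto simp: T_def)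
    have "\<theta> v \<in> U" if "v \<in> V" for v
    proof -
      obtain a where a: "a \<in> snd \<rho>" "v \<in> aatom_vars a" using ex[OF \<open>v \<in> V\<close>] by blast
      then obtain ys where ys: "ys \<in> E (fst a)" "list_all2 (\<lambda>t y. \<forall>u. t = Some u \<longrightarrow> ground_trm \<theta> u = y) (snd a) ys"
        using \<theta>(1) by (auto simp: \<Theta>_def matches_def)
      then have "\<theta> v \<in> set ys" using matches_determined(2)[OF ys(2) ys(2)] a(2) by (simp add: aatom_vars_iff)
      then show ?thesis using a ys by (auto simp: U_def)
    qed
    then show "f \<in> {f. \<forall>v. (v \<in> V \<longrightarrow> f v \<in> U) \<and> (v \<notin> V \<longrightarrow> f v = 0)}" by (simp add: \<theta> cut_def)
  qed
  then have fT: "finite T" using finite_set_of_finite_funs[OF fV fU] finite_subset by blast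
  have inst: "instances E \<rho> = (\<lambda>f. map (ground_trm f) (snd (fst \<rho>))) ` T"
  proof -
    have "map (ground_trm (cut V \<theta>)) (snd (fst \<rho>)) = map (ground_trm \<theta>) (snd (fst \<rho>))" for \<theta>
      by (rule map_ground_cong) (simp add: cut_def V_def head_vars_def)
    then show ?thesis by (auto simp: instances_def T_def \<Theta>_def image_image)
  qed
  then show "finite (instances E \<rho>)" using fT by simp
  show "real (card (instances E \<rho>)) \<le> real N powr (\<Sum>a\<in>snd \<rho>. x a)"
  proof (cases "T = {}")
    case True
    then show ?thesis by (simp add: inst)
  next
    case False
    have proj: "card (cut (aatom_vars a) ` T) \<le> N" if a: "a \<in> snd \<rho>" for a
    proof -
      define Y where "Y ys \<theta> \<longleftrightarrow> list_all2 (\<lambda>t y. \<forall>u. t = Some u \<longrightarrow> ground_trm \<theta> u = y) (snd a) ys" for ys \<theta>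
      \<comment> \<open>Some matching valuation is picked for each tuple. On the variables of
        \<open>a\<close> the tuple leaves no choice, so every restriction is reached from a
        tuple.\<close>
      define F where "F ys = cut (aatom_vars a) (cut V (SOME \<theta>. Y ys \<theta>))" for ys
      have "cut (aatom_vars a) ` T \<subseteq> F ` E (fst a)"
      proof
        fix g assume "g \<in> cut (aatom_vars a) ` T"
        then obtain \<theta> where \<theta>: "\<theta> \<in> \<Theta>" "g = cut (aatom_vars a) (cut V \<theta>)" by (auto simp: T_def)
        then obtain ys where ys: "ys \<in> E (fst a)" "Y ys \<theta>" using a by (auto simp: \<Theta>_def matches_def Y_def)
        define \<theta>1 where "\<theta>1 = (SOME \<theta>. Y ys \<theta>)"
        have Y1: "Y ys \<theta>1" unfolding \<theta>1_def using someI[of "Y ys", OF ys(2)] .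
        have "\<theta>1 v = \<theta> v" if "v \<in> aatom_vars a" for v
          using matches_determined(1)[OF Y1[unfolded Y_def] ys(2)[unfolded Y_def]] that by (simp add: aatom_vars_iff)
        then have "g = F ys" by (auto simp: \<theta>(2) F_def \<theta>1_def[symmetric] fun_eq_iff cut_def)
        then show "g \<in> F ` E (fst a)" using ys by blast
      qed
      then have "card (cut (aatom_vars a) ` T) \<le> card (E (fst a))"
        using E[OF a] by (meson card_image_le card_mono finite_imageI le_trans)
      then show ?thesis using E[OF a] by simp
    qed
    have x0: "0 \<le> x a" if "a \<in> snd \<rho>" for a using cover that by (simp add: fractional_edge_cover_def)
    have "card (instances E \<rho>) \<le> card T" unfolding inst by (rule card_image_le[OF fT])
    then have "real (card (instances E \<rho>)) \<le> real (card T)" by simp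
    also have "\<dots> \<le> (\<Prod>a\<in>snd \<rho>. real (card (cut (aatom_vars a) ` T)) powr x a)"
    proof (rule agm_bound[OF fV fT False fin])
      show "f = g" if "f \<in> T" "g \<in> T" "\<And>v. v \<in> V \<Longrightarrow> f v = g v" for f g
        using that by (auto simp: T_def cut_def fun_eq_iff)
    qed (use x0 c in auto)
    also have "\<dots> \<le> (\<Prod>a\<in>snd \<rho>. real N powr x a)"
      using proj x0 by (intro prod_mono conjI powr_mono2) auto
    also have "\<dots> = real N powr (\<Sum>a\<in>snd \<rho>. x a)" using fin N by (simp add: powr_sum)
    finally show ?thesis .
  qed
qed

lemma instances_ew_bound:
  assumes fin: "finite (snd \<rho>)" and E: "\<And>a. a \<in> snd \<rho> \<Longrightarrow> finite (E (fst a)) \<and> card (E (fst a)) \<le> N"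
    and N: "1 \<le> N" and hv: "head_vars \<rho> \<subseteq> (\<Union>a\<in>snd \<rho>. aatom_vars a)"
  shows "finite (instances E \<rho>)" "real (card (instances E \<rho>)) \<le> real N powr ew_adornment \<rho>"
proof -
  define W where "W = {\<Sum>a\<in>snd \<rho>. x a | x. fractional_edge_cover \<rho> x}"
  \<comment> \<open>Weight 1 on every atom is a cover because each head variable occurs in the body,
    so the infimum is taken over a nonempty set.\<close>
  have "fractional_edge_cover \<rho> (\<lambda>_. 1)"
    unfolding fractional_edge_cover_def
  proof (intro conjI ballI)
    fix v assume "v \<in> head_vars \<rho>"
    then obtain a where "a \<in> {a\<in>snd \<rho>. v \<in> aatom_vars a}" using hv by auto
    then have "0 < card {a\<in>snd \<rho>. v \<in> aatom_vars a}" unfolding card_gt_0_iff by (intro conjI finite_subset[OF _ fin]) blast+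
    then show "1 \<le> (\<Sum>a\<in>{a\<in>snd \<rho>. v \<in> aatom_vars a}. 1::real)" by simp
  qed auto
  then have ne: "W \<noteq> {}" and fi: "finite (instances E \<rho>)"
    using instances_cover_bound(1)[where E=E and N=N and \<rho>=\<rho>, OF fin E N] by (auto simp: W_def)
  show "finite (instances E \<rho>)" by fact
  show "real (card (instances E \<rho>)) \<le> real N powr ew_adornment \<rho>"
  proof (cases "N = 1 \<or> instances E \<rho> = {}")
    case True
    then show ?thesis
    proof
      assume "N = 1"
      obtain x where "fractional_edge_cover \<rho> x" using ne by (auto simp: W_def)
      from instances_cover_bound(2)[where E=E and N=N and \<rho>=\<rho>, OF fin E N this] show ?thesis using \<open>N = 1\<close> by simp
    qed simp
  next
    case False
    then have N1: "1 < real N" and p: "0 < real (card (instances E \<rho>))"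
      using N fi by (auto simp: card_gt_0_iff)
    have "log (real N) (real (card (instances E \<rho>))) \<le> Inf W"
    proof (rule cInf_greatest[OF ne])
      fix w assume "w \<in> W"
      then obtain x where x: "fractional_edge_cover \<rho> x" "w = (\<Sum>a\<in>snd \<rho>. x a)" by (auto simp: W_def)
      show "log (real N) (real (card (instances E \<rho>))) \<le> w"
        using instances_cover_bound(2)[where E=E and N=N and \<rho>=\<rho>, OF fin E N x(1)] N1 p unfolding x(2) by (simp add: log_le_iff)
    qed
    then have "real (card (instances E \<rho>)) \<le> real N powr Inf W" using N1 p by (simp add: log_le_iff)
    then show ?thesis by (simp add: ew_adornment_def W_def)
  qed
qed

section \<open>Unification and variants of adornments\<close>

lemma subst_comp: "subst_trm \<delta> (subst_trm \<sigma> t) = subst_trm (\<lambda>x. subst_trm \<delta> (\<sigma> x)) t"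
  by (cases t) auto

lemma subst_Var [simp]: "subst_trm Var t = t"
  by (cases t) auto

text \<open>Without function symbols unification is flat: after applying the mgu of the remaining
  pairs, the two terms are equal constants, or one of them is a variable that can be bound to the
  other.\<close>

lemma mgu_pairs:
  assumes "\<forall>(s, t)\<in>set P. subst_trm \<tau> s = subst_trm \<tau> t"
  shows "\<exists>\<sigma>. (\<forall>(s, t)\<in>set P. subst_trm \<sigma> s = subst_trm \<sigma> t) \<and>
    (\<forall>\<tau>. (\<forall>(s, t)\<in>set P. subst_trm \<tau> s = subst_trm \<tau> t) \<longrightarrow> (\<exists>\<delta>. \<forall>x. \<tau> x = subst_trm \<delta> (\<sigma> x)))"
  using assms
proof (induction P)
  case Nil
  have "\<forall>\<tau>. \<exists>\<delta>. \<forall>x. \<tau> x = subst_trm \<delta> (Var x)" by (intro allI exI) simp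
  then show ?case by (intro exI[of _ Var]) simp
next
  case (Cons p P)
  obtain s t where p: "p = (s, t)" by (cases p)
  obtain \<sigma> where \<sigma>: "\<forall>(s, t)\<in>set P. subst_trm \<sigma> s = subst_trm \<sigma> t"
    "\<And>\<tau>. \<forall>(s, t)\<in>set P. subst_trm \<tau> s = subst_trm \<tau> t \<Longrightarrow> \<exists>\<delta>. \<forall>x. \<tau> x = subst_trm \<delta> (\<sigma> x)"
    using Cons by auto
  \<comment> \<open>A unifier of all pairs factors through the mgu \<open>\<sigma>\<close> of the
    tail, and its second factor still has to identify the images of \<open>s\<close> and
    \<open>t\<close>.\<close>
  have step: "\<exists>\<delta>. (\<forall>x. \<tau>' x = subst_trm \<delta> (\<sigma> x)) \<and> subst_trm \<delta> (subst_trm \<sigma> s) = subst_trm \<delta> (subst_trm \<sigma> t)"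
    if \<tau>': "\<forall>(s, t)\<in>set (p # P). subst_trm \<tau>' s = subst_trm \<tau>' t" for \<tau>'
  proof -
    obtain \<delta> where \<delta>: "\<forall>x. \<tau>' x = subst_trm \<delta> (\<sigma> x)" using \<sigma>(2)[of \<tau>'] \<tau>' by auto
    then have "\<tau>' = (\<lambda>x. subst_trm \<delta> (\<sigma> x))" by auto
    then show ?thesis using \<tau>' \<delta> p by (intro exI[of _ \<delta>]) (simp add: subst_comp)
  qed
  \<comment> \<open>Stating the images as an unordered pair covers a variable on either
    side.\<close>
  have bind: ?case if st: "{subst_trm \<sigma> s, subst_trm \<sigma> t} = {Var x, u}" for x u
  proof -
    define \<mu> where "\<mu> = Var(x := u)"
    define \<sigma>' where "\<sigma>' = (\<lambda>y. subst_trm \<mu> (\<sigma> y))"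
    have \<mu>u: "subst_trm \<mu> u = u" if "u \<noteq> Var x" using that by (cases u) (auto simp: \<mu>_def)
    then have \<mu>eq: "subst_trm \<mu> (Var x) = subst_trm \<mu> u" by (cases "u = Var x") (auto simp: \<mu>_def)
    have eq: "subst_trm \<mu> (subst_trm \<sigma> s) = subst_trm \<mu> (subst_trm \<sigma> t)"
      using st \<mu>eq by (auto simp: doubleton_eq_iff)
    have "\<forall>(s, t)\<in>set (p # P). subst_trm \<sigma>' s = subst_trm \<sigma>' t"
    proof (intro ballI, clarify)
      fix s' t' assume "(s', t') \<in> set (p # P)"
      then have "subst_trm \<mu> (subst_trm \<sigma> s') = subst_trm \<mu> (subst_trm \<sigma> t')" using \<sigma>(1) p eq by auto
      then show "subst_trm \<sigma>' s' = subst_trm \<sigma>' t'" by (simp add: \<sigma>'_def subst_comp)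
    qed
    moreover have "\<exists>\<delta>. \<forall>y. \<tau>' y = subst_trm \<delta> (\<sigma>' y)"
      if \<tau>': "\<forall>(s, t)\<in>set (p # P). subst_trm \<tau>' s = subst_trm \<tau>' t" for \<tau>'
    proof -
      obtain \<delta> where \<delta>: "\<forall>y. \<tau>' y = subst_trm \<delta> (\<sigma> y)" "subst_trm \<delta> (subst_trm \<sigma> s) = subst_trm \<delta> (subst_trm \<sigma> t)"
        using step[OF \<tau>'] by blast
      \<comment> \<open>As \<open>\<delta>\<close> identifies \<open>x\<close> with
        \<open>u\<close>, composing it with the binding of \<open>x\<close> changes nothing, so the
        same \<open>\<delta>\<close> witnesses that \<open>\<sigma>'\<close> is most
        general.\<close>
      have "subst_trm \<delta> (Var x) = subst_trm \<delta> u" using st \<delta>(2) by (auto simp: doubleton_eq_iff)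
      then have "(\<lambda>y. subst_trm \<delta> (\<mu> y)) = \<delta>" by (auto simp: \<mu>_def fun_eq_iff)
      then have "subst_trm \<delta> (\<sigma>' y) = subst_trm \<delta> (\<sigma> y)" for y by (simp add: \<sigma>'_def subst_comp)
      then show ?thesis using \<delta>(1) by (intro exI[of _ \<delta>]) simp
    qed
    ultimately show ?case by blast
  qed
  show ?case
  proof (cases "subst_trm \<sigma> s")
    case (Var x)
    then show ?thesis using bind[of x "subst_trm \<sigma> t"] by simp
  next
    case s: (Cst c)
    show ?thesis
    proof (cases "subst_trm \<sigma> t")
      case (Var x)
      then show ?thesis using bind[of x "subst_trm \<sigma> s"] by (simp add: insert_commute)
    next
      case t: (Cst d)
      have "c = d" using step[OF Cons.prems] s t by auto
      then show ?thesis using \<sigma> p s t by (intro exI[of _ \<sigma>]) simp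
    qed
  qed
qed

text \<open>The given unifier forces the paired lists to have equal lengths, so the problem flattens
  without loss to pairs of terms at equal positions.\<close>

lemma mgu_exists:
  assumes "unifier \<tau> E"
  shows "\<exists>\<sigma>. is_mgu \<sigma> E"
proof -
  define P where "P = concat (map (\<lambda>(ss, ts). zip ss ts) E)"
  have len: "length ss = length ts" if "(ss, ts) \<in> set E" for ss ts
  proof -
    have "map (subst_trm \<tau>) ss = map (subst_trm \<tau>) ts" using assms that by (fastforce simp: unifier_def)
    then show ?thesis by (rule map_eq_imp_length_eq)
  qed
  have z: "map f ss = map f ts \<longleftrightarrow> (\<forall>(s, t)\<in>set (zip ss ts). f s = f t)" if "length ss = length ts" for f and ss ts :: "trm list"
    using that by (induction ss ts rule: list_induct2) auto
  have *: "unifier \<tau>' E \<longleftrightarrow> (\<forall>(s, t)\<in>set P. subst_trm \<tau>' s = subst_trm \<tau>' t)" for \<tau>'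
    using z[OF len] by (fastforce simp: unifier_def P_def)
  show ?thesis unfolding is_mgu_def * by (rule mgu_pairs) (use assms * in blast)
qed

text \<open>A constant introduced by \<open>\<sigma>\<close> could be exchanged for another one, which would give a unifier that
  is not an instance of \<open>\<sigma>\<close>.\<close>

lemma mgu_consts:
  assumes "is_mgu \<sigma> E" "\<sigma> x = Cst c"
  shows "\<exists>(ss, ts)\<in>set E. Cst c \<in> set ss \<union> set ts"
proof (rule ccontr)
  assume n: "\<not> ?thesis"
  define sw where "sw = (\<lambda>t. if t = Cst c then Cst (Suc c) else t)"
  have sw: "subst_trm (\<lambda>y. sw (\<sigma> y)) t = sw (subst_trm \<sigma> t)" if "t \<noteq> Cst c" for t
    using that by (cases t) (auto simp: sw_def)
  have "unifier (\<lambda>y. sw (\<sigma> y)) E"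
    unfolding unifier_def
  proof (intro ballI, clarify)
    fix ss ts assume e: "(ss, ts) \<in> set E"
    then have cs: "Cst c \<notin> set ss" "Cst c \<notin> set ts" using n by fastforce+
    then have "map (subst_trm (\<lambda>y. sw (\<sigma> y))) ss = map (sw \<circ> subst_trm \<sigma>) ss"
      "map (subst_trm (\<lambda>y. sw (\<sigma> y))) ts = map (sw \<circ> subst_trm \<sigma>) ts"
      using sw by (auto intro!: map_cong) (metis, metis)
    moreover have "map (subst_trm \<sigma>) ss = map (subst_trm \<sigma>) ts" using assms(1) e by (auto simp: is_mgu_def unifier_def)
    ultimately show "map (subst_trm (\<lambda>y. sw (\<sigma> y))) ss = map (subst_trm (\<lambda>y. sw (\<sigma> y))) ts"
      by (metis map_map)
  qed
  then obtain \<delta> where "\<forall>y. sw (\<sigma> y) = subst_trm \<delta> (\<sigma> y)" using assms(1) unfolding is_mgu_def by blast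
  then have "sw (Cst c) = subst_trm \<delta> (Cst c)" using assms(2) by metis
  then show False by (simp add: sw_def)
qed

lemma ground_subst: "ground_trm \<theta> (subst_trm \<sigma> t) = ground_trm (\<lambda>x. ground_trm \<theta> (\<sigma> x)) t"
  by (cases t) auto

lemma subst_aatom_comp: "subst_aatom \<delta> (subst_aatom \<sigma> a) = subst_aatom (\<lambda>x. subst_trm \<delta> (\<sigma> x)) a"
  by (auto simp: subst_aatom_def option.map_comp comp_def subst_comp)

lemma subst_adornment_comp: "subst_adornment \<delta> (subst_adornment \<sigma> \<rho>) = subst_adornment (\<lambda>x. subst_trm \<delta> (\<sigma> x)) \<rho>"
  by (auto simp: subst_adornment_def subst_aatom_comp image_image subst_comp)

lemma subst_aatom_Var [simp]: "subst_aatom Var a = a"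
  by (simp add: subst_aatom_def option.map_ident_strong list.map_ident_strong)

lemma subst_adornment_Var [simp]: "subst_adornment Var \<rho> = \<rho>"
  by (simp add: subst_adornment_def list.map_ident_strong)

lemma subst_Var_inv:
  assumes "bij \<pi>"
  shows "subst_aatom (Var \<circ> inv \<pi>) (subst_aatom (Var \<circ> \<pi>) a) = a"
    "subst_adornment (Var \<circ> inv \<pi>) (subst_adornment (Var \<circ> \<pi>) \<rho>) = \<rho>"
proof -
  have "(\<lambda>x. subst_trm (Var \<circ> inv \<pi>) ((Var \<circ> \<pi>) x)) = Var"
    using assms by (auto simp: fun_eq_iff bij_is_inj)
  then show "subst_aatom (Var \<circ> inv \<pi>) (subst_aatom (Var \<circ> \<pi>) a) = a"
    "subst_adornment (Var \<circ> inv \<pi>) (subst_adornment (Var \<circ> \<pi>) \<rho>) = \<rho>"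
    by (simp_all only: subst_aatom_comp subst_adornment_comp subst_aatom_Var subst_adornment_Var)
qed

section \<open>Renaming invariance of instances and of the edge-cover width\<close>

lemma variant_refl: "variant \<rho> \<rho>"
  unfolding variant_def by (intro exI[of _ id]) auto

lemma variant_sym: "variant \<rho> \<rho>' \<Longrightarrow> variant \<rho>' \<rho>"
  unfolding variant_def using subst_Var_inv(2) bij_imp_bij_inv by metis

lemma variant_trans: "variant \<rho> \<rho>' \<Longrightarrow> variant \<rho>' \<rho>'' \<Longrightarrow> variant \<rho> \<rho>''"
proof -
  assume "variant \<rho> \<rho>'" "variant \<rho>' \<rho>''"
  then obtain \<pi> \<pi>' where *: "bij \<pi>" "\<rho>' = subst_adornment (Var \<circ> \<pi>) \<rho>" "bij \<pi>'" "\<rho>'' = subst_adornment (Var \<circ> \<pi>') \<rho>'"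
    by (auto simp: variant_def)
  have "\<rho>'' = subst_adornment (Var \<circ> (\<pi>' \<circ> \<pi>)) \<rho>" unfolding * subst_adornment_comp by (simp add: comp_def)
  then show ?thesis unfolding variant_def using bij_comp[OF *(1) *(3)] by blast
qed

lemma matches_rename: "matches E \<theta> (subst_aatom (Var \<circ> \<pi>) a) \<longleftrightarrow> matches E (\<theta> \<circ> \<pi>) a"
proof -
  have "ground_trm \<theta> (subst_trm (Var \<circ> \<pi>) u) = ground_trm (\<theta> \<circ> \<pi>) u" for u
    by (simp add: ground_subst comp_def)
  then have "(\<forall>u. map_option (subst_trm (Var \<circ> \<pi>)) t = Some u \<longrightarrow> ground_trm \<theta> u = y) \<longleftrightarrow>
    (\<forall>u. t = Some u \<longrightarrow> ground_trm (\<theta> \<circ> \<pi>) u = y)" for t y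
    by (cases t) auto
  then show ?thesis
    by (simp add: matches_def subst_aatom_def list.rel_map)
qed

text \<open>A satisfying valuation composed with the inverse renaming satisfies the renamed body and
  produces the same tuple.\<close>

lemma instances_variant_subset:
  assumes "bij \<pi>"
  shows "instances E \<rho> \<subseteq> instances E (subst_adornment (Var \<circ> \<pi>) \<rho>)"
proof
  fix xs assume "xs \<in> instances E \<rho>"
  then obtain \<theta> where \<theta>: "xs = map (ground_trm \<theta>) (snd (fst \<rho>))" "\<forall>a\<in>snd \<rho>. matches E \<theta> a"
    by (auto simp: instances_def)
  have id: "\<theta> \<circ> inv \<pi> \<circ> \<pi> = \<theta>" using assms by (auto simp: fun_eq_iff bij_is_inj)
  have g: "ground_trm (\<theta> \<circ> inv \<pi>) (subst_trm (Var \<circ> \<pi>) t) = ground_trm \<theta> t" for t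
    using id by (simp add: ground_subst comp_def)
  show "xs \<in> instances E (subst_adornment (Var \<circ> \<pi>) \<rho>)"
    unfolding instances_def
    by (rule CollectI, rule exI[of _ "\<theta> \<circ> inv \<pi>"]) (use \<theta> g id in \<open>auto simp: subst_adornment_def matches_rename\<close>)
qed

lemma instances_variant: "variant \<rho> \<rho>' \<Longrightarrow> instances E \<rho>' = instances E \<rho>"
  using instances_variant_subset variant_sym unfolding variant_def by (metis subset_antisym)

lemma subst_rename_vars:
  "trm_vars (subst_trm (Var \<circ> \<pi>) t) = \<pi> ` trm_vars t"
  "args_vars (map (subst_trm (Var \<circ> \<pi>)) ts) = \<pi> ` args_vars ts"
proof -
  show *: "trm_vars (subst_trm (Var \<circ> \<pi>) t) = \<pi> ` trm_vars t" for t by (cases t) auto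
  show "args_vars (map (subst_trm (Var \<circ> \<pi>)) ts) = \<pi> ` args_vars ts"
    unfolding args_vars_def set_map image_UN UN_simps(10) * ..
qed

lemma aatom_vars_alt: "aatom_vars a = (\<Union>t\<in>set (snd a). case t of None \<Rightarrow> {} | Some u \<Rightarrow> trm_vars u)"
  by (fastforce simp: aatom_vars_def split: option.splits)

lemma aatom_vars_rename: "aatom_vars (subst_aatom (Var \<circ> \<pi>) a) = \<pi> ` aatom_vars a"
proof -
  have "(case map_option (subst_trm (Var \<circ> \<pi>)) t of None \<Rightarrow> {} | Some u \<Rightarrow> trm_vars u) =
    \<pi> ` (case t of None \<Rightarrow> {} | Some u \<Rightarrow> trm_vars u)" for t
    by (cases t) (simp_all add: subst_rename_vars)
  then show ?thesis by (auto simp: aatom_vars_alt subst_aatom_def)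
qed

lemma head_vars_rename: "head_vars (subst_adornment (Var \<circ> \<pi>) \<rho>) = \<pi> ` head_vars \<rho>"
  by (simp add: head_vars_def subst_adornment_def subst_rename_vars)

text \<open>A renaming maps the body bijectively and preserves which variables lie on which atom, so
  covers are transported along its inverse with equal weight. One inclusion suffices because
  \<open>variant\<close> is symmetric.\<close>

lemma ew_variant:
  assumes "variant \<rho> \<rho>'"
  shows "ew_adornment \<rho>' = ew_adornment \<rho>"
proof -
  have "{\<Sum>a\<in>snd \<rho>. x a | x. fractional_edge_cover \<rho> x} \<subseteq> {\<Sum>a\<in>snd \<rho>'. x a | x. fractional_edge_cover \<rho>' x}"
    if var: "variant \<rho> \<rho>'" for \<rho> \<rho>'
  proof
    fix w assume "w \<in> {\<Sum>a\<in>snd \<rho>. x a | x. fractional_edge_cover \<rho> x}"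
    then obtain x where x: "w = (\<Sum>a\<in>snd \<rho>. x a)" "fractional_edge_cover \<rho> x" by blast
    obtain \<pi> where \<pi>: "bij \<pi>" "\<rho>' = subst_adornment (Var \<circ> \<pi>) \<rho>" using var by (auto simp: variant_def)
    define f where "f = subst_aatom (Var \<circ> \<pi>)"
    define y where "y = (\<lambda>b. x (subst_aatom (Var \<circ> inv \<pi>) b))"
    have yf: "y (f a) = x a" for a by (simp add: y_def f_def subst_Var_inv[OF \<pi>(1)])
    have inj: "inj_on f A" for A by (rule inj_on_inverseI[of _ "subst_aatom (Var \<circ> inv \<pi>)"]) (simp add: f_def subst_Var_inv[OF \<pi>(1)])
    have B: "snd \<rho>' = f ` snd \<rho>" by (simp add: \<pi>(2) subst_adornment_def f_def)
    have sum: "sum y (f ` A) = sum x A" for A by (simp add: sum.reindex[OF inj] yf)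
    have "fractional_edge_cover \<rho>' y"
      unfolding fractional_edge_cover_def B
    proof (intro conjI ballI)
      fix v assume "v \<in> head_vars \<rho>'"
      then obtain u where u: "u \<in> head_vars \<rho>" "v = \<pi> u" by (auto simp: \<pi>(2) head_vars_rename)
      have e: "{a \<in> f ` snd \<rho>. v \<in> aatom_vars a} = f ` {a \<in> snd \<rho>. u \<in> aatom_vars a}"
      proof -
        have "v \<in> aatom_vars (f a) \<longleftrightarrow> u \<in> aatom_vars a" for a
          unfolding f_def aatom_vars_rename u(2) by (rule inj_image_mem_iff[OF bij_is_inj[OF \<pi>(1)]])
        then show ?thesis by blast
      qed
      then show "1 \<le> (\<Sum>a | a \<in> f ` snd \<rho> \<and> v \<in> aatom_vars a. y a)"
        unfolding e sum using x(2) u(1) unfolding fractional_edge_cover_def by blast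
    next
      fix b assume "b \<in> f ` snd \<rho>"
      then obtain a where "a \<in> snd \<rho>" "b = f a" by blast
      then show "0 \<le> y b" "y b \<le> 1" using x(2) yf unfolding fractional_edge_cover_def by simp_all
    qed
    moreover have "w = (\<Sum>b\<in>snd \<rho>'. y b)" by (simp add: B sum x)
    ultimately show "w \<in> {\<Sum>a\<in>snd \<rho>'. x a | x. fractional_edge_cover \<rho>' x}" by blast
  qed
  from subset_antisym[OF this[OF variant_sym[OF assms]] this[OF assms]] show ?thesis
    unfolding ew_adornment_def by (rule arg_cong)
qed

lemma g_out_fst [simp]: "fst (g_out h B) = h"
  by (simp add: g_out_def Let_def)

lemma g_out_body: "snd (g_out h B) \<subseteq> hide_args (snd h) ` B"
  by (auto simp: g_out_def Let_def)

text \<open>Removal of subsumed atoms must not lose a head term. Among the atoms showing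
  \<open>u\<close>, one with the most visible arguments is safe: an atom subsuming it would show
  \<open>u\<close> as well and have more visible arguments.\<close>

lemma g_out_keeps:
  assumes "finite B" "a \<in> B" "Some u \<in> set (snd a)" "u \<in> set (snd h)"
  shows "\<exists>b\<in>snd (g_out h B). Some u \<in> set (snd b)"
proof -
  define C where "C = {b \<in> hide_args (snd h) ` B. Some u \<in> set (snd b)}"
  define m where "m b = length (filter (\<lambda>t. t \<noteq> None) (snd b))" for b :: aatom
  have "hide_args (snd h) a \<in> C"
    using assms(2-4) by (force simp: C_def hide_args_def image_iff)
  moreover have "finite C" using assms(1) by (simp add: C_def)
  ultimately obtain b where b: "b \<in> C" "\<And>c. c \<in> C \<Longrightarrow> m c \<le> m b"
    using Max_in[of "m ` C"] Max_ge[of "m ` C"] by (metis (no_types, lifting) empty_iff finite_imageI imageE image_eqI)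
  have lt: "ts = ts' \<or> length (filter (\<lambda>t. t \<noteq> None) ts) < length (filter (\<lambda>t. t \<noteq> None) ts')"
    if "list_all2 (\<lambda>t t'. t = t' \<or> t = None) ts ts'" for ts ts' :: "trm option list"
    using that by (induction rule: list_all2_induct) auto
  have "\<not> subsumed b c" if "c \<in> hide_args (snd h) ` B" "c \<noteq> b" for c
  proof
    assume s: "subsumed b c"
    then have "m b < m c" using lt[of "snd b" "snd c"] that(2) by (auto simp: subsumed_def m_def prod_eq_iff)
    moreover have "Some u \<in> set (snd c)"
    proof -
      obtain i where i: "i < length (snd b)" "snd b ! i = Some u" using b(1) by (auto simp: C_def in_set_conv_nth)
      then have "i < length (snd c)" "snd c ! i = Some u"
        using s by (auto simp: subsumed_def list_all2_conv_all_nth)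
      then show ?thesis by (metis nth_mem)
    qed
    ultimately show False using b(2)[of c] that(1) by (auto simp: C_def)
  qed
  moreover have "b \<in> hide_args (snd h) ` B" "\<not> set (snd b) \<subseteq> {None}" using b(1) by (auto simp: C_def)
  ultimately have "b \<in> snd (g_out h B)" unfolding g_out_def Let_def snd_conv by blast
  then show ?thesis using b(1) by (auto simp: C_def)
qed

section \<open>The adorned program\<close>

definition prog_consts :: "rule set \<Rightarrow> nat set" where
  "prog_consts \<Pi> = (\<Union>R\<in>\<Pi>. \<Union>a\<in>set (rhead R # rbody R). {c. Cst c \<in> set (snd a)})"

lemma finite_prog_consts: "finite \<Pi> \<Longrightarrow> finite (prog_consts \<Pi>)"
proof -
  have "finite {c. Cst c \<in> set ts}" for ts
    by (rule finite_surj[of "set ts" _ "\<lambda>t. case t of Cst c \<Rightarrow> c | Var x \<Rightarrow> 0"]) (auto simp: image_iff intro!: bexI split: trm.splits)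
  then show "finite \<Pi> \<Longrightarrow> finite (prog_consts \<Pi>)" by (auto simp: prog_consts_def)
qed

lemma finite_idb: "finite \<Pi> \<Longrightarrow> finite (idb \<Pi>)"
  by (auto simp: idb_def)

lemma finite_predicates: "finite \<Pi> \<Longrightarrow> finite (predicates \<Pi>)"
  by (auto simp: predicates_def)

text \<open>The invariant of generated adornments. Occurrence of the head variables in the body
  makes an edge cover exist; visible body arguments from the head and constants from the program
  leave finitely many adornments up to renaming; EDB body atoms let the bound \<open>N\<close>
  apply.\<close>

definition wf_adornment :: "(nat \<Rightarrow> nat) \<Rightarrow> rule set \<Rightarrow> adornment \<Rightarrow> bool" where
  "wf_adornment ar \<Pi> \<rho> \<longleftrightarrow> finite (snd \<rho>) \<and> fst (fst \<rho>) \<in> idb \<Pi> \<and> length (snd (fst \<rho>)) = ar (fst (fst \<rho>)) \<and>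
     head_vars \<rho> \<subseteq> (\<Union>a\<in>snd \<rho>. aatom_vars a) \<and> (\<forall>c. Cst c \<in> set (snd (fst \<rho>)) \<longrightarrow> c \<in> prog_consts \<Pi>) \<and>
     (\<forall>a\<in>snd \<rho>. fst a \<in> edb \<Pi> \<and> length (snd a) = ar (fst a) \<and>
        (\<forall>u. Some u \<in> set (snd a) \<longrightarrow> u \<in> set (snd (fst \<rho>))))"

lemma wf_adornmentD:
  assumes "wf_adornment ar \<Pi> \<rho>"
  shows "finite (snd \<rho>)" "fst (fst \<rho>) \<in> idb \<Pi>" "length (snd (fst \<rho>)) = ar (fst (fst \<rho>))"
    "head_vars \<rho> \<subseteq> (\<Union>a\<in>snd \<rho>. aatom_vars a)" "Cst c \<in> set (snd (fst \<rho>)) \<Longrightarrow> c \<in> prog_consts \<Pi>"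
    "a \<in> snd \<rho> \<Longrightarrow> fst a \<in> edb \<Pi>" "a \<in> snd \<rho> \<Longrightarrow> length (snd a) = ar (fst a)"
    "a \<in> snd \<rho> \<Longrightarrow> Some u \<in> set (snd a) \<Longrightarrow> u \<in> set (snd (fst \<rho>))"
  using assms unfolding wf_adornment_def by blast+

lemma wf_adornment_vars:
  assumes "wf_adornment ar \<Pi> \<rho>"
  shows "adornment_vars \<rho> = head_vars \<rho>"
proof -
  have "aatom_vars a \<subseteq> head_vars \<rho>" if "a \<in> snd \<rho>" for a
  proof
    fix v assume "v \<in> aatom_vars a"
    then have "Var v \<in> set (snd (fst \<rho>))" using wf_adornmentD(8)[OF assms that] by (simp add: aatom_vars_iff)
    then show "v \<in> head_vars \<rho>" by (force simp: head_vars_def args_vars_def)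
  qed
  then show ?thesis by (auto simp: adornment_vars_def)
qed

lemma wf_adornment_variant:
  assumes "wf_adornment ar \<Pi> \<rho>" "variant \<rho> \<rho>'"
  shows "wf_adornment ar \<Pi> \<rho>'"
proof -
  obtain \<pi> where \<pi>: "bij \<pi>" "\<rho>' = subst_adornment (Var \<circ> \<pi>) \<rho>" using assms(2) by (auto simp: variant_def)
  note w = wf_adornmentD[OF assms(1)]
  have s: "snd \<rho>' = subst_aatom (Var \<circ> \<pi>) ` snd \<rho>" "fst (fst \<rho>') = fst (fst \<rho>)"
    "snd (fst \<rho>') = map (subst_trm (Var \<circ> \<pi>)) (snd (fst \<rho>))" by (simp_all add: \<pi>(2) subst_adornment_def)
  have C: "t = Cst c" if "Cst c = subst_trm (Var \<circ> \<pi>) t" for c t using that by (cases t) auto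
  show ?thesis
    unfolding wf_adornment_def
  proof (intro conjI allI ballI impI)
    show "finite (snd \<rho>')" "fst (fst \<rho>') \<in> idb \<Pi>" "length (snd (fst \<rho>')) = ar (fst (fst \<rho>'))"
      using w by (simp_all add: s)
    show "head_vars \<rho>' \<subseteq> (\<Union>a\<in>snd \<rho>'. aatom_vars a)"
    proof
      fix v assume "v \<in> head_vars \<rho>'"
      then obtain u where u: "u \<in> head_vars \<rho>" "v = \<pi> u" by (auto simp: \<pi>(2) head_vars_rename)
      then obtain a where "a \<in> snd \<rho>" "u \<in> aatom_vars a" using w(4) by blast
      then show "v \<in> (\<Union>a\<in>snd \<rho>'. aatom_vars a)" unfolding s(1) UN_simps(10) aatom_vars_rename u(2) by blast
    qed
    fix c assume "Cst c \<in> set (snd (fst \<rho>'))"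
    then obtain t where "t \<in> set (snd (fst \<rho>))" "Cst c = subst_trm (Var \<circ> \<pi>) t" by (auto simp: s)
    then show "c \<in> prog_consts \<Pi>" using w(5)[of c] C[of c t] by simp
  next
    fix a assume "a \<in> snd \<rho>'"
    then obtain b where b: "b \<in> snd \<rho>" "a = subst_aatom (Var \<circ> \<pi>) b" by (auto simp: s)
    show "fst a \<in> edb \<Pi>" "length (snd a) = ar (fst a)" using w(6,7)[OF b(1)] b(2) by (simp_all add: subst_aatom_def)
    fix u assume "Some u \<in> set (snd a)"
    then obtain t where "Some t \<in> set (snd b)" "u = subst_trm (Var \<circ> \<pi>) t" 
      by (auto simp: b(2) subst_aatom_def) (metis map_option_eq_Some)
    then show "u \<in> set (snd (fst \<rho>'))" using w(8)[OF b(1)] by (auto simp: s)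
  qed
qed

lemma Var_in_subst:
  assumes "v \<in> trm_vars (subst_trm \<sigma> t)"
  obtains x where "t = Var x" "\<sigma> x = Var v"
proof (cases t)
  case (Var x)
  then show ?thesis using assms that by (cases "\<sigma> x") auto
qed (use assms in auto)

text \<open>The delicate point is that head variables remain covered. Safety puts such a variable
  into a body atom. An EDB atom is kept; for an IDB atom the unifier identifies the argument with a
  head argument of its adornment, whose body contains it by induction. \<open>g_out_keeps\<close>
  carries the variable through the removal of atoms.\<close>

lemma adornment_wf:
  assumes prog: "datalog_program ar \<Pi>" and "R' \<in> adorned_program \<Pi>"
  shows "wf_adornment ar \<Pi> (ar_head R')"
  using assms(2)
proof (induction rule: adorned_program.induct)
  case (1 R q ss Is Es \<rho>s \<rho>s' \<sigma> \<rho>)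
  have R: "\<forall>a\<in>set (rhead R # rbody R). length (snd a) = ar (fst a)"
    "args_vars (snd (rhead R)) \<subseteq> (\<Union>a\<in>set (rbody R). args_vars (snd a))"
    using prog \<open>R \<in> \<Pi>\<close> by (auto simp: datalog_program_def)
  have wf: "wf_adornment ar \<Pi> \<rho>'" if m: "\<rho>' \<in> set \<rho>s'" for \<rho>'
  proof -
    obtain i where i: "i < length \<rho>s'" "\<rho>' = \<rho>s' ! i" using m by (metis in_set_conv_nth)
    then have l: "i < length Is" using "1.hyps"(7) by simp
    then obtain R1 where "wf_adornment ar \<Pi> (ar_head R1)" "ar_head R1 = \<rho>s ! i" using "1.IH"[rule_format, OF l] by (elim conjE exE)
    moreover have "variant (\<rho>s ! i) \<rho>'" using "1.hyps"(8)[rule_format, OF l] i(2) by simp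
    ultimately have "wf_adornment ar \<Pi> (\<rho>s ! i)" "variant (\<rho>s ! i) \<rho>'" by simp_all
    then show ?thesis by (rule wf_adornment_variant)
  qed
  define B0 where "B0 = (\<Union>\<rho>'\<in>set \<rho>s'. snd \<rho>') \<union> lift_atom ` set Es"
  define B where "B = subst_aatom \<sigma> ` B0"
  have \<rho>: "\<rho> = g_out (q, map (subst_trm \<sigma>) ss) B" using "1.hyps"(11) by (simp add: B_def B0_def)
  have fB: "finite B" using wf_adornmentD(1)[OF wf] by (auto simp: B_def B0_def)
  have Es: "fst a \<in> edb \<Pi>" "length (snd a) = ar (fst a)" if "a \<in> set Es" for a
    using that "1.hyps"(1,5) R(1) by (auto simp: edb_def predicates_def)
  have B0: "fst a \<in> edb \<Pi> \<and> length (snd a) = ar (fst a)" if "a \<in> B0" for a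
  proof -
    from that consider \<rho>' where "\<rho>' \<in> set \<rho>s'" "a \<in> snd \<rho>'" | e where "e \<in> set Es" "a = lift_atom e"
      unfolding B0_def by blast
    then show ?thesis
    proof cases
      case 1
      then show ?thesis using wf_adornmentD(6,7)[OF wf] by blast
    next
      case 2
      then show ?thesis using Es by (simp add: lift_atom_def)
    qed
  qed
  have uni: "unifier \<sigma> (zip (map snd Is) (map (snd \<circ> fst) \<rho>s'))" using "1.hyps"(10) by (simp add: is_mgu_def)
  have eq: "map (subst_trm \<sigma>) (snd (Is ! i)) = map (subst_trm \<sigma>) (snd (fst (\<rho>s' ! i)))" if "i < length Is" for i
  proof -
    have "zip (map snd Is) (map (snd \<circ> fst) \<rho>s') ! i \<in> set (zip (map snd Is) (map (snd \<circ> fst) \<rho>s'))"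
      using that "1.hyps"(6,7) by (intro nth_mem) simp
    then show ?thesis using uni that "1.hyps"(6,7) by (fastforce simp: unifier_def)
  qed
  have occ: "\<exists>a\<in>B. Some (Var v) \<in> set (snd a)" if v: "v \<in> args_vars (map (subst_trm \<sigma>) ss)" for v
  proof -
    obtain t where t: "t \<in> set ss" "v \<in> trm_vars (subst_trm \<sigma> t)" using v by (auto simp: args_vars_def)
    then obtain x where x: "t = Var x" "\<sigma> x = Var v" by (meson Var_in_subst)
    have "x \<in> args_vars (snd (rhead R))" using t x "1.hyps"(2) by (force simp: args_vars_def)
    then obtain a where a: "a \<in> set (rbody R)" "x \<in> args_vars (snd a)" using R(2) by blast
    then obtain u where "u \<in> set (snd a)" "x \<in> trm_vars u" by (auto simp: args_vars_def)
    then have xa: "Var x \<in> set (snd a)" by (cases u rule: trm.exhaust) auto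
    show ?thesis
    proof (cases "fst a \<in> idb \<Pi>")
      case False
      then have "a \<in> set Es" using a "1.hyps"(5) by simp
      then have "subst_aatom \<sigma> (lift_atom a) \<in> B" by (simp add: B_def B0_def)
      moreover have "Some (Var v) \<in> set (snd (subst_aatom \<sigma> (lift_atom a)))"
        using xa x(2) by (force simp: subst_aatom_def lift_atom_def)
      ultimately show ?thesis by blast
    next
      case True
      then have "a \<in> set Is" using a "1.hyps"(4) by simp
      then obtain i where i: "i < length Is" "a = Is ! i" by (metis in_set_conv_nth)
      have "Var v \<in> set (map (subst_trm \<sigma>) (snd (Is ! i)))" using xa x(2) i by force
      then have "Var v \<in> set (map (subst_trm \<sigma>) (snd (fst (\<rho>s' ! i))))" using eq[OF i(1)] by simp
      then obtain u where u: "u \<in> set (snd (fst (\<rho>s' ! i)))" "Var v = subst_trm \<sigma> u" by auto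
      then obtain y where y: "u = Var y" "\<sigma> y = Var v" by (cases u rule: trm.exhaust) auto
      have mem: "\<rho>s' ! i \<in> set \<rho>s'" using i "1.hyps"(7) by simp
      have "y \<in> head_vars (\<rho>s' ! i)" using u y by (force simp: head_vars_def args_vars_def)
      then obtain b where b: "b \<in> snd (\<rho>s' ! i)" "y \<in> aatom_vars b" using wf_adornmentD(4)[OF wf[OF mem]] by blast
      have "subst_aatom \<sigma> b \<in> B" using b mem by (auto simp: B_def B0_def)
      moreover have "Some (Var v) \<in> set (snd (subst_aatom \<sigma> b))"
        using b(2) y(2) by (force simp: subst_aatom_def aatom_vars_iff)
      ultimately show ?thesis by blast
    qed
  qed
  have "wf_adornment ar \<Pi> \<rho>"
    unfolding wf_adornment_def
  proof (intro conjI allI ballI impI)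
    show "finite (snd \<rho>)" unfolding \<rho> by (rule finite_subset[OF g_out_body]) (use fB in simp)
    show "fst (fst \<rho>) \<in> idb \<Pi>" using "1.hyps"(3) by (simp add: \<rho>)
    show "length (snd (fst \<rho>)) = ar (fst (fst \<rho>))" using "1.hyps"(2) R(1) by (simp add: \<rho>)
    show "head_vars \<rho> \<subseteq> (\<Union>a\<in>snd \<rho>. aatom_vars a)"
    proof
      fix v assume v: "v \<in> head_vars \<rho>"
      then have v': "v \<in> args_vars (map (subst_trm \<sigma>) ss)" by (simp add: head_vars_def \<rho>)
      then obtain t where "t \<in> set (map (subst_trm \<sigma>) ss)" "v \<in> trm_vars t" by (auto simp: args_vars_def)
      then have vh: "Var v \<in> set (snd (q, map (subst_trm \<sigma>) ss))" by (cases t rule: trm.exhaust) auto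
      obtain a where "a \<in> B" "Some (Var v) \<in> set (snd a)" using occ[OF v'] by blast
      then obtain b where "b \<in> snd \<rho>" "Some (Var v) \<in> set (snd b)" using g_out_keeps[OF fB _ _ vh] unfolding \<rho> by blast
      then show "v \<in> (\<Union>a\<in>snd \<rho>. aatom_vars a)" by (auto simp: aatom_vars_iff)
    qed
    fix c assume "Cst c \<in> set (snd (fst \<rho>))"
    then obtain t where t: "t \<in> set ss" "Cst c = subst_trm \<sigma> t" by (auto simp: \<rho>)
    show "c \<in> prog_consts \<Pi>"
    proof (cases t)
      case (Cst d)
      then show ?thesis using t "1.hyps"(1,2) by (force simp: prog_consts_def)
    next
      case (Var x)
      \<comment> \<open>The mgu invents no constants: \<open>c\<close> stands in one of the unified
        lists, that is, in the rule or in the head of an earlier adornment.\<close>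
      then have "\<sigma> x = Cst c" using t by simp
      then obtain us ts where E: "(us, ts) \<in> set (zip (map snd Is) (map (snd \<circ> fst) \<rho>s'))" "Cst c \<in> set us \<union> set ts"
        using mgu_consts \<open>is_mgu \<sigma> _\<close> by blast
      then have "us \<in> snd ` set Is" "ts \<in> (snd \<circ> fst) ` set \<rho>s'" by (auto dest: set_zip_leftD set_zip_rightD)
      then show ?thesis
        using E(2) wf_adornmentD(5)[OF wf] \<open>R \<in> \<Pi>\<close> \<open>Is = _\<close> by (auto simp: prog_consts_def)
    qed
  next
    fix a assume "a \<in> snd \<rho>"
    then obtain b where b: "b \<in> B0" "a = hide_args (map (subst_trm \<sigma>) ss) (subst_aatom \<sigma> b)"
      using g_out_body unfolding \<rho> B_def by fastforce
    show "fst a \<in> edb \<Pi>" "length (snd a) = ar (fst a)" using B0[OF b(1)] by (simp_all add: b(2) hide_args_def subst_aatom_def)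
    fix u assume "Some u \<in> set (snd a)"
    then show "u \<in> set (snd (fst \<rho>))"
      by (auto simp: b(2) hide_args_def \<rho> split: option.splits if_splits)
  qed
  then show ?case by simp
qed

section \<open>Finitely many adornments up to renaming\<close>

lemma bij_into_initial:
  fixes W :: "nat set"
  assumes "finite W" "card W \<le> n"
  shows "\<exists>\<pi>. bij \<pi> \<and> \<pi> ` W \<subseteq> {..<n}"
proof -
  define A where "A = W \<union> {..<n}"
  have fA: "finite A" using assms by (simp add: A_def)
  obtain e where e: "bij_betw e W {..<card W}" using finite_same_card_bij[of W "{..<card W}"] assms by auto
  have sub: "{..<card W} \<subseteq> A" "W \<subseteq> A" using assms(2) by (auto simp: A_def)
  have "card (A - W) = card (A - {..<card W})"
    using fA sub assms(1) by (simp add: card_Diff_subset)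
  then obtain g where g: "bij_betw g (A - W) (A - {..<card W})"
    using finite_same_card_bij[of "A - W" "A - {..<card W}"] fA by auto
  \<comment> \<open>A renaming has to permute all variables. The injection of \<open>W\<close> into
    an initial segment is completed by a bijection of the two complements within the finite set
    \<open>A\<close> and by the identity outside \<open>A\<close>.\<close>
  define \<pi> where "\<pi> x = (if x \<in> W then e x else if x \<in> A then g x else x)" for x
  have 1: "bij_betw \<pi> W {..<card W}" using e by (rule bij_betw_cong[THEN iffD1, rotated]) (simp add: \<pi>_def)
  have 2: "bij_betw \<pi> (A - W) (A - {..<card W})" using g by (rule bij_betw_cong[THEN iffD1, rotated]) (simp add: \<pi>_def)
  have 3: "bij_betw \<pi> (- A) (- A)"
  proof -
    have "bij_betw \<pi> (- A) (- A) \<longleftrightarrow> bij_betw id (- A) (- A)"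
      by (rule bij_betw_cong) (use sub in \<open>auto simp: \<pi>_def\<close>)
    then show ?thesis by simp
  qed
  have "bij_betw \<pi> (W \<union> (A - W)) ({..<card W} \<union> (A - {..<card W}))" by (rule bij_betw_combine[OF 1 2]) auto
  then have "bij_betw \<pi> A A" using sub by (simp add: Un_absorb1)
  from bij_betw_combine[OF this 3] have "bij \<pi>" by (simp add: Compl_partition)
  moreover have "\<pi> ` W \<subseteq> {..<n}" using bij_betw_imp_surj_on[OF 1] assms(2) by auto
  ultimately show ?thesis by blast
qed

text \<open>Representatives of the variant classes. Names below the arity suffice, since a head with
  \<open>ar q\<close> arguments has at most that many variables.\<close>

definition canonical :: "(nat \<Rightarrow> nat) \<Rightarrow> rule set \<Rightarrow> nat \<Rightarrow> adornment set" where
  "canonical ar \<Pi> q = {\<rho>. wf_adornment ar \<Pi> \<rho> \<and> fst (fst \<rho>) = q \<and> head_vars \<rho> \<subseteq> {..<ar q}}"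

lemma finite_canonical:
  assumes "finite \<Pi>"
  shows "finite (canonical ar \<Pi> q)"
proof -
  define T where "T = Var ` {..<ar q} \<union> Cst ` prog_consts \<Pi>"
  have fT: "finite T" using finite_prog_consts[OF assms] by (simp add: T_def)
  define A where "A = (\<Union>p\<in>edb \<Pi>. {p} \<times> {ts. set ts \<subseteq> insert None (Some ` T) \<and> length ts = ar p})"
  have "finite (edb \<Pi>)" using finite_predicates[OF assms] by (simp add: edb_def)
  then have fA: "finite A" unfolding A_def using fT by (intro finite_UN_I finite_cartesian_product finite_lists_length_eq) auto
  have "canonical ar \<Pi> q \<subseteq> ({q} \<times> {ts. set ts \<subseteq> T \<and> length ts = ar q}) \<times> Pow A"
  proof
    fix \<rho> assume "\<rho> \<in> canonical ar \<Pi> q"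
    then have w: "wf_adornment ar \<Pi> \<rho>" and q: "fst (fst \<rho>) = q" and hv: "head_vars \<rho> \<subseteq> {..<ar q}"
      by (auto simp: canonical_def)
    note w' = wf_adornmentD[OF w]
    have T: "set (snd (fst \<rho>)) \<subseteq> T"
    proof
      fix t assume t: "t \<in> set (snd (fst \<rho>))"
      then have "trm_vars t \<subseteq> {..<ar q}" using hv by (auto simp: head_vars_def args_vars_def)
      then show "t \<in> T" using t w'(5) by (cases t rule: trm.exhaust) (auto simp: T_def)
    qed
    have "a \<in> A" if "a \<in> snd \<rho>" for a
    proof -
      have "set (snd a) \<subseteq> insert None (Some ` T)"
      proof
        fix t assume "t \<in> set (snd a)"
        then show "t \<in> insert None (Some ` T)" using w'(8)[OF that] T by (cases t rule: option.exhaust) auto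
      qed
      then show ?thesis using w'(6,7)[OF that] by (cases a) (auto simp: A_def)
    qed
    then show "\<rho> \<in> ({q} \<times> {ts. set ts \<subseteq> T \<and> length ts = ar q}) \<times> Pow A"
      using T w'(3) q by (cases \<rho>) auto
  qed
  moreover have "finite (({q} \<times> {ts. set ts \<subseteq> T \<and> length ts = ar q}) \<times> Pow A)"
    using fA fT finite_lists_length_eq[OF fT] by auto
  ultimately show ?thesis by (rule finite_subset)
qed

lemma canonical_variant:
  assumes "wf_adornment ar \<Pi> \<rho>"
  shows "\<exists>\<rho>'\<in>canonical ar \<Pi> (fst (fst \<rho>)). variant \<rho> \<rho>'"
proof -
  have "card (head_vars \<rho>) \<le> ar (fst (fst \<rho>))"
  proof -
    have "head_vars \<rho> \<subseteq> (\<lambda>t. case t of Var x \<Rightarrow> x | Cst c \<Rightarrow> 0) ` set (snd (fst \<rho>))"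
    proof
      fix v assume "v \<in> head_vars \<rho>"
      then obtain t where "t \<in> set (snd (fst \<rho>))" "v \<in> trm_vars t" by (auto simp: head_vars_def args_vars_def)
      then show "v \<in> (\<lambda>t. case t of Var x \<Rightarrow> x | Cst c \<Rightarrow> 0) ` set (snd (fst \<rho>))" by (cases t rule: trm.exhaust) (auto intro!: rev_image_eqI[of t])
    qed
    then have "card (head_vars \<rho>) \<le> card (set (snd (fst \<rho>)))"
      by (meson List.finite_set card_image_le card_mono finite_imageI le_trans)
    also have "\<dots> \<le> length (snd (fst \<rho>))" by (rule card_length)
    finally show ?thesis using wf_adornmentD(3)[OF assms] by simp
  qed
  then obtain \<pi> where \<pi>: "bij \<pi>" "\<pi> ` head_vars \<rho> \<subseteq> {..<ar (fst (fst \<rho>))}"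
    using bij_into_initial[of "head_vars \<rho>"] by (auto simp: head_vars_def)
  define \<rho>' where "\<rho>' = subst_adornment (Var \<circ> \<pi>) \<rho>"
  have v: "variant \<rho> \<rho>'" using \<pi>(1) by (auto simp: variant_def \<rho>'_def)
  have "head_vars \<rho>' \<subseteq> {..<ar (fst (fst \<rho>))}" using \<pi>(2) by (simp add: \<rho>'_def head_vars_rename)
  moreover have "fst (fst \<rho>') = fst (fst \<rho>)" by (simp add: \<rho>'_def subst_adornment_def)
  ultimately have "\<rho>' \<in> canonical ar \<Pi> (fst (fst \<rho>))"
    using wf_adornment_variant[OF assms v] by (simp add: canonical_def)
  then show ?thesis using v by blast
qed

text \<open>\<open>adornments \<Pi>\<close> is closed under the arbitrary choices of fresh names and
  may be infinite, but the width depends only on the variant class. This finiteness makes the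
  \<open>Max\<close> in \<open>ew\<close> a genuine maximum.\<close>

lemma finite_ew_adornments:
  assumes "datalog_program ar \<Pi>"
  shows "finite (ew_adornment ` adornments \<Pi>)"
proof -
  have fin: "finite \<Pi>" using assms by (simp add: datalog_program_def)
  have "ew_adornment ` adornments \<Pi> \<subseteq> ew_adornment ` (\<Union>q\<in>idb \<Pi>. canonical ar \<Pi> q)"
  proof
    fix w assume "w \<in> ew_adornment ` adornments \<Pi>"
    then obtain R' where R': "R' \<in> adorned_program \<Pi>" "w = ew_adornment (ar_head R')" unfolding adornments_def by blast
    define \<rho> where "\<rho> = ar_head R'"
    have \<rho>: "w = ew_adornment \<rho>" "wf_adornment ar \<Pi> \<rho>"
      using R' adornment_wf[OF assms] by (simp_all add: \<rho>_def)
    obtain \<rho>' where "\<rho>' \<in> canonical ar \<Pi> (fst (fst \<rho>))" "variant \<rho> \<rho>'" using canonical_variant[OF \<rho>(2)] by blast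
    then show "w \<in> ew_adornment ` (\<Union>q\<in>idb \<Pi>. canonical ar \<Pi> q)"
      using ew_variant[of \<rho> \<rho>'] wf_adornmentD(2)[OF \<rho>(2)] \<rho>(1) by (intro image_eqI[of _ _ \<rho>']) auto
  qed
  then show ?thesis using finite_idb[OF fin] finite_canonical[OF fin] by (meson finite_UN finite_imageI finite_subset)
qed

lemma ew_adornment_le:
  "datalog_program ar \<Pi> \<Longrightarrow> \<rho> \<in> adornments \<Pi> \<Longrightarrow> ew_adornment \<rho> \<le> ew \<Pi>"
  unfolding ew_def using finite_ew_adornments by (intro Max_ge) auto

text \<open>On an infinite quotient \<open>card\<close> would be 0 and \<open>num_adornments\<close>
  would count nothing. Each class is the class of a canonical adornment.\<close>

lemma finite_adornment_classes:
  assumes "datalog_program ar \<Pi>"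
  shows "finite ({\<rho> \<in> adornments \<Pi>. fst (fst \<rho>) = q} // {(\<rho>, \<rho>'). variant \<rho> \<rho>'})"
proof -
  have fin: "finite \<Pi>" using assms by (simp add: datalog_program_def)
  let ?r = "{(\<rho>, \<rho>'). variant \<rho> \<rho>'}"
  have "{\<rho> \<in> adornments \<Pi>. fst (fst \<rho>) = q} // ?r \<subseteq> (\<lambda>\<rho>. ?r `` {\<rho>}) ` canonical ar \<Pi> q"
  proof
    fix c assume "c \<in> {\<rho> \<in> adornments \<Pi>. fst (fst \<rho>) = q} // ?r"
    then obtain \<rho> where \<rho>: "\<rho> \<in> adornments \<Pi>" "fst (fst \<rho>) = q" "c = ?r `` {\<rho>}" by (auto elim!: quotientE)
    then have "wf_adornment ar \<Pi> \<rho>" using adornment_wf[OF assms] by (auto simp: adornments_def)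
    then obtain \<rho>' where \<rho>': "\<rho>' \<in> canonical ar \<Pi> q" "variant \<rho> \<rho>'" using canonical_variant \<rho>(2) by blast
    have "?r `` {\<rho>} = ?r `` {\<rho>'}" using \<rho>'(2) variant_trans variant_sym by blast
    then show "c \<in> (\<lambda>\<rho>. ?r `` {\<rho>}) ` canonical ar \<Pi> q" using \<rho>'(1) \<rho>(3) by blast
  qed
  then show ?thesis by (rule finite_subset) (simp add: finite_canonical[OF fin])
qed

lemma adornment_vars_rename: "adornment_vars (subst_adornment (Var \<circ> \<pi>) \<rho>) = \<pi> ` adornment_vars \<rho>"
  unfolding adornment_vars_def head_vars_rename by (simp add: subst_adornment_def aatom_vars_rename image_Un image_UN)

lemma fresh_bij:
  fixes W Z :: "nat set"
  assumes "finite W" "finite Z"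
  shows "\<exists>\<pi>. bij \<pi> \<and> \<pi> ` W \<inter> Z = {}"
proof -
  obtain k where k: "\<forall>x\<in>W \<union> Z. x < k" using finite_nat_set_iff_bounded[of "W \<union> Z"] assms by auto
  \<comment> \<open>The blocks of numbers below \<open>k\<close> and from \<open>k\<close> to
    \<open>2 * k - 1\<close> are exchanged. This is an involution, hence a bijection, and it moves
    \<open>W\<close> above all of \<open>Z\<close>.\<close>
  define \<pi> where "\<pi> x = (if x < k then x + k else if x < 2 * k then x - k else x)" for x
  have "\<pi> (\<pi> x) = x" for x by (auto simp: \<pi>_def)
  then have "bij \<pi>" by (rule involuntory_imp_bij)
  moreover have "\<pi> ` W \<inter> Z = {}" using k by (force simp: \<pi>_def)
  ultimately show ?thesis by blast
qed

text \<open>The adornments are renamed one after the other; the variables of each renamed one join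
  the forbidden set \<open>Z\<close> for the rest.\<close>

lemma fresh_variants:
  assumes "\<forall>\<rho>\<in>set \<rho>s. finite (adornment_vars \<rho>)" "finite Z"
  shows "\<exists>\<rho>s'. length \<rho>s' = length \<rho>s \<and>
    (\<forall>i<length \<rho>s. variant (\<rho>s ! i) (\<rho>s' ! i) \<and> adornment_vars (\<rho>s' ! i) \<inter> Z = {}) \<and>
    (\<forall>i<length \<rho>s. \<forall>j<length \<rho>s. i \<noteq> j \<longrightarrow> adornment_vars (\<rho>s' ! i) \<inter> adornment_vars (\<rho>s' ! j) = {})"
  using assms
proof (induction \<rho>s arbitrary: Z)
  case (Cons \<rho> \<rho>s)
  have f: "finite (adornment_vars \<rho>)" using Cons.prems by simp
  obtain \<pi> where \<pi>: "bij \<pi>" "\<pi> ` adornment_vars \<rho> \<inter> Z = {}" using fresh_bij[OF f Cons.prems(2)] by blast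
  define \<rho>' where "\<rho>' = subst_adornment (Var \<circ> \<pi>) \<rho>"
  have v: "variant \<rho> \<rho>'" "adornment_vars \<rho>' \<inter> Z = {}" "finite (adornment_vars \<rho>')"
    using \<pi> f by (auto simp: variant_def \<rho>'_def adornment_vars_rename)
  obtain \<rho>s' where s: "length \<rho>s' = length \<rho>s"
    "\<forall>i<length \<rho>s. variant (\<rho>s ! i) (\<rho>s' ! i) \<and> adornment_vars (\<rho>s' ! i) \<inter> (Z \<union> adornment_vars \<rho>') = {}"
    "\<forall>i<length \<rho>s. \<forall>j<length \<rho>s. i \<noteq> j \<longrightarrow> adornment_vars (\<rho>s' ! i) \<inter> adornment_vars (\<rho>s' ! j) = {}"
    using Cons.IH[of "Z \<union> adornment_vars \<rho>'"] Cons.prems v(3) by auto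
  show ?case
  proof (intro exI[of _ "\<rho>' # \<rho>s'"] conjI allI impI)
    fix i assume i: "i < length (\<rho> # \<rho>s)"
    show "variant ((\<rho> # \<rho>s) ! i) ((\<rho>' # \<rho>s') ! i)" "adornment_vars ((\<rho>' # \<rho>s') ! i) \<inter> Z = {}"
      using i v s(2) by (cases i; auto)+
    fix j assume j: "j < length (\<rho> # \<rho>s)" "i \<noteq> j"
    show "adornment_vars ((\<rho>' # \<rho>s') ! i) \<inter> adornment_vars ((\<rho>' # \<rho>s') ! j) = {}"
    proof -
      have a: "adornment_vars (\<rho>s' ! i') \<inter> adornment_vars \<rho>' = {}" "adornment_vars \<rho>' \<inter> adornment_vars (\<rho>s' ! i') = {}"
        if "i' < length \<rho>s" for i'
        using s(2) that by blast+
      show ?thesis using i j a s(3) by (cases i; cases j) simp_all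
    qed
  qed (use s in simp)
qed simp

section \<open>The size of the IDB relations\<close>

lemma map_ground_Cst:
  assumes "args_vars ts = {}"
  shows "map Cst (map (ground_trm \<theta>) ts) = ts"
proof -
  have "Cst (ground_trm \<theta> t) = t" if "t \<in> set ts" for t
    using that assms by (cases t rule: trm.exhaust) (auto simp: args_vars_def)
  then show ?thesis by (simp add: map_idI)
qed

text \<open>An EDB fact comes from the database or from a rule with empty body, and safety makes the
  head of such a rule ground. Both sources belong to \<open>edb_relation\<close>.\<close>

lemma edb_fact:
  assumes prog: "datalog_program ar \<Pi>" and "f \<in> least_fixpoint \<Pi> D" "fst f \<notin> idb \<Pi>"
  shows "snd f \<in> edb_relation \<Pi> D (fst f)"
  using assms(2)
proof cases
  case database_fact
  then show ?thesis by (simp add: edb_relation_def)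
next
  case (rule_instance R \<theta>)
  have b: "rbody R = []" using rule_instance assms(3) by (auto simp: idb_def ground_atom_def)
  have "args_vars (snd (rhead R)) \<subseteq> (\<Union>a\<in>set (rbody R). args_vars (snd a))"
    using prog rule_instance(2) by (simp add: datalog_program_def)
  then have "map Cst (map (ground_trm \<theta>) (snd (rhead R))) = snd (rhead R)"
    using b by (intro map_ground_Cst) simp
  then have "Rule (fst f, map Cst (snd f)) [] = R" using b rule_instance(1) by (cases R) (auto simp: ground_atom_def)
  then show ?thesis using rule_instance(2) by (simp add: edb_relation_def)
qed

lemma matches_subst: "matches E \<theta> (subst_aatom \<sigma> a) \<longleftrightarrow> matches E (\<lambda>x. ground_trm \<theta> (\<sigma> x)) a"
proof -
  have "(\<forall>u. map_option (subst_trm \<sigma>) t = Some u \<longrightarrow> ground_trm \<theta> u = y) \<longleftrightarrow>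
    (\<forall>u. t = Some u \<longrightarrow> ground_trm (\<lambda>x. ground_trm \<theta> (\<sigma> x)) u = y)" for t y
    by (cases t) (auto simp: ground_subst)
  then show ?thesis by (simp add: matches_def subst_aatom_def list.rel_map)
qed

lemma matches_cong:
  assumes "\<And>v. v \<in> aatom_vars a \<Longrightarrow> \<theta> v = \<theta>' v"
  shows "matches E \<theta> a \<longleftrightarrow> matches E \<theta>' a"
proof -
  have g: "ground_trm \<theta> u = ground_trm \<theta>' u" if "Some u \<in> set (snd a)" for u
    using assms that by (intro ground_trm_cong) (auto simp: aatom_vars_def)
  have "list_all2 (\<lambda>t y. \<forall>u. t = Some u \<longrightarrow> ground_trm \<theta> u = y) (snd a) ys \<longleftrightarrow>
    list_all2 (\<lambda>t y. \<forall>u. t = Some u \<longrightarrow> ground_trm \<theta>' u = y) (snd a) ys" for ys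
    by (rule list.rel_cong[OF refl refl]) (use g in auto)
  then show ?thesis by (simp add: matches_def)
qed

text \<open>Hiding an argument drops a constraint on the tuple, so a match survives.\<close>

lemma matches_hide: "matches E \<theta> a \<Longrightarrow> matches E \<theta> (hide_args ss a)"
  unfolding matches_def hide_args_def
  by (force simp: list.rel_map elim!: list.rel_mono_strong split: option.splits if_splits)

lemma matches_lift: "matches E \<theta> (lift_atom a) \<longleftrightarrow> map (ground_trm \<theta>) (snd a) \<in> E (fst a)"
proof -
  have "list_all2 (\<lambda>t y. \<forall>u. t = Some u \<longrightarrow> ground_trm \<theta> u = y) (map Some ts) ys \<longleftrightarrow> map (ground_trm \<theta>) ts = ys"
    for ts ys
  proof (induction ts arbitrary: ys)
    case (Cons t ts)
    then show ?case by (cases ys) auto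
  qed auto
  then show ?thesis by (simp add: matches_def lift_atom_def)
qed

text \<open>Induction on the derivation. The valuation of the rule and those of the renamed
  adornments live on disjoint variables and glue to one valuation \<open>\<Theta>\<close>. Read as a
  substitution by constants, \<open>\<Theta>\<close> unifies the heads with the body atoms and so
  factors through the mgu; the second factor yields the valuation \<open>\<eta>\<close> of the new
  adornment.\<close>

lemma idb_fact_instance:
  assumes prog: "datalog_program ar \<Pi>" and db: "database ar \<Pi> D"
    and "f \<in> least_fixpoint \<Pi> D" "fst f \<in> idb \<Pi>"
  shows "\<exists>\<rho>\<in>adornments \<Pi>. fst (fst \<rho>) = fst f \<and> snd f \<in> instances (edb_relation \<Pi> D) \<rho>"
  using assms(3,4)
proof (induction rule: least_fixpoint.induct)
  case (database_fact f)
  then show ?case using db by (auto simp: database_def edb_def)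
next
  case (rule_instance R \<theta>)
  define E where "E = edb_relation \<Pi> D"
  define q ss where "q = fst (rhead R)" and "ss = snd (rhead R)"
  define Is where "Is = filter (\<lambda>a. fst a \<in> idb \<Pi>) (rbody R)"
  define Es where "Es = filter (\<lambda>a. fst a \<notin> idb \<Pi>) (rbody R)"
  define n where "n = length Is"
  have q: "q \<in> idb \<Pi>" using rule_instance.prems by (simp add: q_def ground_atom_def)
  have body: "a \<in> set (rbody R) \<Longrightarrow> ground_atom \<theta> a \<in> least_fixpoint \<Pi> D" for a using rule_instance.IH by blast
  have ex: "\<exists>\<rho>. \<rho> \<in> adornments \<Pi> \<and> fst (fst \<rho>) = fst (Is ! i) \<and> map (ground_trm \<theta>) (snd (Is ! i)) \<in> instances E \<rho>"
    if "i < n" for i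
  proof -
    have "Is ! i \<in> set Is" using that by (simp add: n_def)
    then have "Is ! i \<in> set (rbody R)" "fst (Is ! i) \<in> idb \<Pi>" by (auto simp: Is_def)
    then show ?thesis using rule_instance.IH by (fastforce simp: ground_atom_def E_def)
  qed
  then obtain r where r: "\<And>i. i < n \<Longrightarrow> r i \<in> adornments \<Pi>" "\<And>i. i < n \<Longrightarrow> fst (fst (r i)) = fst (Is ! i)"
    "\<And>i. i < n \<Longrightarrow> map (ground_trm \<theta>) (snd (Is ! i)) \<in> instances E (r i)" by metis
  define \<rho>s where "\<rho>s = map r [0..<n]"
  have wf: "wf_adornment ar \<Pi> \<rho>" if "\<rho> \<in> adornments \<Pi>" for \<rho>
    using that adornment_wf[OF prog] by (auto simp: adornments_def)
  have "finite (adornment_vars \<rho>)" if "\<rho> \<in> set \<rho>s" for \<rho>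
  proof -
    have "\<rho> \<in> adornments \<Pi>" using that r(1) by (auto simp: \<rho>s_def)
    then show ?thesis using wf_adornment_vars[OF wf] by (simp add: head_vars_def)
  qed
  then have f1: "\<forall>\<rho>\<in>set \<rho>s. finite (adornment_vars \<rho>)" by blast
  have f2: "finite (rule_vars R)" by (simp add: rule_vars_def)
  obtain \<rho>s' where s': "length \<rho>s' = length \<rho>s"
    "\<forall>i<length \<rho>s. variant (\<rho>s ! i) (\<rho>s' ! i) \<and> adornment_vars (\<rho>s' ! i) \<inter> rule_vars R = {}"
    "\<forall>i<length \<rho>s. \<forall>j<length \<rho>s. i \<noteq> j \<longrightarrow> adornment_vars (\<rho>s' ! i) \<inter> adornment_vars (\<rho>s' ! j) = {}"
    using fresh_variants[OF f1 f2] by (elim exE conjE)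
  note s = s'(1) s'(2)[rule_format] s'(3)[rule_format]
  have l: "length \<rho>s = n" "length \<rho>s' = n" using s(1) by (simp_all add: \<rho>s_def)
  have \<rho>i: "\<rho>s ! i = r i" if "i < n" for i using that by (simp add: \<rho>s_def)
  have "\<exists>\<theta>'. map (ground_trm \<theta>) (snd (Is ! i)) = map (ground_trm \<theta>') (snd (fst (\<rho>s' ! i))) \<and>
      (\<forall>a\<in>snd (\<rho>s' ! i). matches E \<theta>' a)" if "i < n" for i
  proof -
    have "variant (\<rho>s ! i) (\<rho>s' ! i)" using s(2)[of i] that l by simp
    then have "map (ground_trm \<theta>) (snd (Is ! i)) \<in> instances E (\<rho>s' ! i)"
      using r(3)[OF that] instances_variant \<rho>i[OF that] by simp
    then show ?thesis by (auto simp: instances_def)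
  qed
  then obtain T where T: "\<And>i. i < n \<Longrightarrow> map (ground_trm \<theta>) (snd (Is ! i)) = map (ground_trm (T i)) (snd (fst (\<rho>s' ! i)))"
    "\<And>i a. i < n \<Longrightarrow> a \<in> snd (\<rho>s' ! i) \<Longrightarrow> matches E (T i) a" by metis
  \<comment> \<open>Disjointness of the adornment variables makes the chosen index the only possible
    one.\<close>
  define \<Theta> where "\<Theta> x = (if x \<in> rule_vars R then \<theta> x else T (SOME i. i < n \<and> x \<in> adornment_vars (\<rho>s' ! i)) x)" for x
  have \<Theta>R: "\<Theta> x = \<theta> x" if "x \<in> rule_vars R" for x using that by (simp add: \<Theta>_def)
  have \<Theta>i: "\<Theta> x = T i x" if i: "i < n" "x \<in> adornment_vars (\<rho>s' ! i)" for i x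
  proof -
    have "x \<notin> rule_vars R" using s(2)[of i] i l by auto
    moreover have "(SOME j. j < n \<and> x \<in> adornment_vars (\<rho>s' ! j)) = i"
    proof (rule some_equality)
      show "j = i" if "j < n \<and> x \<in> adornment_vars (\<rho>s' ! j)" for j using s(3)[of i j] i that l by auto
    qed (use i in simp)
    ultimately show ?thesis by (simp add: \<Theta>_def)
  qed
  have body_vars: "args_vars (snd a) \<subseteq> rule_vars R" if "a \<in> set (rbody R)" for a using that by (auto simp: rule_vars_def)
  have gb: "map (ground_trm \<Theta>) (snd a) = map (ground_trm \<theta>) (snd a)" if "a \<in> set (rbody R)" for a
    using \<Theta>R body_vars[OF that] by (intro map_ground_cong) blast
  have gh: "map (ground_trm \<Theta>) ss = map (ground_trm \<theta>) ss"
    by (intro map_ground_cong \<Theta>R) (auto simp: rule_vars_def ss_def)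
  have gi: "map (ground_trm \<Theta>) (snd (fst (\<rho>s' ! i))) = map (ground_trm (T i)) (snd (fst (\<rho>s' ! i)))" if "i < n" for i
    using \<Theta>i[OF that] by (intro map_ground_cong) (auto simp: adornment_vars_def head_vars_def)
  have Isb: "Is ! i \<in> set (rbody R)" if "i < n" for i
    using that nth_mem[of i Is] by (auto simp: n_def Is_def)
  define U where "U = zip (map snd Is) (map (snd \<circ> fst) \<rho>s')"
  have "subst_trm (Cst \<circ> \<Theta>) t = (Cst \<circ> ground_trm \<Theta>) t" for t by (cases t) auto
  then have cst: "subst_trm (Cst \<circ> \<Theta>) = Cst \<circ> ground_trm \<Theta>" by (rule ext)
  have "unifier (Cst \<circ> \<Theta>) U"
    unfolding unifier_def
  proof (intro ballI, clarify)
    fix us ts assume "(us, ts) \<in> set U"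
    then obtain i where i: "i < n" "us = snd (Is ! i)" "ts = snd (fst (\<rho>s' ! i))"
      using l by (auto simp: U_def n_def set_zip)
    have "map (ground_trm \<Theta>) us = map (ground_trm \<Theta>) ts"
      using gb[OF Isb[OF i(1)]] T(1)[OF i(1)] gi[OF i(1)] i by simp
    then have "map Cst (map (ground_trm \<Theta>) us) = map Cst (map (ground_trm \<Theta>) ts)" by simp
    then show "map (subst_trm (Cst \<circ> \<Theta>)) us = map (subst_trm (Cst \<circ> \<Theta>)) ts" unfolding cst by simp
  qed
  then obtain \<sigma> where \<sigma>: "is_mgu \<sigma> U" using mgu_exists by blast
  obtain \<delta> where \<delta>: "\<And>x. Cst (\<Theta> x) = subst_trm \<delta> (\<sigma> x)"
    using \<sigma> \<open>unifier (Cst \<circ> \<Theta>) U\<close> unfolding is_mgu_def by fastforce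
  \<comment> \<open>The value 0 is never met on variables in the range of \<open>\<sigma>\<close>:
    there \<open>\<delta>\<close> has to produce constants.\<close>
  define \<eta> where "\<eta> x = (case \<delta> x of Cst c \<Rightarrow> c | Var y \<Rightarrow> 0)" for x
  have \<eta>: "ground_trm \<eta> (\<sigma> x) = \<Theta> x" for x
    using \<delta>[of x] by (cases "\<sigma> x") (auto simp: \<eta>_def split: trm.splits)
  define B where "B = subst_aatom \<sigma> ` ((\<Union>\<rho>'\<in>set \<rho>s'. snd \<rho>') \<union> lift_atom ` set Es)"
  define \<rho> where "\<rho> = g_out (q, map (subst_trm \<sigma>) ss) B"
  have "ARule \<rho> (zip \<rho>s (map (map (subst_trm \<sigma>) \<circ> snd) Is))
         (map (\<lambda>a. (fst a, map (subst_trm \<sigma>) (snd a))) Es) \<in> adorned_program \<Pi>"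
  proof (rule adorned_program.intros[of R \<Pi> q ss Is Es \<rho>s \<rho>s' \<sigma> \<rho>])
    show "rhead R = (q, ss)" by (simp add: q_def ss_def)
    show "length \<rho>s = length Is" "length \<rho>s' = length Is" using l by (simp_all add: n_def)
    show "\<forall>i<length Is. (\<exists>R'. R' \<in> adorned_program \<Pi> \<and> ar_head R' = \<rho>s ! i) \<and> fst (fst (\<rho>s ! i)) = fst (Is ! i)"
      using r(1,2) \<rho>i by (fastforce simp: n_def adornments_def)
    show "\<forall>i<length Is. variant (\<rho>s ! i) (\<rho>s' ! i) \<and> adornment_vars (\<rho>s' ! i) \<inter> rule_vars R = {}"
      using s(2) l by (simp add: n_def)
    show "\<forall>i<length Is. \<forall>j<length Is. i \<noteq> j \<longrightarrow> adornment_vars (\<rho>s' ! i) \<inter> adornment_vars (\<rho>s' ! j) = {}"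
      using s(3) l by (simp add: n_def)
  qed (use rule_instance.hyps q \<sigma> in \<open>simp_all add: Is_def Es_def U_def \<rho>_def B_def\<close>)
  then have ad: "\<rho> \<in> adornments \<Pi>" by (force simp: adornments_def)
  have B0: "matches E \<Theta> a" if "a \<in> (\<Union>\<rho>'\<in>set \<rho>s'. snd \<rho>') \<union> lift_atom ` set Es" for a
  proof -
    from that consider i where "i < n" "a \<in> snd (\<rho>s' ! i)" | e where "e \<in> set Es" "a = lift_atom e"
      using l(2) by (auto simp: in_set_conv_nth)
    then show ?thesis
    proof cases
      case 1
      have "matches E \<Theta> a \<longleftrightarrow> matches E (T i) a"
        using \<Theta>i[OF 1(1)] 1(2) by (intro matches_cong) (auto simp: adornment_vars_def)
      then show ?thesis using T(2)[OF 1] by simp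
    next
      case 2
      then have e: "e \<in> set (rbody R)" "fst e \<notin> idb \<Pi>" by (auto simp: Es_def)
      then have "map (ground_trm \<theta>) (snd e) \<in> E (fst e)"
        using edb_fact[OF prog body[OF e(1)]] by (simp add: ground_atom_def E_def)
      then show ?thesis unfolding 2(2) matches_lift gb[OF e(1)] .
    qed
  qed
  \<comment> \<open>Removing atoms only weakens the body, and each remaining atom is a hidden form
    of a satisfied one.\<close>
  have "matches E \<eta> a" if a: "a \<in> snd \<rho>" for a
  proof -
    obtain b where b: "b \<in> B" "a = hide_args (map (subst_trm \<sigma>) ss) b"
      using a g_out_body unfolding \<rho>_def by fastforce
    then obtain c where "c \<in> (\<Union>\<rho>'\<in>set \<rho>s'. snd \<rho>') \<union> lift_atom ` set Es" "b = subst_aatom \<sigma> c" by (auto simp: B_def)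
    then have "matches E \<eta> b" using B0 by (simp add: matches_subst \<eta>)
    then show ?thesis unfolding b(2) by (rule matches_hide)
  qed
  moreover have "map (ground_trm \<eta>) (map (subst_trm \<sigma>) ss) = map (ground_trm \<theta>) ss"
    using gh by (simp add: ground_subst \<eta>)
  ultimately have "map (ground_trm \<theta>) ss \<in> instances E \<rho>"
    unfolding instances_def by (intro CollectI exI[of _ \<eta>]) (simp add: \<rho>_def)
  then show ?case using ad by (intro bexI[of _ \<rho>]) (simp_all add: ground_atom_def E_def \<rho>_def q_def ss_def)
qed

lemma finite_edb_relation:
  assumes "finite \<Pi>" "finite D"
  shows "finite (edb_relation \<Pi> D e)"
proof -
  have "edb_relation \<Pi> D e \<subseteq> snd ` D \<union> (\<lambda>R. map (ground_trm (\<lambda>_. 0)) (snd (rhead R))) ` \<Pi>"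
  proof
    fix xs assume "xs \<in> edb_relation \<Pi> D e"
    then consider "(e, xs) \<in> D" | "Rule (e, map Cst xs) [] \<in> \<Pi>" by (auto simp: edb_relation_def)
    then show "xs \<in> snd ` D \<union> (\<lambda>R. map (ground_trm (\<lambda>_. 0)) (snd (rhead R))) ` \<Pi>"
    proof cases
      case 1
      then show ?thesis by force
    next
      case 2
      then show ?thesis by (intro UnI2 image_eqI[of _ _ "Rule (e, map Cst xs) []"]) (simp_all add: comp_def)
    qed
  qed
  then show ?thesis using assms finite_subset by blast
qed

text \<open>Variants have the same instances, so a whole class contributes no more tuples than one
  adornment. Summing over the classes gives the factor \<open>f\<close>.\<close>

lemma idb_relation_bound:
  assumes prog: "datalog_program ar \<Pi>" and db: "database ar \<Pi> D" and N: "1 \<le> N"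
    and E: "\<And>e. e \<in> edb \<Pi> \<Longrightarrow> card (edb_relation \<Pi> D e) \<le> N" and q: "q \<in> idb \<Pi>"
  shows "finite {xs. (q, xs) \<in> least_fixpoint \<Pi> D}"
    "real (card {xs. (q, xs) \<in> least_fixpoint \<Pi> D}) \<le> real (max_adornments \<Pi>) * real N powr ew \<Pi>"
proof -
  have fin: "finite \<Pi>" "finite D" using prog db by (auto simp: datalog_program_def database_def)
  define r where "r = {(\<rho>, \<rho>'). variant \<rho> \<rho>'}"
  define A where "A = {\<rho> \<in> adornments \<Pi>. fst (fst \<rho>) = q}"
  define I where "I = instances (edb_relation \<Pi> D)"
  have wf: "wf_adornment ar \<Pi> \<rho>" if "\<rho> \<in> adornments \<Pi>" for \<rho>
    using that adornment_wf[OF prog] by (auto simp: adornments_def)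
  have Ef: "finite (edb_relation \<Pi> D (fst a)) \<and> card (edb_relation \<Pi> D (fst a)) \<le> N" if "\<rho> \<in> adornments \<Pi>" "a \<in> snd \<rho>" for \<rho> a
    using E[OF wf_adornmentD(6)[OF wf[OF that(1)] that(2)]] finite_edb_relation[OF fin] by simp
  have I: "finite (I \<rho>)" "real (card (I \<rho>)) \<le> real N powr ew \<Pi>" if \<rho>: "\<rho> \<in> adornments \<Pi>" for \<rho>
  proof -
    note b = instances_ew_bound[where E="edb_relation \<Pi> D" and N=N and \<rho>=\<rho>, OF wf_adornmentD(1)[OF wf[OF \<rho>]] Ef[OF \<rho>] N wf_adornmentD(4)[OF wf[OF \<rho>]]]
    show "finite (I \<rho>)" unfolding I_def by (rule b(1))
    have "real N powr ew_adornment \<rho> \<le> real N powr ew \<Pi>"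
      using ew_adornment_le[OF prog \<rho>] N by (intro powr_mono) auto
    then show "real (card (I \<rho>)) \<le> real N powr ew \<Pi>" unfolding I_def using b(2) by linarith
  qed
  have fq: "finite (A // r)" unfolding A_def r_def by (rule finite_adornment_classes[OF prog])
  define G where "G c = (\<Union>\<rho>\<in>c. I \<rho>)" for c
  have G: "\<exists>\<rho>\<in>adornments \<Pi>. G c = I \<rho>" if c: "c \<in> A // r" for c
  proof -
    obtain \<rho> where \<rho>: "\<rho> \<in> A" "c = r `` {\<rho>}" using c by (auto elim!: quotientE)
    have "I \<rho>' = I \<rho>" if "\<rho>' \<in> c" for \<rho>'
      using that instances_variant unfolding \<rho>(2) r_def I_def by auto
    moreover have "\<rho> \<in> c" using variant_refl by (simp add: \<rho>(2) r_def)
    ultimately have "G c = I \<rho>" unfolding G_def by blast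
    then show ?thesis using \<rho>(1) by (auto simp: A_def)
  qed
  have sub: "{xs. (q, xs) \<in> least_fixpoint \<Pi> D} \<subseteq> (\<Union>c\<in>A // r. G c)"
  proof
    fix xs assume "xs \<in> {xs. (q, xs) \<in> least_fixpoint \<Pi> D}"
    then obtain \<rho> where \<rho>: "\<rho> \<in> adornments \<Pi>" "fst (fst \<rho>) = q" "xs \<in> I \<rho>"
      using idb_fact_instance[OF prog db, of "(q, xs)"] q by (auto simp: I_def)
    have "r `` {\<rho>} \<in> A // r" using \<rho> by (auto simp: A_def intro: quotientI)
    moreover have "xs \<in> G (r `` {\<rho>})" unfolding G_def r_def using \<rho>(3) variant_refl by blast
    ultimately show "xs \<in> (\<Union>c\<in>A // r. G c)" by blast
  qed
  have fG: "finite (G c)" if "c \<in> A // r" for c using G[OF that] I(1) by auto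
  have fU: "finite (\<Union>c\<in>A // r. G c)" using fq fG by blast
  show "finite {xs. (q, xs) \<in> least_fixpoint \<Pi> D}" using sub fU finite_subset by blast
  have "card {xs. (q, xs) \<in> least_fixpoint \<Pi> D} \<le> card (\<Union>c\<in>A // r. G c)" by (rule card_mono[OF fU sub])
  also have "\<dots> \<le> (\<Sum>c\<in>A // r. card (G c))" by (rule card_UN_le[OF fq])
  finally have "real (card {xs. (q, xs) \<in> least_fixpoint \<Pi> D}) \<le> (\<Sum>c\<in>A // r. real (card (G c)))" by (simp flip: of_nat_sum)
  also have "\<dots> \<le> (\<Sum>c\<in>A // r. real N powr ew \<Pi>)"
    using G I(2) by (intro sum_mono) fastforce
  also have "\<dots> = real (num_adornments \<Pi> q) * real N powr ew \<Pi>" by (simp add: num_adornments_def A_def r_def)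
  also have "num_adornments \<Pi> q \<le> max_adornments \<Pi>"
    unfolding max_adornments_def using finite_idb[OF fin(1)] q by (intro Max_ge) auto
  then have "real (num_adornments \<Pi> q) * real N powr ew \<Pi> \<le> real (max_adornments \<Pi>) * real N powr ew \<Pi>"
    by (intro mult_right_mono) auto
  finally show "real (card {xs. (q, xs) \<in> least_fixpoint \<Pi> D}) \<le> real (max_adornments \<Pi>) * real N powr ew \<Pi>" .
qed

text \<open>A width of at least 1 cannot be the default element 0 of the maximum, so there is an
  adornment and with it an IDB predicate and a rule. These lower bounds later absorb additive
  terms.\<close>

lemma adornment_exists:
  assumes "datalog_program ar \<Pi>" "1 \<le> ew \<Pi>"
  shows "1 \<le> max_adornments \<Pi>" "\<Pi> \<noteq> {}"
proof -
  have "ew \<Pi> \<in> insert 0 (ew_adornment ` adornments \<Pi>)"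
    unfolding ew_def using finite_ew_adornments[OF assms(1)] by (intro Max_in) auto
  then obtain R' where R': "R' \<in> adorned_program \<Pi>" using assms(2) by (auto simp: adornments_def)
  define q where "q = fst (fst (ar_head R'))"
  have q: "q \<in> idb \<Pi>" using wf_adornmentD(2)[OF adornment_wf[OF assms(1) R']] by (simp add: q_def)
  then show "\<Pi> \<noteq> {}" by (auto simp: idb_def)
  have "{\<rho> \<in> adornments \<Pi>. fst (fst \<rho>) = q} \<noteq> {}" using R' unfolding adornments_def q_def by blast
  then have "num_adornments \<Pi> q \<noteq> 0"
    using finite_adornment_classes[OF assms(1), of q] by (auto simp: num_adornments_def quotient_is_empty)
  moreover have "num_adornments \<Pi> q \<le> max_adornments \<Pi>"
    unfolding max_adornments_def using finite_idb q assms(1) by (intro Max_ge) (auto simp: datalog_program_def)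
  ultimately show "1 \<le> max_adornments \<Pi>" by linarith
qed

section \<open>Structured programs on the machine\<close>

text \<open>\<open>rCnt\<close> is the last pattern cell in use; \<open>rOc\<close>, \<open>rQc\<close> and \<open>rQp\<close> count the occurrences, the queued and
  the processed facts; \<open>rNn\<close> is the last node, \<open>rBd\<close> the number \<open>B\<close>, and \<open>rSt\<close> the stamp of the current
  variable bindings.

  \<open>aTAG\<close> and \<open>aVAL\<close> hold the terms of the patterns, each pattern being delimited on both sides by
  the tag 0.  An occurrence consists of a body pattern (\<open>aOWN\<close>), the other body pattern (\<open>aOTH\<close>, of class
  \<open>aOCO\<close>) and the head (\<open>aOHD\<close>) of a rule.  \<open>aQN\<close> gives the nodes of the queued facts, \<open>aTR\<close> is the hash
  table, and \<open>aKEY\<close> and \<open>aTL\<close> are the heads and tails of the nodes.  Occurrences (\<open>aOL\<close>, \<open>aONX\<close>) and facts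
  (\<open>aQL\<close>, \<open>aQNX\<close>) of the same class form linked lists, where the class is 0 for the empty list and
  otherwise one more than the predicate.\<close>

datatype var = rCnt | rX | rL | rTg | rFlag | rNr | rM | rCl | rHd | rP | rB1 | rC1 | rB2 | rC2 | rOc | rBd
  | rSt | rQc | rQp | rF | rO | rD | rG | rOk | rI | rH | rNd | rNn

datatype arr = aTAG | aVAL | aIDB | aOWN | aOTH | aOCO | aOHD | aONX | aOL | aQN | aQNX | aQL | aKNOWN | aENV | aENVS
  | aTR | aKEY | aTL | aCLS

definition vars :: "var list" where
  "vars = [rCnt, rX, rL, rTg, rFlag, rNr, rM, rCl, rHd, rP, rB1, rC1, rB2, rC2, rOc, rBd, rSt, rQc, rQp, rF, rO, rD, rG, rOk,
    rI, rH, rNd, rNn]"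

definition arrs :: "arr list" where
  "arrs = [aTAG, aVAL, aIDB, aOWN, aOTH, aOCO, aOHD, aONX, aOL, aQN, aQNX, aQL, aKNOWN, aENV, aENVS, aTR, aKEY, aTL, aCLS]"

definition vidx :: "var \<Rightarrow> nat" where "vidx v = (THE i. i < length vars \<and> vars ! i = v)"
definition aidx :: "arr \<Rightarrow> nat" where "aidx a = (THE i. i < length arrs \<and> arrs ! i = a)"

lemma vidx_ex1: "\<exists>!i. i < length vars \<and> vars ! i = v"
proof -
  have "distinct vars" "v \<in> set vars" by (simp_all add: vars_def, cases v, simp_all)
  then show ?thesis by (metis distinct_Ex1)
qed

lemma aidx_ex1: "\<exists>!i. i < length arrs \<and> arrs ! i = a"
proof -
  have "distinct arrs" "a \<in> set arrs" by (simp_all add: arrs_def, cases a, simp_all)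
  then show ?thesis by (metis distinct_Ex1)
qed

lemma vidx_inj [simp]: "vidx v = vidx w \<longleftrightarrow> v = w"
  using theI'[OF vidx_ex1[of v]] theI'[OF vidx_ex1[of w]] unfolding vidx_def by metis

lemma aidx_inj [simp]: "aidx a = aidx b \<longleftrightarrow> a = b"
  using theI'[OF aidx_ex1[of a]] theI'[OF aidx_ex1[of b]] unfolding aidx_def by metis

lemma aidx_less: "aidx a < 32"
  using theI'[OF aidx_ex1[of a]] unfolding aidx_def[symmetric] by (simp add: arrs_def)

record st =
  mreg :: "var \<Rightarrow> nat"
  marr :: "arr \<Rightarrow> nat \<Rightarrow> nat"
  minp :: "nat list"
  mout :: "nat list"

text \<open>Odd registers are reserved for the evaluation of expressions.\<close>

definition abs_state :: "ram_state \<Rightarrow> st" where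
  "abs_state S = \<lparr>mreg = (\<lambda>v. reg S (2 * vidx v)), marr = (\<lambda>a x. mem S (32 * x + aidx a)),
     minp = inp S, mout = out S\<rparr>"

datatype exp = Num nat | Reg var | Plus exp exp | Minus exp exp | Arr arr exp

fun aval :: "exp \<Rightarrow> st \<Rightarrow> nat" where
  "aval (Num n) s = n"
| "aval (Reg v) s = mreg s v"
| "aval (Plus a b) s = aval a s + aval b s"
| "aval (Minus a b) s = aval a s - aval b s"
| "aval (Arr r a) s = marr s r (aval a s)"

text \<open>The exact number of machine steps of \<open>cexp\<close>. Copying a register takes 2
  steps in the absence of a move instruction; 8 is an address computation of 7 steps and a
  load.\<close>

fun ecost :: "exp \<Rightarrow> nat" where
  "ecost (Num n) = 1"
| "ecost (Reg v) = 2"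
| "ecost (Plus a b) = ecost a + ecost b + 1"
| "ecost (Minus a b) = ecost a + ecost b + 1"
| "ecost (Arr r a) = ecost a + 8"

definition caddr :: "arr \<Rightarrow> nat \<Rightarrow> ram" where
  "caddr a t = Seq (Add t t t) (Seq (Add t t t) (Seq (Add t t t) (Seq (Add t t t) (Seq (Add t t t)
     (Seq (Set (t + 2) (aidx a)) (Add t t (t + 2)))))))"

text \<open>Evaluation on a stack of odd registers: the value goes to \<open>t\<close>, a second
  operand to \<open>t + 2\<close>; even registers and those below \<open>t\<close> are left
  alone.\<close>

fun cexp :: "exp \<Rightarrow> nat \<Rightarrow> ram" where
  "cexp (Num n) t = Set t n"
| "cexp (Reg v) t = Seq (Set t 0) (Add t t (2 * vidx v))"
| "cexp (Plus a b) t = Seq (cexp a t) (Seq (cexp b (t + 2)) (Add t t (t + 2)))"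
| "cexp (Minus a b) t = Seq (cexp a t) (Seq (cexp b (t + 2)) (Sub t t (t + 2)))"
| "cexp (Arr r a) t = Seq (cexp a t) (Seq (caddr r t) (Load t t))"

text \<open>Agreement outside the scratch registers, the odd ones from \<open>t\<close> on, which
  the abstract state does not see.\<close>

definition temp_eq :: "nat \<Rightarrow> ram_state \<Rightarrow> ram_state \<Rightarrow> bool" where
  "temp_eq t S S' \<longleftrightarrow> mem S' = mem S \<and> inp S' = inp S \<and> out S' = out S \<and>
     (\<forall>r. even r \<or> r < t \<longrightarrow> reg S' r = reg S r)"

lemmas ex_set = ram_exec.intros(2) and ex_add = ram_exec.intros(3) and ex_sub = ram_exec.intros(4)
  and ex_load = ram_exec.intros(5) and ex_store = ram_exec.intros(6) and ex_write = ram_exec.intros(9)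
  and ex_seq = ram_exec.intros(10)

lemma temp_eq_abs: "temp_eq t S S' \<Longrightarrow> abs_state S' = abs_state S"
  by (simp add: temp_eq_def abs_state_def)

lemma temp_eq_trans: "temp_eq t S S' \<Longrightarrow> temp_eq t' S' S'' \<Longrightarrow> t \<le> t' \<Longrightarrow> temp_eq t S S''"
  by (auto simp: temp_eq_def)

lemma double_exec:
  assumes "odd t"
  obtains S' where "ram_exec (Add t t t) S 1 S'" "reg S' t = 2 * reg S t" "temp_eq t S S'"
proof
  show "ram_exec (Add t t t) S 1 (S\<lparr>reg := (reg S)(t := reg S t + reg S t)\<rparr>)" by (rule ex_add)
qed (use assms in \<open>auto simp: temp_eq_def\<close>)

lemma caddr_exec:
  assumes "odd t"
  shows "\<exists>S'. ram_exec (caddr a t) S 7 S' \<and> reg S' t = 32 * reg S t + aidx a \<and> temp_eq t S S'"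
proof -
  obtain S1 where 1: "ram_exec (Add t t t) S 1 S1" "reg S1 t = 2 * reg S t" "temp_eq t S S1"
    by (rule double_exec[OF assms])
  obtain S2 where 2: "ram_exec (Add t t t) S1 1 S2" "reg S2 t = 2 * reg S1 t" "temp_eq t S1 S2"
    by (rule double_exec[OF assms])
  obtain S3 where 3: "ram_exec (Add t t t) S2 1 S3" "reg S3 t = 2 * reg S2 t" "temp_eq t S2 S3"
    by (rule double_exec[OF assms])
  obtain S4 where 4: "ram_exec (Add t t t) S3 1 S4" "reg S4 t = 2 * reg S3 t" "temp_eq t S3 S4"
    by (rule double_exec[OF assms])
  obtain S5 where 5: "ram_exec (Add t t t) S4 1 S5" "reg S5 t = 2 * reg S4 t" "temp_eq t S4 S5"
    by (rule double_exec[OF assms])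
  let ?S6 = "S5\<lparr>reg := (reg S5)(t + 2 := aidx a)\<rparr>"
  let ?S7 = "?S6\<lparr>reg := (reg ?S6)(t := reg ?S6 t + reg ?S6 (t + 2))\<rparr>"
  have e: "(7::nat) = 1+(1+(1+(1+(1+(1+1)))))" by simp
  have "ram_exec (caddr a t) S (1+(1+(1+(1+(1+(1+1)))))) ?S7"
    unfolding caddr_def
    by (rule ex_seq[OF 1(1) ex_seq[OF 2(1) ex_seq[OF 3(1) ex_seq[OF 4(1) ex_seq[OF 5(1)
      ex_seq[OF ex_set ex_add]]]]]])
  moreover have "reg ?S7 t = 32 * reg S t + aidx a" using 1(2) 2(2) 3(2) 4(2) 5(2) by simp
  moreover have "temp_eq t S S5"
    using temp_eq_trans[OF 1(3) temp_eq_trans[OF 2(3) temp_eq_trans[OF 3(3) temp_eq_trans[OF 4(3) 5(3)]]]] by simp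
  then have "temp_eq t S ?S7" using assms by (auto simp: temp_eq_def)
  ultimately show ?thesis unfolding e by blast
qed

lemma cexp_exec:
  assumes "odd t"
  shows "\<exists>S'. ram_exec (cexp e t) S (ecost e) S' \<and> reg S' t = aval e (abs_state S) \<and> temp_eq t S S'"
  using assms
proof (induction e arbitrary: t S)
  case (Num n)
  let ?S = "S\<lparr>reg := (reg S)(t := n)\<rparr>"
  have "ram_exec (cexp (Num n) t) S (ecost (Num n)) ?S"
    unfolding cexp.simps ecost.simps by (rule ram_exec.intros)
  then show ?case using Num by (intro exI[of _ ?S] conjI) (auto simp: temp_eq_def)
next
  case (Reg v)
  let ?S = "S\<lparr>reg := (reg S)(t := 0)\<rparr>"
  let ?S' = "?S\<lparr>reg := (reg ?S)(t := reg ?S t + reg ?S (2 * vidx v))\<rparr>"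
  have "ram_exec (cexp (Reg v) t) S (1 + 1) ?S'" unfolding cexp.simps by (rule ex_seq[OF ex_set ex_add])
  moreover have "reg ?S' t = aval (Reg v) (abs_state S)" using Reg by (auto simp: abs_state_def)
  moreover have "temp_eq t S ?S'" using Reg by (auto simp: temp_eq_def)
  ultimately show ?case by (auto simp del: cexp.simps simp: numeral_2_eq_2)
next
  case (Plus a b)
  obtain S1 where 1: "ram_exec (cexp a t) S (ecost a) S1" "reg S1 t = aval a (abs_state S)" "temp_eq t S S1"
    using Plus by blast
  obtain S2 where 2: "ram_exec (cexp b (t+2)) S1 (ecost b) S2" "reg S2 (t+2) = aval b (abs_state S1)" "temp_eq (t+2) S1 S2"
    using Plus.IH(2)[of "t+2" S1] Plus.prems by auto
  let ?S' = "S2\<lparr>reg := (reg S2)(t := reg S2 t + reg S2 (t+2))\<rparr>"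
  have "ram_exec (cexp (Plus a b) t) S (ecost a + (ecost b + 1)) ?S'"
    unfolding cexp.simps by (rule ex_seq[OF 1(1) ex_seq[OF 2(1) ex_add]])
  moreover have "reg S2 t = reg S1 t" using 2 by (simp add: temp_eq_def)
  moreover have "temp_eq t S ?S'" using Plus.prems 1(3) 2(3) by (auto simp: temp_eq_def)
  ultimately show ?case using 1 2 by (auto simp del: cexp.simps simp: temp_eq_abs add_ac)
next
  case (Minus a b)
  obtain S1 where 1: "ram_exec (cexp a t) S (ecost a) S1" "reg S1 t = aval a (abs_state S)" "temp_eq t S S1"
    using Minus by blast
  obtain S2 where 2: "ram_exec (cexp b (t+2)) S1 (ecost b) S2" "reg S2 (t+2) = aval b (abs_state S1)" "temp_eq (t+2) S1 S2"
    using Minus.IH(2)[of "t+2" S1] Minus.prems by auto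
  let ?S' = "S2\<lparr>reg := (reg S2)(t := reg S2 t - reg S2 (t+2))\<rparr>"
  have "ram_exec (cexp (Minus a b) t) S (ecost a + (ecost b + 1)) ?S'"
    unfolding cexp.simps by (rule ex_seq[OF 1(1) ex_seq[OF 2(1) ex_sub]])
  moreover have "reg S2 t = reg S1 t" using 2 by (simp add: temp_eq_def)
  moreover have "temp_eq t S ?S'" using Minus.prems 1(3) 2(3) by (auto simp: temp_eq_def)
  ultimately show ?case using 1 2 by (auto simp del: cexp.simps simp: temp_eq_abs add_ac)
next
  case (Arr r a)
  obtain S1 where 1: "ram_exec (cexp a t) S (ecost a) S1" "reg S1 t = aval a (abs_state S)" "temp_eq t S S1"
    using Arr by blast
  obtain S2 where 2: "ram_exec (caddr r t) S1 7 S2" "reg S2 t = 32 * reg S1 t + aidx r" "temp_eq t S1 S2"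
    using caddr_exec[OF Arr.prems] by blast
  let ?S' = "S2\<lparr>reg := (reg S2)(t := mem S2 (reg S2 t))\<rparr>"
  have "ram_exec (cexp (Arr r a) t) S (ecost a + (7 + 1)) ?S'"
    unfolding cexp.simps by (rule ex_seq[OF 1(1) ex_seq[OF 2(1) ex_load]])
  moreover have "mem S2 = mem S" using 1(3) 2(3) by (simp add: temp_eq_def)
  moreover have "temp_eq t S ?S'" using Arr.prems 1(3) 2(3) by (auto simp: temp_eq_def)
  ultimately show ?case using 1(2) 2(2)
    by (intro exI[of _ ?S']) (auto simp del: cexp.simps simp: abs_state_def add_ac)
qed

section \<open>A calculus for total correctness with time\<close>

definition asg :: "var \<Rightarrow> exp \<Rightarrow> ram" where
  "asg v e = Seq (cexp e 1) (Seq (Set (2 * vidx v) 0) (Add (2 * vidx v) (2 * vidx v) 1))"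
definition sto :: "arr \<Rightarrow> exp \<Rightarrow> exp \<Rightarrow> ram" where
  "sto a i e = Seq (cexp i 1) (Seq (caddr a 1) (Seq (cexp e 3) (Store 1 3)))"
definition rd :: "var \<Rightarrow> ram" where "rd v = Read (2 * vidx v)"
definition wr :: "exp \<Rightarrow> ram" where "wr e = Seq (cexp e 1) (Write 1)"
definition cond :: "exp \<Rightarrow> ram \<Rightarrow> ram \<Rightarrow> ram" where "cond e a b = Seq (cexp e 1) (If 1 a b)"
text \<open>\<open>While\<close> tests a register, so the guard is recomputed at the end of every
  round.\<close>

definition loop :: "exp \<Rightarrow> ram \<Rightarrow> ram" where
  "loop e c = Seq (cexp e 1) (While 1 (Seq c (cexp e 1)))"

text \<open>The number \<open>n\<close> counts ticks of at most 200 machine steps each.\<close>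

definition runs :: "ram \<Rightarrow> st \<Rightarrow> nat \<Rightarrow> st \<Rightarrow> bool" where
  "runs c s n s' \<longleftrightarrow> (\<forall>S. abs_state S = s \<longrightarrow>
     (\<exists>t S'. ram_exec c S t S' \<and> t \<le> 200 * n \<and> abs_state S' = s'))"

text \<open>Termination is included, since \<open>runs\<close> asserts an execution from every
  concrete state behind \<open>s\<close>, whatever its scratch registers hold. The postcondition
  also receives the tick count.\<close>

definition wp :: "ram \<Rightarrow> (nat \<Rightarrow> st \<Rightarrow> bool) \<Rightarrow> st \<Rightarrow> bool" where
  "wp c Q s \<longleftrightarrow> (\<exists>n s'. runs c s n s' \<and> Q n s')"

lemma wp_conseq: "wp c Q s \<Longrightarrow> (\<And>n s'. Q n s' \<Longrightarrow> Q' n s') \<Longrightarrow> wp c Q' s"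
  unfolding wp_def by blast

lemma wp_seq: "wp c (\<lambda>n s'. wp d (\<lambda>m. Q (n + m)) s') s \<Longrightarrow> wp (Seq c d) Q s"
proof -
  have "runs (Seq c d) s (n + m) s''" if r: "runs c s n s'" "runs d s' m s''" for n m s' s''
    unfolding runs_def
  proof (intro allI impI)
    fix S assume "abs_state S = s"
    then obtain t S' where 1: "ram_exec c S t S'" "t \<le> 200 * n" "abs_state S' = s'"
      using r(1) unfolding runs_def by blast
    then obtain t' S'' where 2: "ram_exec d S' t' S''" "t' \<le> 200 * m" "abs_state S'' = s''"
      using r(2) unfolding runs_def by blast
    show "\<exists>t S'. ram_exec (Seq c d) S t S' \<and> t \<le> 200 * (n + m) \<and> abs_state S' = s''"
      using 1 2 by (intro exI[of _ "t + t'"] exI[of _ S'']) (auto intro: ram_exec.intros)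
  qed
  then show "wp c (\<lambda>n s'. wp d (\<lambda>m. Q (n + m)) s') s \<Longrightarrow> wp (Seq c d) Q s"
    unfolding wp_def by blast
qed

lemma wp_I:
  assumes "\<And>S. abs_state S = s \<Longrightarrow> \<exists>t S'. ram_exec c S t S' \<and> t \<le> 200 * n \<and> abs_state S' = s'" "Q n s'"
  shows "wp c Q s"
  using assms unfolding wp_def runs_def by blast

text \<open>The limit on \<open>ecost\<close> leaves room for the two copying steps within the 200
  steps of one tick.\<close>

lemma wp_asg:
  assumes "ecost e \<le> 100" "Q 1 (s\<lparr>mreg := (mreg s)(v := aval e s)\<rparr>)"
  shows "wp (asg v e) Q s"
proof (rule wp_I[where Q=Q, OF _ assms(2)])
  fix S assume S: "abs_state S = s"
  obtain S1 where 1: "ram_exec (cexp e 1) S (ecost e) S1" "reg S1 1 = aval e s" "temp_eq 1 S S1"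
    using cexp_exec[of 1 e S] S by auto
  let ?S2 = "S1\<lparr>reg := (reg S1)(2 * vidx v := 0)\<rparr>"
  let ?S3 = "?S2\<lparr>reg := (reg ?S2)(2 * vidx v := reg ?S2 (2 * vidx v) + reg ?S2 1)\<rparr>"
  have "ram_exec (asg v e) S (ecost e + (1 + 1)) ?S3"
    unfolding asg_def by (rule ex_seq[OF 1(1) ex_seq[OF ex_set ex_add]])
  moreover have "1 \<noteq> 2 * vidx v" by presburger
  then have "abs_state ?S3 = s\<lparr>mreg := (mreg s)(v := aval e s)\<rparr>"
    using S 1 by (auto simp: abs_state_def temp_eq_def fun_eq_iff)
  ultimately show "\<exists>t S'. ram_exec (asg v e) S t S' \<and> t \<le> 200 * 1 \<and> abs_state S' = s\<lparr>mreg := (mreg s)(v := aval e s)\<rparr>"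
    using assms(1) by (intro exI[of _ "ecost e + (1 + 1)"] exI[of _ ?S3]) auto
qed

lemma addr_inj: "32 * x + aidx a = 32 * y + aidx b \<longleftrightarrow> x = y \<and> a = b"
proof
  assume h: "32 * x + aidx a = 32 * y + aidx b"
  have "x = y" using h aidx_less[of a] aidx_less[of b] by presburger
  with h show "x = y \<and> a = b" by simp
qed simp

lemma wp_sto:
  assumes "ecost i \<le> 90" "ecost e \<le> 90"
    "Q 1 (s\<lparr>marr := (marr s)(a := (marr s a)(aval i s := aval e s))\<rparr>)"
  shows "wp (sto a i e) Q s"
proof (rule wp_I[where Q=Q, OF _ assms(3)])
  fix S assume S: "abs_state S = s"
  obtain S1 where 1: "ram_exec (cexp i 1) S (ecost i) S1" "reg S1 1 = aval i s" "temp_eq 1 S S1"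
    using cexp_exec[of 1 i S] S by auto
  obtain S2 where 2: "ram_exec (caddr a 1) S1 7 S2" "reg S2 1 = 32 * reg S1 1 + aidx a" "temp_eq 1 S1 S2"
    using caddr_exec[of 1] by auto
  have abs2: "abs_state S2 = s" using S 1 2 temp_eq_abs by metis
  obtain S3 where 3: "ram_exec (cexp e 3) S2 (ecost e) S3" "reg S3 3 = aval e s" "temp_eq 3 S2 S3"
    using cexp_exec[of 3 e S2] abs2 by auto
  have 13: "reg S3 1 = reg S2 1" using 3 by (simp add: temp_eq_def)
  have abs3: "abs_state S3 = s" using abs2 3 temp_eq_abs by metis
  let ?S4 = "S3\<lparr>mem := (mem S3)(reg S3 1 := reg S3 3)\<rparr>"
  have "ram_exec (sto a i e) S (ecost i + (7 + (ecost e + 1))) ?S4"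
    unfolding sto_def by (rule ex_seq[OF 1(1) ex_seq[OF 2(1) ex_seq[OF 3(1) ex_store]]])
  moreover have "abs_state ?S4 = s\<lparr>marr := (marr s)(a := (marr s a)(aval i s := aval e s))\<rparr>"
    unfolding abs3[symmetric]
    using 13 1 2 3 abs3 by (auto simp: abs_state_def fun_eq_iff addr_inj)
  ultimately show "\<exists>t S'. ram_exec (sto a i e) S t S' \<and> t \<le> 200 * 1 \<and>
      abs_state S' = s\<lparr>marr := (marr s)(a := (marr s a)(aval i s := aval e s))\<rparr>"
    using assms(1,2) by (intro exI[of _ "ecost i + (7 + (ecost e + 1))"] exI[of _ ?S4]) auto
qed

lemma wp_rd:
  assumes "minp s = x # xs" "Q 1 (s\<lparr>mreg := (mreg s)(v := x), minp := xs\<rparr>)"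
  shows "wp (rd v) Q s"
proof (rule wp_I[where Q=Q, OF _ assms(2)])
  fix S assume S: "abs_state S = s"
  let ?S = "S\<lparr>reg := (reg S)(2 * vidx v := x), inp := xs\<rparr>"
  have "ram_exec (rd v) S 1 ?S"
    unfolding rd_def using assms(1) S by (intro ram_exec.intros) (auto simp: abs_state_def)
  moreover have "abs_state ?S = s\<lparr>mreg := (mreg s)(v := x), minp := xs\<rparr>"
    using S by (auto simp: abs_state_def fun_eq_iff)
  ultimately show "\<exists>t S'. ram_exec (rd v) S t S' \<and> t \<le> 200 * 1 \<and> abs_state S' = s\<lparr>mreg := (mreg s)(v := x), minp := xs\<rparr>"
    by (intro exI[of _ 1] exI[of _ ?S]) auto
qed

lemma wp_wr:
  assumes "ecost e \<le> 100" "Q 1 (s\<lparr>mout := mout s @ [aval e s]\<rparr>)"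
  shows "wp (wr e) Q s"
proof (rule wp_I[where Q=Q, OF _ assms(2)])
  fix S assume S: "abs_state S = s"
  obtain S1 where 1: "ram_exec (cexp e 1) S (ecost e) S1" "reg S1 1 = aval e s" "temp_eq 1 S S1"
    using cexp_exec[of 1 e S] S by auto
  have abs1: "abs_state S1 = s" using S 1 temp_eq_abs by metis
  let ?S = "S1\<lparr>out := out S1 @ [reg S1 1]\<rparr>"
  have "ram_exec (wr e) S (ecost e + 1) ?S"
    unfolding wr_def by (rule ex_seq[OF 1(1) ex_write])
  moreover have "abs_state ?S = s\<lparr>mout := mout s @ [aval e s]\<rparr>"
    using 1 abs1 by (auto simp: abs_state_def)
  ultimately show "\<exists>t S'. ram_exec (wr e) S t S' \<and> t \<le> 200 * 1 \<and> abs_state S' = s\<lparr>mout := mout s @ [aval e s]\<rparr>"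
    using assms(1) by (intro exI[of _ "ecost e + 1"] exI[of _ ?S]) auto
qed

lemma wp_cond:
  assumes "ecost e \<le> 100" "aval e s \<noteq> 0 \<Longrightarrow> wp c (\<lambda>n. Q (Suc n)) s"
    "aval e s = 0 \<Longrightarrow> wp d (\<lambda>n. Q (Suc n)) s"
  shows "wp (cond e c d) Q s"
proof -
  define b where "b = (if aval e s \<noteq> 0 then c else d)"
  have "wp b (\<lambda>n. Q (Suc n)) s" using assms unfolding b_def by auto
  then obtain n s' where n: "runs b s n s'" "Q (Suc n) s'" unfolding wp_def by blast
  show ?thesis
  proof (rule wp_I[where Q=Q, OF _ n(2)])
    fix S assume S: "abs_state S = s"
    obtain S1 where 1: "ram_exec (cexp e 1) S (ecost e) S1" "reg S1 1 = aval e s" "temp_eq 1 S S1"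
      using cexp_exec[of 1 e S] S by auto
    have "abs_state S1 = s" using S 1 temp_eq_abs by metis
    then obtain t S2 where 2: "ram_exec b S1 t S2" "t \<le> 200 * n" "abs_state S2 = s'"
      using n(1) unfolding runs_def by blast
    have "ram_exec (If 1 c d) S1 (1 + t) S2"
      using 1(2) 2(1) ram_exec.intros(11)[of S1 1 c t S2 d] ram_exec.intros(12)[of S1 1 d t S2 c]
      unfolding b_def by (cases "aval e s = 0") auto
    then have "ram_exec (cond e c d) S (ecost e + (1 + t)) S2"
      unfolding cond_def by (rule ex_seq[OF 1(1)])
    then show "\<exists>t S'. ram_exec (cond e c d) S t S' \<and> t \<le> 200 * Suc n \<and> abs_state S' = s'"
      using assms(1) 2 by (intro exI[of _ "ecost e + (1 + t)"] exI[of _ S2]) auto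
  qed
qed

lemma wp_loop_0:
  assumes "ecost e \<le> 90" "aval e s = 0" "Q 1 s"
  shows "wp (loop e c) Q s"
proof (rule wp_I[where Q=Q, OF _ assms(3)])
  fix S assume S: "abs_state S = s"
  obtain S1 where 1: "ram_exec (cexp e 1) S (ecost e) S1" "reg S1 1 = aval e s" "temp_eq 1 S S1"
    using cexp_exec[of 1 e S] S by auto
  have "ram_exec (loop e c) S (ecost e + 1) S1"
    unfolding loop_def using 1(2) assms by (intro ex_seq[OF 1(1)] ram_exec.intros(13)) simp
  moreover have "abs_state S1 = s" using S 1 temp_eq_abs by metis
  ultimately show "\<exists>t S'. ram_exec (loop e c) S t S' \<and> t \<le> 200 * 1 \<and> abs_state S' = s"
    using assms(1) by (intro exI[of _ "ecost e + 1"] exI[of _ S1]) auto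
qed

lemma wp_loop_step:
  assumes "ecost e \<le> 90" "aval e s \<noteq> 0" "wp c (\<lambda>n s'. wp (loop e c) (\<lambda>m. Q (Suc (n + m))) s') s"
  shows "wp (loop e c) Q s"
proof -
  obtain n m s' s'' where n: "runs c s n s'" "runs (loop e c) s' m s''" "Q (Suc (n + m)) s''"
    using assms(3) unfolding wp_def by blast
  show ?thesis
  proof (rule wp_I[where Q=Q, OF _ n(3)])
    fix S assume S: "abs_state S = s"
    obtain S1 where 1: "ram_exec (cexp e 1) S (ecost e) S1" "reg S1 1 = aval e s" "temp_eq 1 S S1"
      using cexp_exec[of 1 e S] S by auto
    have "abs_state S1 = s" using S 1 temp_eq_abs by metis
    then obtain t S2 where 2: "ram_exec c S1 t S2" "t \<le> 200 * n" "abs_state S2 = s'"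
      using n(1) unfolding runs_def by blast
    then obtain t' S3 where 3: "ram_exec (loop e c) S2 t' S3" "t' \<le> 200 * m" "abs_state S3 = s''"
      using n(2) unfolding runs_def by blast
    \<comment> \<open>The rest of the run is again a \<open>loop\<close> and starts with the guard;
      exactly this evaluation of the guard closes the current round of \<open>While\<close>.\<close>
    then obtain ta tb Sa where 4: "ram_exec (cexp e 1) S2 ta Sa"
      "ram_exec (While 1 (Seq c (cexp e 1))) Sa tb S3" "t' = ta + tb"
      unfolding loop_def by (auto elim: ram_exec.cases)
    have "ram_exec (loop e c) S (ecost e + (1 + (t + ta) + tb)) S3"
      unfolding loop_def
      using 1(2) assms(2) by (intro ex_seq[OF 1(1)] ram_exec.intros(14)[OF _ ex_seq[OF 2(1) 4(1)] 4(2)]) simp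
    then show "\<exists>t S'. ram_exec (loop e c) S t S' \<and> t \<le> 200 * Suc (n + m) \<and> abs_state S' = s''"
      using assms(1) 2 3 4 by (intro exI[of _ "ecost e + (1 + (t + ta) + tb)"] exI[of _ S3]) auto
  qed
qed

section \<open>Matching patterns against facts\<close>

notation Seq (infixr ";;" 60)

lemma wp_skip: "Q 1 s \<Longrightarrow> wp Skip Q s"
  by (rule wp_I[where Q=Q and n=1 and s'=s]) (use ram_exec.intros(1) in force)

text \<open>The frame condition for registers and arrays. Where a command consumes input or writes
  output, it is applied to the new state with that field reset.\<close>

definition same :: "var set \<Rightarrow> arr set \<Rightarrow> st \<Rightarrow> st \<Rightarrow> bool" where
  "same W R s s' \<longleftrightarrow> (\<forall>v. v \<notin> W \<longrightarrow> mreg s' v = mreg s v) \<and> (\<forall>a. a \<notin> R \<longrightarrow> marr s' a = marr s a) \<and>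
     minp s' = minp s \<and> mout s' = mout s"

lemma same_refl [simp]: "same W R s s"
  by (simp add: same_def)

lemma same_trans: "same W R s s' \<Longrightarrow> same W R s' s'' \<Longrightarrow> same W R s s''"
  by (simp add: same_def)

lemma same_mono: "same W R s s' \<Longrightarrow> W \<subseteq> W' \<Longrightarrow> R \<subseteq> R' \<Longrightarrow> same W' R' s s'"
  unfolding same_def by blast

text \<open>A test for inequality: with truncated subtraction the two differences are both 0 only
  for equal arguments.\<close>

abbreviation neq :: "exp \<Rightarrow> exp \<Rightarrow> exp" where
  "neq a b \<equiv> Plus (Minus a b) (Minus b a)"

lemma nat_neq: "(a::nat) - b + (b - a) = 0 \<longleftrightarrow> a = b"
  by auto

text \<open>One more than the tags of the input encoding, because 0 is the delimiter and the initial
  content of memory.\<close>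

fun tag :: "trm \<Rightarrow> nat" where "tag (Var x) = 1" | "tag (Cst c) = 2"
fun tval :: "trm \<Rightarrow> nat" where "tval (Var x) = x" | "tval (Cst c) = c"

fun patf :: "(nat \<Rightarrow> nat) \<Rightarrow> (nat \<Rightarrow> nat) \<Rightarrow> nat \<Rightarrow> trm list \<Rightarrow> bool" where
  "patf T V p [] \<longleftrightarrow> T p = 0"
| "patf T V p (t # ts) \<longleftrightarrow> T p = tag t \<and> V p = tval t \<and> patf T V (Suc p) ts"

text \<open>Stored lists grow at the front, so a head pattern has to be traversed downwards from its
  last cell.\<close>

fun patb :: "(nat \<Rightarrow> nat) \<Rightarrow> (nat \<Rightarrow> nat) \<Rightarrow> nat \<Rightarrow> trm list \<Rightarrow> bool" where
  "patb T V p [] \<longleftrightarrow> T p = 0"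
| "patb T V p (t # ts) \<longleftrightarrow> T p = tag t \<and> V p = tval t \<and> patb T V (p - 1) ts"

fun path :: "(nat \<Rightarrow> nat) \<Rightarrow> (nat \<Rightarrow> nat) \<Rightarrow> nat \<Rightarrow> nat list \<Rightarrow> bool" where
  "path K T n [] \<longleftrightarrow> n = 0"
| "path K T n (x # xs) \<longleftrightarrow> n \<noteq> 0 \<and> K n = x \<and> path K T (T n) xs"

fun chain :: "(nat \<Rightarrow> nat) \<Rightarrow> nat \<Rightarrow> nat list \<Rightarrow> bool" where
  "chain X n [] \<longleftrightarrow> n = 0"
| "chain X n (x # xs) \<longleftrightarrow> n = x \<and> x \<noteq> 0 \<and> chain X (X n) xs"

lemma chain_cong: "chain X n xs \<Longrightarrow> (\<And>x. x \<in> set xs \<Longrightarrow> X' x = X x) \<Longrightarrow> chain X' n xs"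
  by (induction xs arbitrary: n) auto

text \<open>Bindings with an old stamp count as unset, so the environment is never cleared.\<close>

definition envof :: "st \<Rightarrow> nat \<Rightarrow> nat option" where
  "envof s = (\<lambda>x. if marr s aENVS x = mreg s rSt then Some (marr s aENV x) else None)"

text \<open>A mismatch clears the flag without stopping, so the loop keeps a single guard and its
  time depends only on the length of the pattern.\<close>

fun mstep :: "(nat \<Rightarrow> nat option) \<times> bool \<Rightarrow> trm \<times> nat \<Rightarrow> (nat \<Rightarrow> nat option) \<times> bool" where
  "mstep (\<beta>, ok) (Var x, v) =
     (case \<beta> x of None \<Rightarrow> (\<beta>(x := Some v), ok) | Some w \<Rightarrow> (\<beta>, ok \<and> w = v))"
| "mstep (\<beta>, ok) (Cst c, v) = (\<beta>, ok \<and> c = v)"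

definition match_code :: ram where
  "match_code = loop (Arr aTAG (Reg rI))
     (cond (Minus (Arr aTAG (Reg rI)) (Num 1))
        (cond (neq (Arr aVAL (Reg rI)) (Arr aKEY (Reg rG))) (asg rOk (Num 0)) Skip)
        (cond (neq (Arr aENVS (Arr aVAL (Reg rI))) (Reg rSt))
           (sto aENVS (Arr aVAL (Reg rI)) (Reg rSt) ;; sto aENV (Arr aVAL (Reg rI)) (Arr aKEY (Reg rG)))
           (cond (neq (Arr aENV (Arr aVAL (Reg rI))) (Arr aKEY (Reg rG))) (asg rOk (Num 0)) Skip)) ;;
      asg rI (Plus (Reg rI) (Num 1)) ;;
      asg rG (Arr aTL (Reg rG)))"

lemma wp_match:
  assumes "patf (marr s aTAG) (marr s aVAL) (mreg s rI) ps"
    and "path (marr s aKEY) (marr s aTL) (mreg s rG) fs" "length fs = length ps"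
  shows "wp match_code (\<lambda>n s'. n \<le> 8 * length ps + 1 \<and> same {rI, rG, rOk} {aENV, aENVS} s s' \<and>
    (\<forall>x. marr s' aENVS x = marr s aENVS x \<or> marr s' aENVS x = mreg s rSt) \<and>
    (envof s', mreg s' rOk \<noteq> 0) = foldl mstep (envof s, mreg s rOk \<noteq> 0) (zip ps fs)) s"
    (is "wp _ (?Q s ps fs) _")
  using assms
proof (induction ps arbitrary: fs s)
  case Nil
  then show ?case
    unfolding match_code_def by (intro wp_loop_0) auto
next
  case (Cons t ps)
  obtain v fs' where fs: "fs = v # fs'" using Cons.prems by (cases fs) auto
  have T: "marr s aTAG (mreg s rI) = tag t" "marr s aVAL (mreg s rI) = tval t"
    "patf (marr s aTAG) (marr s aVAL) (Suc (mreg s rI)) ps"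
    "mreg s rG \<noteq> 0" "marr s aKEY (mreg s rG) = v" "path (marr s aKEY) (marr s aTL) (marr s aTL (mreg s rG)) fs'"
    "length fs' = length ps"
    using Cons.prems unfolding fs by auto
  define b e where "b = fst (mstep (envof s, mreg s rOk \<noteq> 0) (t, v))"
    and "e = snd (mstep (envof s, mreg s rOk \<noteq> 0) (t, v))"
  have be: "mstep (envof s, mreg s rOk \<noteq> 0) (t, v) = (b, e)" unfolding b_def e_def by simp
  \<comment> \<open>All branches of the loop body lead to a state as described for
    \<open>s1\<close>, so the induction hypothesis is used once, here, and not in every
    branch.\<close>
  have step: "wp match_code (\<lambda>m. ?Q s (t # ps) (v # fs') (8 + m)) s1"
    if s1: "same {rI, rG, rOk} {aENV, aENVS} s s1"
      "\<forall>x. marr s1 aENVS x = marr s aENVS x \<or> marr s1 aENVS x = mreg s rSt"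
      "mreg s1 rI = Suc (mreg s rI)" "mreg s1 rG = marr s aTL (mreg s rG)"
      "envof s1 = b" "(mreg s1 rOk \<noteq> 0) = e" for s1
  proof (rule wp_conseq[OF Cons.IH[of s1 fs']])
    show "patf (marr s1 aTAG) (marr s1 aVAL) (mreg s1 rI) ps" "path (marr s1 aKEY) (marr s1 aTL) (mreg s1 rG) fs'"
      "length fs' = length ps"
      using T s1 by (simp_all add: same_def)
    fix m s'
    assume "?Q s1 ps fs' m s'"
    moreover from this have "same {rI, rG, rOk} {aENV, aENVS} s s'"
      using s1(1) same_trans by blast
    moreover have "mreg s1 rSt = mreg s rSt" using s1(1) by (simp add: same_def)
    ultimately show "?Q s (t # ps) (v # fs') (8 + m) s'"
      using s1(2,5,6) be by (simp, metis)
  qed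
  show ?case
    unfolding fs
    apply (subst match_code_def)
    apply (rule wp_loop_step)
      apply simp
     apply (use T in \<open>cases t; simp\<close>)
    unfolding match_code_def[symmetric]
    apply (intro wp_seq wp_cond wp_asg wp_sto wp_skip)
                        apply (simp_all only: aval.simps nat_neq)
                   apply simp_all
    subgoal using T by (cases t) (auto intro!: wp_conseq[OF step] simp: same_def envof_def b_def e_def fun_eq_iff)
    subgoal using T by (cases t) (auto intro!: wp_conseq[OF step] simp: same_def envof_def b_def e_def fun_eq_iff)
    subgoal using T by (cases t) (auto intro!: wp_conseq[OF step] simp: same_def envof_def b_def e_def fun_eq_iff)
    subgoal using T by (cases t) (auto intro!: wp_conseq[OF step] simp: same_def envof_def b_def e_def fun_eq_iff)
    subgoal using T by (cases t) (auto intro!: wp_conseq[OF step] simp: same_def envof_def b_def e_def fun_eq_iff)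
    done
qed

section \<open>Hash-consed lists\<close>

definition isnode :: "st \<Rightarrow> nat \<Rightarrow> bool" where
  "isnode s n \<longleftrightarrow> n \<le> mreg s rNn \<and> mreg s rBd dvd n"

definition trie :: "st \<Rightarrow> bool" where
  "trie s \<longleftrightarrow> 0 < mreg s rBd \<and> mreg s rBd dvd mreg s rNn \<and> marr s aCLS 0 = 0 \<and>
     (\<forall>n. isnode s n \<and> n \<noteq> 0 \<longrightarrow> isnode s (marr s aTL n) \<and> marr s aTL n < n \<and> marr s aKEY n < mreg s rBd \<and>
        marr s aTR (marr s aTL n + marr s aKEY n) = n \<and> marr s aCLS n = Suc (marr s aKEY n)) \<and>
     (\<forall>n v. isnode s n \<and> v < mreg s rBd \<and> marr s aTR (n + v) \<noteq> 0 \<longrightarrow>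
        isnode s (marr s aTR (n + v)) \<and> marr s aTL (marr s aTR (n + v)) = n \<and> marr s aKEY (marr s aTR (n + v)) = v) \<and>
     (\<forall>x \<ge> mreg s rNn + mreg s rBd. marr s aTR x = 0)"

abbreviation npath :: "st \<Rightarrow> nat \<Rightarrow> nat list \<Rightarrow> bool" where
  "npath s \<equiv> path (marr s aKEY) (marr s aTL)"

fun fcls :: "nat list \<Rightarrow> nat" where "fcls [] = 0" | "fcls (x # xs) = Suc x"

lemma isnode_0 [simp]: "isnode s 0"
  by (simp add: isnode_def)

lemma trieD:
  assumes "trie s" "isnode s n" "n \<noteq> 0"
  shows "isnode s (marr s aTL n)" "marr s aTL n < n" "marr s aKEY n < mreg s rBd"
    "marr s aTR (marr s aTL n + marr s aKEY n) = n" "marr s aCLS n = Suc (marr s aKEY n)"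
  using assms unfolding trie_def by blast+

lemma trieD2:
  assumes "trie s" "isnode s n" "v < mreg s rBd" "marr s aTR (n + v) \<noteq> 0"
  shows "isnode s (marr s aTR (n + v))" "marr s aTL (marr s aTR (n + v)) = n" "marr s aKEY (marr s aTR (n + v)) = v"
  using assms unfolding trie_def by blast+

lemma trie_basic:
  assumes "trie s"
  shows "0 < mreg s rBd" "mreg s rBd dvd mreg s rNn" "marr s aCLS 0 = 0"
    "mreg s rNn + mreg s rBd \<le> x \<Longrightarrow> marr s aTR x = 0"
  using assms unfolding trie_def by blast+

text \<open>By induction the tails have the same node; with the same key this is the same table
  entry, which names the node.\<close>

lemma npath_inj:
  assumes "trie s" "isnode s n" "isnode s m" "npath s n xs" "npath s m xs"
  shows "n = m"
  using assms(2-)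
proof (induction xs arbitrary: n m)
  case (Cons x xs)
  then show ?case using trieD[OF assms(1)] by (metis path.simps(2))
qed simp

lemma npath_unique: "npath s n xs \<Longrightarrow> npath s n ys \<Longrightarrow> xs = ys"
proof (induction xs arbitrary: n ys)
  case Nil
  then show ?case by (cases ys) auto
next
  case (Cons x xs)
  then show ?case by (cases ys) auto
qed

lemma npath_less:
  assumes "trie s" "isnode s n" "npath s n xs"
  shows "\<forall>x\<in>set xs. x < mreg s rBd"
  using assms(2-)
proof (induction xs arbitrary: n)
  case (Cons x xs)
  then show ?case using trieD[OF assms(1) Cons.prems(1)] by auto
qed simp

lemma npath_cls: "trie s \<Longrightarrow> isnode s n \<Longrightarrow> npath s n xs \<Longrightarrow> marr s aCLS n = fcls xs"
  by (cases xs) (simp_all add: trieD(5) trie_basic(3))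

text \<open>Growth of the store: old nodes keep head and tail, so a stored list remains readable at
  its node.\<close>

definition ext :: "st \<Rightarrow> st \<Rightarrow> bool" where
  "ext s s' \<longleftrightarrow> mreg s rNn \<le> mreg s' rNn \<and> mreg s' rBd = mreg s rBd \<and>
     (\<forall>n. isnode s n \<longrightarrow> marr s' aKEY n = marr s aKEY n \<and> marr s' aTL n = marr s aTL n)"

lemma ext_refl [simp]: "ext s s" by (simp add: ext_def)

lemma ext_isnode: "ext s s' \<Longrightarrow> isnode s n \<Longrightarrow> isnode s' n"
  by (auto simp: ext_def isnode_def)

lemma ext_trans: "ext s s' \<Longrightarrow> ext s' s'' \<Longrightarrow> ext s s''"
  using ext_isnode unfolding ext_def by (metis order_trans)

lemma ext_npath:
  assumes "ext s s'" "trie s" "isnode s n" "npath s n xs"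
  shows "npath s' n xs"
  using assms(3,4)
proof (induction xs arbitrary: n)
  case (Cons x xs)
  then show ?case using trieD(1)[OF assms(2) Cons.prems(1)] assms(1) by (auto simp: ext_def)
qed simp

lemma same_ext: "same W R s s' \<Longrightarrow> rNn \<notin> W \<Longrightarrow> rBd \<notin> W \<Longrightarrow> aKEY \<notin> R \<Longrightarrow> aTL \<notin> R \<Longrightarrow> ext s s'"
  by (auto simp: same_def ext_def)

lemma same_rg: "same W R s s' \<Longrightarrow> v \<notin> W \<Longrightarrow> mreg s' v = mreg s v"
  by (simp add: same_def)

lemma same_ar: "same W R s s' \<Longrightarrow> a \<notin> R \<Longrightarrow> marr s' a = marr s a"
  by (simp add: same_def)

lemma same_trie:
  assumes "same W R s s'" "rNn \<notin> W" "rBd \<notin> W" "aTR \<notin> R" "aKEY \<notin> R" "aTL \<notin> R" "aCLS \<notin> R"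
  shows "trie s' = trie s"
  unfolding trie_def isnode_def assms(2-3)[THEN same_rg[OF assms(1)]] assms(4-)[THEN same_ar[OF assms(1)]] ..

definition cons_code :: ram where
  "cons_code =
     cond (Arr aTR (Plus (Reg rNd) (Reg rX))) Skip
       (asg rNn (Plus (Reg rNn) (Reg rBd)) ;; sto aTR (Plus (Reg rNd) (Reg rX)) (Reg rNn) ;;
        sto aKEY (Reg rNn) (Reg rX) ;; sto aTL (Reg rNn) (Reg rNd) ;;
        sto aCLS (Reg rNn) (Plus (Reg rX) (Num 1))) ;;
     asg rNd (Arr aTR (Plus (Reg rNd) (Reg rX)))"

text \<open>Division with remainder: a multiple of \<open>b\<close> and a number below
  \<open>b\<close> can be recovered from their sum. Plain addition thus serves as a pairing
  function.\<close>

lemma block_addr: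
  fixes b :: nat
  assumes "b dvd n" "b dvd m" "v < b" "w < b"
  shows "n + v = m + w \<longleftrightarrow> n = m \<and> v = w"
proof -
  obtain i j where "n = b * i" "m = b * j" using assms by (auto elim!: dvdE)
  then have "(n + v) mod b = v" "(m + w) mod b = w" using assms by auto
  then show ?thesis by (metis add_right_cancel)
qed

text \<open>The new node follows the last one at distance \<open>B\<close>. The single new table
  entry collides with no other by \<open>block_addr\<close>, and it lies below the region that has
  to stay empty.\<close>

lemma trie_alloc:
  assumes t: "trie s" and n: "isnode s n" and v: "v < mreg s rBd" and z: "marr s aTR (n + v) = 0"
    and s': "mreg s' rNn = mreg s rNn + mreg s rBd" "mreg s' rBd = mreg s rBd"
      "marr s' aTR = (marr s aTR)(n + v := mreg s rNn + mreg s rBd)"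
      "marr s' aKEY = (marr s aKEY)(mreg s rNn + mreg s rBd := v)"
      "marr s' aTL = (marr s aTL)(mreg s rNn + mreg s rBd := n)"
      "marr s' aCLS = (marr s aCLS)(mreg s rNn + mreg s rBd := Suc v)"
  shows "trie s'" "ext s s'" "isnode s' (mreg s rNn + mreg s rBd)"
proof -
  define b nn where "b = mreg s rBd" and "nn = mreg s rNn"
  have b: "0 < b" "b dvd nn" using trie_basic[OF t] by (simp_all add: b_def nn_def)
  \<comment> \<open>The only multiple of \<open>b\<close> from \<open>nn + 1\<close> to
    \<open>nn + b\<close> is \<open>nn + b\<close> itself.\<close>
  have node': "isnode s' m \<longleftrightarrow> isnode s m \<or> m = nn + b" for m
  proof
    assume m: "isnode s' m"
    show "isnode s m \<or> m = nn + b"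
    proof (cases "m \<le> nn")
      case False
      then have "b dvd m - nn" using m b s' by (auto simp: isnode_def b_def nn_def intro: dvd_diff_nat)
      then have "b \<le> m - nn" using False by (intro dvd_imp_le) auto
      then show ?thesis using m s' False by (auto simp: isnode_def b_def nn_def)
    qed (use m s' in \<open>auto simp: isnode_def b_def nn_def\<close>)
  qed (use s' b in \<open>auto simp: isnode_def b_def nn_def\<close>)
  show "isnode s' (mreg s rNn + mreg s rBd)" using node' by (simp add: b_def nn_def)
  have old: "m \<le> nn" "m \<noteq> nn + b" "b dvd m" if "isnode s m" for m
    using that b by (auto simp: isnode_def b_def nn_def)
  have dv: "b dvd m" if "isnode s' m" for m using that s' by (auto simp: isnode_def b_def)
  have eq: "m + w = n + v \<longleftrightarrow> m = n \<and> w = v" if "isnode s' m" "w < b" for m w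
    using block_addr[OF dv[OF that(1)] old(3)[OF n] that(2)] v b_def by simp
  show "ext s s'" using old s' by (auto simp: ext_def b_def nn_def)
  show "trie s'"
    unfolding trie_def
  proof (intro conjI allI impI)
    show "0 < mreg s' rBd" "mreg s' rBd dvd mreg s' rNn" using b s' by (auto simp: b_def nn_def)
    show "marr s' aCLS 0 = 0" using trie_basic(3)[OF t] b s' by (simp add: b_def nn_def)
  next
    fix m assume m: "isnode s' m \<and> m \<noteq> 0"
    have *: "isnode s' (marr s' aTL m) \<and> marr s' aTL m < m \<and> marr s' aKEY m < b \<and>
       marr s' aTR (marr s' aTL m + marr s' aKEY m) = m \<and> marr s' aCLS m = Suc (marr s' aKEY m)"
    proof (cases "m = nn + b")
      case True
      then show ?thesis using s' node' n v old(1)[OF n] b by (auto simp: b_def nn_def)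
    next
      case False
      then have "isnode s m" using m node' by auto
      note d = trieD[OF t this] and o = old[OF this]
      have "marr s aTL m + marr s aKEY m \<noteq> n + v" using d z m by auto
      then show ?thesis using d m node' False s' by (auto simp: b_def nn_def)
    qed
    then show "isnode s' (marr s' aTL m)" "marr s' aTL m < m" "marr s' aKEY m < mreg s' rBd"
       "marr s' aTR (marr s' aTL m + marr s' aKEY m) = m" "marr s' aCLS m = Suc (marr s' aKEY m)"
      using s' b_def by auto
  next
    fix m w assume m: "isnode s' m \<and> w < mreg s' rBd \<and> marr s' aTR (m + w) \<noteq> 0"
    have w: "w < b" using m s' b_def by simp
    have "isnode s' (marr s' aTR (m + w)) \<and> marr s' aTL (marr s' aTR (m + w)) = m \<and> marr s' aKEY (marr s' aTR (m + w)) = w"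
    proof (cases "m = n \<and> w = v")
      case True
      then show ?thesis using s' node' by (auto simp: b_def nn_def)
    next
      case False
      then have e: "marr s' aTR (m + w) = marr s aTR (m + w)" using eq[of m w] m w s' by auto
      \<comment> \<open>The entries of the new node begin where the old empty region began, so all
        of them are still 0.\<close>
      have "m \<noteq> nn + b"
      proof
        assume "m = nn + b"
        then have "marr s aTR (m + w) = 0" using trie_basic(4)[OF t] by (simp add: b_def nn_def)
        then show False using e m by simp
      qed
      then have m': "isnode s m" using m node' by auto
      note d = trieD2[OF t m' w[unfolded b_def] m[THEN conjunct2, THEN conjunct2, unfolded e]]
      have "marr s aTR (m + w) \<noteq> nn + b" using d(1) old(2) by blast
      then show ?thesis using d e node' s' by (auto simp: b_def nn_def)
    qed
    then show "isnode s' (marr s' aTR (m + w))" "marr s' aTL (marr s' aTR (m + w)) = m" "marr s' aKEY (marr s' aTR (m + w)) = w"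
      by auto
  next
    fix x assume "mreg s' rNn + mreg s' rBd \<le> x"
    moreover have "n + v < nn + b" using old(1)[OF n] v b_def by simp
    ultimately show "marr s' aTR x = 0" using s' trie_basic(4)[OF t] by (auto simp: b_def nn_def)
  qed
qed

lemma wp_cons:
  assumes "trie s" "isnode s (mreg s rNd)" "mreg s rX < mreg s rBd" "npath s (mreg s rNd) xs"
  shows "wp cons_code (\<lambda>n s'. n \<le> 7 \<and> trie s' \<and> ext s s' \<and> isnode s' (mreg s' rNd) \<and>
     npath s' (mreg s' rNd) (mreg s rX # xs) \<and> same {rNd, rNn} {aTR, aKEY, aTL, aCLS} s s') s"
proof (cases "marr s aTR (mreg s rNd + mreg s rX) = 0")
  case False
  note d = trieD2[OF assms(1-3) False]
  define t where "t = s\<lparr>mreg := (mreg s)(rNd := marr s aTR (mreg s rNd + mreg s rX))\<rparr>"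
  have sm: "same {rNd} {} s t" by (simp add: t_def same_def)
  have "trie t" using same_trie[OF sm] assms by simp
  moreover have "ext s t" using same_ext[OF sm] by simp
  moreover have "wp cons_code (\<lambda>n s'. n \<le> 7 \<and> s' = t) s"
    unfolding cons_code_def
    apply (intro wp_seq wp_cond wp_asg wp_sto wp_skip)
    using False by (simp_all add: t_def)
  ultimately show ?thesis
    by (elim wp_conseq) (use d assms False sm in \<open>auto simp: t_def isnode_def same_def\<close>)
next
  case True
  define t where "t = s\<lparr>mreg := (mreg s)(rNn := mreg s rNn + mreg s rBd, rNd := mreg s rNn + mreg s rBd),
    marr := (marr s)(aTR := (marr s aTR)(mreg s rNd + mreg s rX := mreg s rNn + mreg s rBd),
      aKEY := (marr s aKEY)(mreg s rNn + mreg s rBd := mreg s rX),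
      aTL := (marr s aTL)(mreg s rNn + mreg s rBd := mreg s rNd),
      aCLS := (marr s aCLS)(mreg s rNn + mreg s rBd := Suc (mreg s rX)))\<rparr>"
  have t: "trie t" "ext s t" "isnode t (mreg s rNn + mreg s rBd)"
    by (rule trie_alloc[OF assms(1-3) True]; simp add: t_def)+
  have p: "npath t (mreg s rNd) xs" using ext_npath[OF t(2) assms(1,2,4)] .
  have "wp cons_code (\<lambda>n s'. n \<le> 7 \<and> s' = t) s"
    unfolding cons_code_def
    apply (intro wp_seq wp_cond wp_asg wp_sto wp_skip)
    using True by (simp_all add: t_def)
  then show ?thesis
    by (rule wp_conseq) (use t p trie_basic(1)[OF assms(1)] in \<open>simp_all add: t_def same_def\<close>)
qed

definition inst_code :: ram where
  "inst_code = asg rNd (Num 0) ;;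
     loop (Arr aTAG (Reg rH))
       (cond (Minus (Arr aTAG (Reg rH)) (Num 1)) (asg rX (Arr aVAL (Reg rH)))
          (asg rX (Arr aENV (Arr aVAL (Reg rH)))) ;;
        cons_code ;;
        asg rH (Minus (Reg rH) (Num 1)))"

lemma wp_inst_loop:
  assumes "patb (marr s aTAG) (marr s aVAL) (mreg s rH) ts" "trie s" "isnode s (mreg s rNd)" "npath s (mreg s rNd) xs"
    "\<forall>t\<in>set ts. ground_trm (marr s aENV) t < mreg s rBd"
  shows "wp (loop (Arr aTAG (Reg rH))
       (cond (Minus (Arr aTAG (Reg rH)) (Num 1)) (asg rX (Arr aVAL (Reg rH)))
          (asg rX (Arr aENV (Arr aVAL (Reg rH)))) ;;
        cons_code ;;
        asg rH (Minus (Reg rH) (Num 1))))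
    (\<lambda>n s'. n \<le> 11 * length ts + 1 \<and> trie s' \<and> ext s s' \<and> isnode s' (mreg s' rNd) \<and>
     npath s' (mreg s' rNd) (rev (map (ground_trm (marr s aENV)) ts) @ xs) \<and>
     same {rNd, rNn, rX, rH} {aTR, aKEY, aTL, aCLS} s s') s" (is "wp ?c (?Q s ts xs) _")
  using assms
proof (induction ts arbitrary: s xs)
  case Nil
  then show ?case by (intro wp_loop_0) auto
next
  case (Cons t ts)
  define v where "v = ground_trm (marr s aENV) t"
  define s1 where "s1 = s\<lparr>mreg := (mreg s)(rX := v)\<rparr>"
  have T: "marr s aTAG (mreg s rH) = tag t" "marr s aVAL (mreg s rH) = tval t"
    "patb (marr s aTAG) (marr s aVAL) (mreg s rH - 1) ts" using Cons.prems by auto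
  have sm1: "same {rX} {} s s1" by (simp add: s1_def same_def)
  have tr: "trie s1" using same_trie[OF sm1] Cons.prems by simp
  have c: "wp cons_code (\<lambda>n s'. n \<le> 7 \<and> trie s' \<and> ext s1 s' \<and> isnode s' (mreg s' rNd) \<and>
     npath s' (mreg s' rNd) (mreg s1 rX # xs) \<and> same {rNd, rNn} {aTR, aKEY, aTL, aCLS} s1 s') s1"
    using Cons.prems tr by (intro wp_cons) (auto simp: s1_def isnode_def v_def)
  have "wp cons_code (\<lambda>n. wp (asg rH (Minus (Reg rH) (Num 1)))
      (\<lambda>m. wp ?c (\<lambda>k. ?Q s (t # ts) xs (3 + n + m + k)))) s1"
  proof (rule wp_conseq[OF c], intro wp_asg, simp, elim conjE)
    fix n :: nat and s2
    assume s2: "n \<le> 7" "trie s2" "ext s1 s2" "isnode s2 (mreg s2 rNd)"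
     "npath s2 (mreg s2 rNd) (mreg s1 rX # xs)" "same {rNd, rNn} {aTR, aKEY, aTL, aCLS} s1 s2"
    define s3 where "s3 = s2\<lparr>mreg := (mreg s2)(rH := aval (Minus (Reg rH) (Num 1)) s2)\<rparr>"
    have sm3: "same {rH} {} s2 s3" by (simp add: s3_def same_def)
    have sm: "same {rNd, rNn, rX, rH} {aTR, aKEY, aTL, aCLS} s s3"
      by (rule same_trans[OF same_mono[OF sm1] same_trans[OF same_mono[OF s2(6)] same_mono[OF sm3]]]) auto
    have 3: "trie s3" using same_trie[OF sm3] s2 by simp
    have ex3: "ext s s3"
      by (rule ext_trans[OF same_ext[OF sm1] ext_trans[OF s2(3) same_ext[OF sm3]]]) auto
    have env: "marr s3 aENV = marr s aENV" "mreg s3 rBd = mreg s rBd" "marr s3 aTAG = marr s aTAG" "marr s3 aVAL = marr s aVAL"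
      using sm by (auto simp: same_def)
    have rH: "mreg s3 rH = mreg s rH - 1" using same_rg[OF s2(6), of rH] same_rg[OF sm1, of rH] by (simp add: s3_def)
    show "wp ?c (\<lambda>k. ?Q s (t # ts) xs (3 + n + 1 + k)) s3"
    proof (rule wp_conseq[OF Cons.IH[of s3 "v # xs"]])
      show "patb (marr s3 aTAG) (marr s3 aVAL) (mreg s3 rH) ts" using T(3) env rH by simp
      show "trie s3" by fact
      show "isnode s3 (mreg s3 rNd)" using s2(4) by (simp add: s3_def isnode_def)
      show "npath s3 (mreg s3 rNd) (v # xs)" using s2(5) by (simp add: s3_def s1_def)
      show "\<forall>t\<in>set ts. ground_trm (marr s3 aENV) t < mreg s3 rBd" using Cons.prems env by auto
      fix k :: nat and s'
      assume "?Q s3 ts (v # xs) k s'"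
      then show "?Q s (t # ts) xs (3 + n + 1 + k) s'"
        using s2(1) env ext_trans[OF ex3, of s'] same_trans[OF sm, of s'] by (simp add: v_def)
    qed
  qed
  note main = this
  show ?case
    apply (rule wp_loop_step)
      apply simp
     apply (use T in \<open>cases t; simp\<close>)
    apply (intro wp_seq wp_cond wp_asg)
    using T main apply (cases t; simp add: s1_def v_def)
    using T main by (cases t; simp add: s1_def v_def)+
qed

lemma wp_inst:
  assumes "patb (marr s aTAG) (marr s aVAL) (mreg s rH) (rev ts)" "trie s"
    "\<forall>t\<in>set ts. ground_trm (marr s aENV) t < mreg s rBd"
  shows "wp inst_code (\<lambda>n s'. n \<le> 11 * length ts + 2 \<and> trie s' \<and> ext s s' \<and> isnode s' (mreg s' rNd) \<and>
     npath s' (mreg s' rNd) (map (ground_trm (marr s aENV)) ts) \<and>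
     same {rNd, rNn, rX, rH} {aTR, aKEY, aTL, aCLS} s s') s"
proof -
  define s1 where "s1 = s\<lparr>mreg := (mreg s)(rNd := 0)\<rparr>"
  have sm1: "same {rNd} {} s s1" by (simp add: s1_def same_def)
  then have sm: "same {rNd, rNn, rX, rH} {aTR, aKEY, aTL, aCLS} s s1" by (rule same_mono) auto
  have e: "ext s s1" using same_ext[OF sm1] by simp
  have "trie s1" using same_trie[OF sm1] assms by simp
  then show ?thesis
    unfolding inst_code_def
    apply (intro wp_seq wp_asg)
     apply simp
    apply (rule wp_conseq[OF wp_inst_loop[where ts="rev ts" and xs="[]"]])
    using assms ext_trans[OF e] same_trans[OF sm]
    by (auto simp: s1_def rev_map)
qed

section \<open>The queue of derived facts\<close>

text \<open>The cells of class \<open>c\<close>, newest first as pushing leaves them; cells are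
  numbered from 1 because 0 ends a \<open>chain\<close>.\<close>

definition cells :: "(nat \<Rightarrow> nat) \<Rightarrow> nat \<Rightarrow> nat \<Rightarrow> nat list" where
  "cells f n c = rev (map Suc (filter (\<lambda>j. f j = c) [0..<n]))"

lemma cells_Suc: "cells f (Suc n) c = (if f n = c then [Suc n] else []) @ cells f n c"
  by (simp add: cells_def)

lemma cells_cong: "(\<And>j. j < n \<Longrightarrow> f j = g j) \<Longrightarrow> cells f n c = cells g n c"
  by (auto simp: cells_def intro!: filter_cong)

lemma set_cells: "set (cells f n c) = {Suc j | j. j < n \<and> f j = c}"
  by (auto simp: cells_def)

text \<open>The new cell number is larger than all numbers in the existing lists, so writing its
  successor disturbs none of them.\<close>

lemma chain_push:
  assumes "\<And>c. chain X (L c) (cells f n c)" "\<And>j. j < n \<Longrightarrow> f' j = f j" "f' n = k"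
  shows "chain (X(Suc n := L k)) ((L(k := Suc n)) c) (cells f' (Suc n) c)"
proof -
  have "chain (X(Suc n := L k)) (L c') (cells f n c')" for c'
    by (rule chain_cong[OF assms(1)]) (auto simp: set_cells)
  moreover have "cells f' n c' = cells f n c'" for c' by (rule cells_cong) (rule assms(2))
  ultimately show ?thesis using assms(3) by (auto simp: cells_Suc)
qed

fun pcls :: "trm list \<Rightarrow> nat" where "pcls (Cst p # ts) = Suc p" | "pcls ts = 0"

type_synonym occ = "trm list \<times> trm list \<times> trm list"

text \<open>The bound on the head terms lets constants of the head become keys of stored
  nodes.\<close>

definition occ_repr :: "st \<Rightarrow> nat \<Rightarrow> occ \<Rightarrow> bool" where
  "occ_repr s j = (\<lambda>(a, b, h). patf (marr s aTAG) (marr s aVAL) (marr s aOWN j) a \<and>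
     patf (marr s aTAG) (marr s aVAL) (marr s aOTH j) b \<and> marr s aOCO j = pcls b \<and>
     patb (marr s aTAG) (marr s aVAL) (marr s aOHD j) (rev h) \<and> (\<forall>t\<in>set h. tval t < mreg s rBd))"

definition static :: "st \<Rightarrow> occ list \<Rightarrow> nat set \<Rightarrow> bool" where
  "static s Occ J \<longleftrightarrow> mreg s rOc = length Occ \<and>
     (\<forall>j<length Occ. occ_repr s (Suc j) (Occ ! j)) \<and>
     (\<forall>c. chain (marr s aONX) (marr s aOL c) (cells (\<lambda>j. pcls (fst (Occ ! j))) (length Occ) c)) \<and>
     (\<forall>c. marr s aIDB c \<noteq> 0 \<longleftrightarrow> c \<in> J)"

lemma static_same:
  assumes "same W R s s'" "rOc \<notin> W" "rBd \<notin> W" "aTAG \<notin> R" "aVAL \<notin> R" "aOWN \<notin> R" "aOTH \<notin> R"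
    "aOCO \<notin> R" "aOHD \<notin> R" "aONX \<notin> R" "aOL \<notin> R" "aIDB \<notin> R"
  shows "static s' Occ J = static s Occ J"
  unfolding static_def occ_repr_def assms(2-3)[THEN same_rg[OF assms(1)]] assms(4-)[THEN same_ar[OF assms(1)]] ..

text \<open>Since lists and nodes correspond uniquely, marking nodes in \<open>aKNOWN\<close>
  decides membership in the queue in constant time.\<close>

definition finv :: "st \<Rightarrow> nat list list \<Rightarrow> bool" where
  "finv s Q \<longleftrightarrow> trie s \<and> mreg s rQc = length Q \<and> distinct Q \<and>
     (\<forall>j<length Q. isnode s (marr s aQN (Suc j)) \<and> npath s (marr s aQN (Suc j)) (Q ! j)) \<and>
     (\<forall>n. marr s aKNOWN n \<noteq> 0 \<longleftrightarrow> (\<exists>j<length Q. marr s aQN (Suc j) = n)) \<and>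
     (\<forall>c. chain (marr s aQNX) (marr s aQL c) (cells (\<lambda>j. fcls (Q ! j)) (length Q) c))"

lemma finvD:
  assumes "finv s Q"
  shows "trie s" "mreg s rQc = length Q" "distinct Q"
    "j < length Q \<Longrightarrow> isnode s (marr s aQN (Suc j))" "j < length Q \<Longrightarrow> npath s (marr s aQN (Suc j)) (Q ! j)"
    "marr s aKNOWN n \<noteq> 0 \<longleftrightarrow> (\<exists>j<length Q. marr s aQN (Suc j) = n)"
    "chain (marr s aQNX) (marr s aQL c) (cells (\<lambda>j. fcls (Q ! j)) (length Q) c)"
  using assms unfolding finv_def by blast+

lemma finv_ext:
  assumes "finv s Q" "ext s s'" "trie s'" "same W R s s'" "rQc \<notin> W"
    "aKNOWN \<notin> R" "aQN \<notin> R" "aQNX \<notin> R" "aQL \<notin> R"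
  shows "finv s' Q"
proof -
  note D = finvD[OF assms(1)]
  note e = assms(5)[THEN same_rg[OF assms(4)]] assms(6-)[THEN same_ar[OF assms(4)]]
  show ?thesis
    unfolding finv_def e
    using D(2,3,6,7) assms(3) ext_isnode[OF assms(2)] ext_npath[OF assms(2) D(1)] D(4,5) by blast
qed

lemma finv_same:
  assumes "finv s Q" "same W R s s'" "rQc \<notin> W" "rNn \<notin> W" "rBd \<notin> W"
    "aKNOWN \<notin> R" "aQN \<notin> R" "aQNX \<notin> R" "aQL \<notin> R" "aTR \<notin> R" "aKEY \<notin> R" "aTL \<notin> R" "aCLS \<notin> R"
  shows "finv s' Q"
  using assms finv_ext[OF assms(1) same_ext[OF assms(2)] _ assms(2)] same_trie[OF assms(2)] finvD(1) by blast

definition insert_code :: ram where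
  "insert_code = cond (Arr aKNOWN (Reg rNd)) Skip
     (sto aKNOWN (Reg rNd) (Num 1) ;; asg rQc (Plus (Reg rQc) (Num 1)) ;; sto aQN (Reg rQc) (Reg rNd) ;;
      sto aQNX (Reg rQc) (Arr aQL (Arr aCLS (Reg rNd))) ;; sto aQL (Arr aCLS (Reg rNd)) (Reg rQc))"

text \<open>Facts are pushed while lists of facts are being traversed. The claim about
  \<open>aQNX\<close> says that old cells keep their successors, so a traversal in progress goes on
  undisturbed and does not meet the newcomers.\<close>

lemma wp_insert:
  assumes Q: "finv s Q" and nd: "isnode s (mreg s rNd)" "npath s (mreg s rNd) f"
  shows "wp insert_code (\<lambda>n s'. n \<le> 7 \<and> finv s' (if f \<in> set Q then Q else Q @ [f]) \<and> ext s s' \<and>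
     (\<forall>x\<le>length Q. marr s' aQNX x = marr s aQNX x) \<and>
     same {rQc} {aKNOWN, aQN, aQNX, aQL} s s') s"
proof -
  note D = finvD[OF Q]
  \<comment> \<open>One direction uses that a node carries a single list, the other that a list has
    a single node.\<close>
  have known: "marr s aKNOWN (mreg s rNd) \<noteq> 0 \<longleftrightarrow> f \<in> set Q"
  proof
    assume "marr s aKNOWN (mreg s rNd) \<noteq> 0"
    then obtain j where j: "j < length Q" "marr s aQN (Suc j) = mreg s rNd" using D(6) by blast
    have "Q ! j = f" by (rule npath_unique[OF D(5)[OF j(1)]]) (use j nd in simp)
    then show "f \<in> set Q" using j by auto
  next
    assume "f \<in> set Q"
    then obtain j where j: "j < length Q" "Q ! j = f" by (auto simp: in_set_conv_nth)
    have "marr s aQN (Suc j) = mreg s rNd"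
      by (rule npath_inj[OF D(1) D(4)[OF j(1)] nd(1) D(5)[OF j(1)]]) (use j nd in simp)
    then show "marr s aKNOWN (mreg s rNd) \<noteq> 0" using D(6) j by blast
  qed
  show ?thesis
  proof (cases "f \<in> set Q")
    case True
    then have "marr s aKNOWN (mreg s rNd) \<noteq> 0" using known by simp
    then have "wp insert_code (\<lambda>n s'. n \<le> 7 \<and> s' = s) s"
      unfolding insert_code_def by (intro wp_cond wp_skip) simp_all
    then show ?thesis by (rule wp_conseq) (use True Q in simp)
  next
    case False
    define k where "k = marr s aCLS (mreg s rNd)"
    have k: "k = fcls f" using npath_cls[OF D(1) nd] k_def by simp
    define n where "n = length Q"
    define s' where "s' = s\<lparr>mreg := (mreg s)(rQc := Suc n),
      marr := (marr s)(aKNOWN := (marr s aKNOWN)(mreg s rNd := 1), aQN := (marr s aQN)(Suc n := mreg s rNd),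
        aQNX := (marr s aQNX)(Suc n := marr s aQL k), aQL := (marr s aQL)(k := Suc n))\<rparr>"
    have 0: "marr s aKNOWN (mreg s rNd) = 0" using known False by simp
    then have wp: "wp insert_code (\<lambda>n s''. n \<le> 7 \<and> s'' = s') s"
      unfolding insert_code_def
      apply (intro wp_seq wp_cond wp_asg wp_sto wp_skip)
      using D(2) by (simp_all add: s'_def n_def k_def)
    have sm: "same {rQc} {aKNOWN, aQN, aQNX, aQL} s s'" by (simp add: s'_def same_def)
    have ex: "ext s s'" using same_ext[OF sm] by simp
    have tr: "trie s'" using same_trie[OF sm] D(1) by simp
    have fi: "finv s' (Q @ [f])"
      unfolding finv_def
    proof (intro conjI allI impI)
      show "trie s'" by fact
      show "mreg s' rQc = length (Q @ [f])" by (simp add: s'_def n_def)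
      show "distinct (Q @ [f])" using D(3) False by simp
    next
      fix j assume j: "j < length (Q @ [f])"
      have "isnode s' (marr s' aQN (Suc j)) \<and> npath s' (marr s' aQN (Suc j)) ((Q @ [f]) ! j)"
      proof (cases "j = n")
        case True
        then show ?thesis
          using ext_isnode[OF ex nd(1)] ext_npath[OF ex D(1) nd] by (simp add: s'_def n_def)
      next
        case False
        then have "j < length Q" using j n_def by simp
        then show ?thesis
          using ext_isnode[OF ex D(4)] ext_npath[OF ex D(1) D(4) D(5)] by (simp add: s'_def n_def nth_append)
      qed
      then show "isnode s' (marr s' aQN (Suc j))" "npath s' (marr s' aQN (Suc j)) ((Q @ [f]) ! j)" by auto
    next
      fix x
      show "(marr s' aKNOWN x \<noteq> 0) = (\<exists>j<length (Q @ [f]). marr s' aQN (Suc j) = x)"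
        using D(6)[of x] by (auto simp: s'_def n_def less_Suc_eq) (metis less_irrefl_nat)
    next
      fix c
      show "chain (marr s' aQNX) (marr s' aQL c) (cells (\<lambda>j. fcls ((Q @ [f]) ! j)) (length (Q @ [f])) c)"
        using chain_push[of "marr s aQNX" "marr s aQL" "\<lambda>j. fcls (Q ! j)" n "\<lambda>j. fcls ((Q @ [f]) ! j)" k c] D(7)
        by (simp add: s'_def n_def k nth_append)
    qed
    have q: "\<forall>x\<le>length Q. marr s' aQNX x = marr s aQNX x" by (simp add: s'_def n_def)
    show ?thesis by (rule wp_conseq[OF wp]) (use False fi ex sm q in simp)
  qed
qed

text \<open>The bindings are forced: a valuation that respects the old bindings and produces the
  facts respects the new ones. Together with the growth of bindings this makes the flag exact. One
  induction proves all four claims because the flag speaks about the final bindings.\<close>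

lemma match_props:
  assumes "foldl mstep (\<beta>, ok) (zip ps fs) = (\<beta>', ok')" "length fs = length ps"
  shows "\<forall>x v. \<beta> x = Some v \<longrightarrow> \<beta>' x = Some v"
    and "\<forall>x\<in>args_vars ps. \<beta>' x \<noteq> None"
    and "ok' \<longleftrightarrow> ok \<and> map (ground_trm (the \<circ> \<beta>')) ps = fs"
    and "\<And>\<theta>. map (ground_trm \<theta>) ps = fs \<Longrightarrow> \<forall>x v. \<beta> x = Some v \<longrightarrow> \<theta> x = v \<Longrightarrow> \<forall>x v. \<beta>' x = Some v \<longrightarrow> \<theta> x = v"
proof -
  have "(\<forall>x v. \<beta> x = Some v \<longrightarrow> \<beta>' x = Some v) \<and> (\<forall>x\<in>args_vars ps. \<beta>' x \<noteq> None) \<and>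
    (ok' \<longleftrightarrow> ok \<and> map (ground_trm (the \<circ> \<beta>')) ps = fs) \<and>
    (\<forall>\<theta>. map (ground_trm \<theta>) ps = fs \<longrightarrow> (\<forall>x v. \<beta> x = Some v \<longrightarrow> \<theta> x = v) \<longrightarrow> (\<forall>x v. \<beta>' x = Some v \<longrightarrow> \<theta> x = v))"
    using assms
  proof (induction ps arbitrary: fs \<beta> ok)
    case Nil
    then show ?case by (auto simp: args_vars_def)
  next
    case (Cons t ps)
    then obtain v fs' where fs: "fs = v # fs'" by (cases fs) auto
    obtain \<beta>1 ok1 where 1: "mstep (\<beta>, ok) (t, v) = (\<beta>1, ok1)" by fastforce
    have IH: "(\<forall>x v. \<beta>1 x = Some v \<longrightarrow> \<beta>' x = Some v)" "(\<forall>x\<in>args_vars ps. \<beta>' x \<noteq> None)"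
      "(ok' \<longleftrightarrow> ok1 \<and> map (ground_trm (the \<circ> \<beta>')) ps = fs')"
      "(\<forall>\<theta>. map (ground_trm \<theta>) ps = fs' \<longrightarrow> (\<forall>x v. \<beta>1 x = Some v \<longrightarrow> \<theta> x = v) \<longrightarrow> (\<forall>x v. \<beta>' x = Some v \<longrightarrow> \<theta> x = v))"
      using Cons.IH[of \<beta>1 ok1 fs'] Cons.prems 1 fs by (simp_all add: comp_def)
    have s1: "\<beta> x = Some w \<Longrightarrow> \<beta>1 x = Some w" for x w
      using 1 by (cases t) (auto split: option.splits if_splits)
    have s2: "x \<in> trm_vars t \<Longrightarrow> \<beta>1 x \<noteq> None" for x
      using 1 by (cases t) (auto split: option.splits if_splits)
    have s3: "ok1 \<longleftrightarrow> ok \<and> ground_trm (the \<circ> \<beta>') t = v"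
      using 1 IH(1) by (cases t) (auto split: option.splits if_splits)
    have s4: "\<beta>1 x = Some w \<Longrightarrow> \<theta> x = w"
      if "ground_trm \<theta> t = v" "\<forall>x v. \<beta> x = Some v \<longrightarrow> \<theta> x = v" for \<theta> x w
      using 1 that by (cases t) (auto split: option.splits if_splits)
    have s2': "x \<in> trm_vars t \<Longrightarrow> \<beta>' x \<noteq> None" for x using s2[of x] IH(1) by fastforce
    show ?case
    proof (intro conjI)
      show "\<forall>x v. \<beta> x = Some v \<longrightarrow> \<beta>' x = Some v" using s1 IH(1) by blast
      show "\<forall>x\<in>args_vars (t # ps). \<beta>' x \<noteq> None" using s2' IH(2) by (auto simp: args_vars_def)
      show "ok' \<longleftrightarrow> ok \<and> map (ground_trm (the \<circ> \<beta>')) (t # ps) = fs" using IH(3) s3 fs by auto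
      show "\<forall>\<theta>. map (ground_trm \<theta>) (t # ps) = fs \<longrightarrow> (\<forall>x v. \<beta> x = Some v \<longrightarrow> \<theta> x = v) \<longrightarrow> (\<forall>x v. \<beta>' x = Some v \<longrightarrow> \<theta> x = v)"
      proof (intro allI impI)
        fix \<theta> x w
        assume h: "map (ground_trm \<theta>) (t # ps) = fs" "\<forall>x v. \<beta> x = Some v \<longrightarrow> \<theta> x = v" "\<beta>' x = Some w"
        then have "map (ground_trm \<theta>) ps = fs'" "ground_trm \<theta> t = v" using fs by auto
        moreover from this(2) have "\<forall>x v. \<beta>1 x = Some v \<longrightarrow> \<theta> x = v" using s4 h(2) by blast
        ultimately show "\<theta> x = w" using IH(4) h(3) by blast
      qed
    qed
  qed
  then show "\<forall>x v. \<beta> x = Some v \<longrightarrow> \<beta>' x = Some v"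
    and "\<forall>x\<in>args_vars ps. \<beta>' x \<noteq> None"
    and "ok' \<longleftrightarrow> ok \<and> map (ground_trm (the \<circ> \<beta>')) ps = fs"
    and "\<And>\<theta>. map (ground_trm \<theta>) ps = fs \<Longrightarrow> \<forall>x v. \<beta> x = Some v \<longrightarrow> \<theta> x = v \<Longrightarrow> \<forall>x v. \<beta>' x = Some v \<longrightarrow> \<theta> x = v"
    by blast+
qed

text \<open>Matching two patterns in one environment computes their join. \<open>\<eta>\<close> may
  be any total extension of the bindings, which permits using the raw memory array with its
  leftovers at unbound variables.\<close>

lemma match_two:
  assumes "foldl mstep (foldl mstep (Map.empty, True) (zip a f)) (zip b g) = (\<beta>, ok)"
    and len: "length f = length a" "length g = length b"
    and \<eta>: "\<forall>x v. \<beta> x = Some v \<longrightarrow> \<eta> x = v"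
  shows "ok \<Longrightarrow> map (ground_trm \<eta>) a = f" "ok \<Longrightarrow> map (ground_trm \<eta>) b = g"
    and "\<And>\<theta>. map (ground_trm \<theta>) a = f \<Longrightarrow> map (ground_trm \<theta>) b = g \<Longrightarrow>
      ok \<and> (\<forall>x \<in> args_vars a \<union> args_vars b. \<theta> x = \<eta> x)"
proof -
  obtain \<beta>1 ok1 where 1: "foldl mstep (Map.empty, True) (zip a f) = (\<beta>1, ok1)" by fastforce
  note m1 = match_props[OF 1 len(1)]
  note m2 = match_props[OF assms(1)[unfolded 1] len(2)]
  have dom: "\<exists>v. \<beta> x = Some v \<and> \<eta> x = v" if "x \<in> args_vars a \<union> args_vars b" for x
    using that m1(2) m2(1,2) \<eta> by fast
  have e1: "map (ground_trm (the \<circ> \<beta>1)) a = map (ground_trm \<eta>) a"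
    using m1(2) m2(1) \<eta> by (intro map_ground_cong) fastforce
  have e2: "map (ground_trm (the \<circ> \<beta>)) b = map (ground_trm \<eta>) b"
    using dom by (intro map_ground_cong) fastforce
  have ok: "ok \<longleftrightarrow> map (ground_trm \<eta>) a = f \<and> map (ground_trm \<eta>) b = g"
    using m1(3) m2(3) e1 e2 by simp
  then show "ok \<Longrightarrow> map (ground_trm \<eta>) a = f" "ok \<Longrightarrow> map (ground_trm \<eta>) b = g" by auto
  fix \<theta> assume t: "map (ground_trm \<theta>) a = f" "map (ground_trm \<theta>) b = g"
  have "\<forall>x v. \<beta> x = Some v \<longrightarrow> \<theta> x = v"
    by (rule m2(4)[OF t(2) m1(4)[OF t(1)]]) simp
  then have ag: "\<forall>x \<in> args_vars a \<union> args_vars b. \<theta> x = \<eta> x" using dom by blast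
  then have "map (ground_trm \<eta>) a = f" "map (ground_trm \<eta>) b = g"
    using t map_ground_cong[of a \<theta> \<eta>] map_ground_cong[of b \<theta> \<eta>] by auto
  then show "ok \<and> (\<forall>x \<in> args_vars a \<union> args_vars b. \<theta> x = \<eta> x)" using ok ag by blast
qed

section \<open>Processing a pair of facts\<close>

text \<open>A stamp larger than all stored ones invalidates all bindings at once.\<close>

definition stamps :: "st \<Rightarrow> bool" where
  "stamps s \<longleftrightarrow> (\<forall>x. marr s aENVS x \<le> mreg s rSt)"

definition pair_code :: ram where
  "pair_code =
     asg rSt (Plus (Reg rSt) (Num 1)) ;; asg rOk (Num 1) ;;
     asg rI (Arr aOWN (Reg rO)) ;; asg rG (Reg rF) ;; match_code ;;
     asg rI (Arr aOTH (Reg rO)) ;; asg rG (Arr aQN (Reg rD)) ;; match_code ;;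
     cond (Reg rOk) (asg rH (Arr aOHD (Reg rO)) ;; inst_code ;; insert_code) Skip"

text \<open>\<open>L\<close> is the least fixpoint together with the empty list, which stands for a missing body atom, and
  \<open>J\<close> contains the classes of the IDB predicates.  \<open>Occ\<close> lists each rule twice, with its body atoms in either order.\<close>

locale worklist =
  fixes Occ :: "occ list" and L :: "nat list set" and m :: nat and J :: "nat set"
  assumes closed: "(a, b, h) \<in> set Occ \<Longrightarrow> map (ground_trm \<theta>) a \<in> L \<Longrightarrow> map (ground_trm \<theta>) b \<in> L \<Longrightarrow>
      map (ground_trm \<theta>) h \<in> L"
    and nil: "[] \<in> L" and finL: "finite L"
    and len: "(a, b, h) \<in> set Occ \<Longrightarrow> length a \<le> m \<and> length b \<le> m \<and> length h \<le> m"
    and lenL: "f \<in> L \<Longrightarrow> length f \<le> m"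
    and wf: "(a, b, h) \<in> set Occ \<Longrightarrow> f \<in> L \<Longrightarrow> fcls f = pcls a \<Longrightarrow> length f = length a"
    and cls: "(a, b, h) \<in> set Occ \<Longrightarrow> fcls (map (ground_trm \<theta>) a) = pcls a"
    and swap: "(a, b, h) \<in> set Occ \<Longrightarrow> (b, a, h) \<in> set Occ"
    and range: "(a, b, h) \<in> set Occ \<Longrightarrow> args_vars h \<subseteq> args_vars a \<union> args_vars b"
begin

abbreviation (input) Wp :: "var set" where
  "Wp \<equiv> {rSt, rOk, rI, rG, rH, rNd, rNn, rX, rQc}"
abbreviation (input) Rp :: "arr set" where
  "Rp \<equiv> {aENV, aENVS, aTR, aKEY, aTL, aCLS, aKNOWN, aQN, aQNX, aQL}"

text \<open>What the nested loops hand on: the queue is extended at its end only and stays sound,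
  and links between old cells are untouched. The relation composes along successive rounds.\<close>

definition pair_post :: "st \<Rightarrow> nat list list \<Rightarrow> st \<Rightarrow> nat list list \<Rightarrow> bool" where
  "pair_post s Q s' Q' \<longleftrightarrow> finv s' Q' \<and> stamps s' \<and> ext s s' \<and> (\<exists>qs. Q' = Q @ qs) \<and> set Q' \<subseteq> L \<and>
     (\<forall>x\<le>length Q. marr s' aQNX x = marr s aQNX x)"

lemma wp_pair:
  assumes st: "static s Occ J" and Q: "finv s Q" "stamps s" "set Q \<subseteq> L"
    and j: "mreg s rO = Suc j" "j < length Occ" "Occ ! j = (a, b, h)"
    and f: "npath s (mreg s rF) f" "f \<in> L" "length f = length a" "isnode s (mreg s rF)"
    and d: "mreg s rD = Suc d" "d < length Q" "length (Q ! d) = length b"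
  shows "wp pair_code (\<lambda>n s'. n \<le> 30 * m + 30 \<and> same Wp Rp s s' \<and>
    (\<exists>Q'. pair_post s Q s' Q' \<and>
      (\<forall>\<theta>. map (ground_trm \<theta>) a = f \<longrightarrow> map (ground_trm \<theta>) b = Q ! d \<longrightarrow> map (ground_trm \<theta>) h \<in> set Q'))) s"
proof -
  note D = finvD[OF Q(1)]
  have o: "(a, b, h) \<in> set Occ" using j by (metis nth_mem)
  have rep: "occ_repr s (Suc j) (a, b, h)" using st j by (auto simp: static_def)
  define k where "k = Suc (mreg s rSt)"
  define s1 where "s1 = s\<lparr>mreg := (mreg s)(rSt := k, rOk := Suc 0, rI := marr s aOWN (Suc j), rG := mreg s rF)\<rparr>"
  have sm1: "same {rSt, rOk, rI, rG} {} s s1" by (simp add: s1_def same_def)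
  have env1: "envof s1 = Map.empty"
  proof
    fix x
    have "marr s aENVS x \<le> mreg s rSt" using Q(2) by (simp add: stamps_def)
    then show "envof s1 x = None" by (simp add: envof_def s1_def k_def)
  qed
  have w1: "wp match_code (\<lambda>n s'. n \<le> 8 * length a + 1 \<and> same {rI, rG, rOk} {aENV, aENVS} s1 s' \<and>
    (\<forall>x. marr s' aENVS x = marr s1 aENVS x \<or> marr s' aENVS x = mreg s1 rSt) \<and>
    (envof s', mreg s' rOk \<noteq> 0) = foldl mstep (envof s1, mreg s1 rOk \<noteq> 0) (zip a f)) s1"
    by (rule wp_match) (use rep f in \<open>auto simp: s1_def occ_repr_def\<close>)
  obtain n1 s2 where n1: "runs match_code s1 n1 s2" "n1 \<le> 8 * length a + 1"
    and sm2: "same {rI, rG, rOk} {aENV, aENVS} s1 s2"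
    and st2: "\<forall>x. marr s2 aENVS x = marr s1 aENVS x \<or> marr s2 aENVS x = mreg s1 rSt"
    and e2: "(envof s2, mreg s2 rOk \<noteq> 0) = foldl mstep (envof s1, mreg s1 rOk \<noteq> 0) (zip a f)"
    using w1 unfolding wp_def by blast
  define s3 where "s3 = s2\<lparr>mreg := (mreg s2)(rI := marr s aOTH (Suc j), rG := marr s aQN (Suc d))\<rparr>"
  have sm3: "same {rI, rG} {} s2 s3" by (simp add: s3_def same_def)
  have sm13: "same {rI, rG, rOk} {aENV, aENVS} s1 s3"
    by (rule same_trans[OF sm2 same_mono[OF sm3]]) auto
  have sm03: "same {rSt, rOk, rI, rG} {aENV, aENVS} s s3"
    by (rule same_trans[OF same_mono[OF sm1] same_mono[OF sm13]]) auto
  have a3: "marr s3 aTAG = marr s aTAG" "marr s3 aVAL = marr s aVAL" "marr s3 aKEY = marr s aKEY" "marr s3 aTL = marr s aTL"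
    using sm03 by (auto simp: same_def)
  have w2: "wp match_code (\<lambda>n s'. n \<le> 8 * length b + 1 \<and> same {rI, rG, rOk} {aENV, aENVS} s3 s' \<and>
    (\<forall>x. marr s' aENVS x = marr s3 aENVS x \<or> marr s' aENVS x = mreg s3 rSt) \<and>
    (envof s', mreg s' rOk \<noteq> 0) = foldl mstep (envof s3, mreg s3 rOk \<noteq> 0) (zip b (Q ! d))) s3"
    by (rule wp_match) (unfold a3, use rep d D(5)[OF d(2)] in \<open>auto simp: s3_def occ_repr_def\<close>)
  obtain n2 s4 where n2: "runs match_code s3 n2 s4" "n2 \<le> 8 * length b + 1"
    and sm4: "same {rI, rG, rOk} {aENV, aENVS} s3 s4"
    and st4: "\<forall>x. marr s4 aENVS x = marr s3 aENVS x \<or> marr s4 aENVS x = mreg s3 rSt"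
    and e4: "(envof s4, mreg s4 rOk \<noteq> 0) = foldl mstep (envof s3, mreg s3 rOk \<noteq> 0) (zip b (Q ! d))"
    using w2 unfolding wp_def by blast
  have sm04: "same {rSt, rOk, rI, rG} {aENV, aENVS} s s4"
    by (rule same_trans[OF sm03 same_mono[OF sm4]]) auto
  have St: "mreg s1 rSt = k" "mreg s3 rSt = k" "mreg s4 rSt = k"
    using sm13 sm4 by (auto simp: same_def s1_def)
  have stamp4: "stamps s4"
    unfolding stamps_def
  proof
    fix x
    have "marr s1 aENVS x \<le> k" using Q(2) by (auto simp: stamps_def s1_def k_def le_SucI)
    moreover have "marr s3 aENVS x = marr s2 aENVS x" by (simp add: s3_def)
    ultimately show "marr s4 aENVS x \<le> mreg s4 rSt" using st2 st4 St by (metis order_refl)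
  qed
  have e23: "envof s3 = envof s2" "mreg s3 rOk = mreg s2 rOk" by (simp_all add: s3_def envof_def cong: if_cong)
  have fold4: "foldl mstep (foldl mstep (Map.empty, True) (zip a f)) (zip b (Q ! d)) = (envof s4, mreg s4 rOk \<noteq> 0)"
  proof -
    have "foldl mstep (Map.empty, True) (zip a f) = (envof s3, mreg s3 rOk \<noteq> 0)"
      using e2 env1 e23 by (simp add: s1_def)
    then show ?thesis using e4 by simp
  qed
  \<comment> \<open>The memory array itself, leftovers of older matches included; the binding part
    is what the stamps certify.\<close>
  define \<eta> where "\<eta> = marr s4 aENV"
  have \<eta>: "\<forall>x v. envof s4 x = Some v \<longrightarrow> \<eta> x = v" by (auto simp: envof_def \<eta>_def split: if_splits)
  note m2 = match_two[OF fold4 f(3) d(3) \<eta>]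
  \<comment> \<open>Range restriction: head variables occur in the bodies, where every matching
    valuation agrees with \<open>\<eta>\<close>.\<close>
  have head: "mreg s4 rOk \<noteq> 0 \<and> map (ground_trm \<theta>) h = map (ground_trm \<eta>) h"
    if "map (ground_trm \<theta>) a = f" "map (ground_trm \<theta>) b = Q ! d" for \<theta>
    using m2(3)[OF that] map_ground_cong[of h \<theta> \<eta>] range[OF o] by blast
  have Qd: "Q ! d \<in> L" using d Q(3) by auto
  have tr4: "trie s4" "ext s s4" "finv s4 Q" "static s4 Occ J"
    using same_trie[OF sm04] D(1) same_ext[OF sm04] finv_same[OF Q(1) sm04] static_same[OF sm04] st by simp_all
  have reg4: "mreg s4 rO = Suc j" "marr s4 aOHD = marr s aOHD" "marr s4 aTAG = marr s aTAG" "marr s4 aVAL = marr s aVAL" "mreg s4 rBd = mreg s rBd"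
    "marr s4 aQNX = marr s aQNX"
    using sm04 j by (auto simp: same_def)
  have last: "wp (cond (Reg rOk) (asg rH (Arr aOHD (Reg rO)) ;; inst_code ;; insert_code) Skip)
     (\<lambda>n s'. n \<le> 11 * m + 15 \<and> same Wp Rp s s' \<and>
    (\<exists>Q'. pair_post s Q s' Q' \<and> (mreg s4 rOk \<noteq> 0 \<longrightarrow> map (ground_trm \<eta>) h \<in> set Q'))) s4"
    (is "wp _ ?last _")
  proof (rule wp_cond)
    show "ecost (Reg rOk) \<le> 100" by simp
    assume "aval (Reg rOk) s4 = 0"
    then show "wp Skip (\<lambda>n. ?last (Suc n)) s4"
      using same_mono[OF sm04, of Wp Rp] tr4 stamp4 Q reg4
      by (intro wp_skip) (auto simp: pair_post_def)
  next
    assume "aval (Reg rOk) s4 \<noteq> 0"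
    then have ok: "mreg s4 rOk \<noteq> 0" by simp
    have g: "map (ground_trm \<eta>) a = f" "map (ground_trm \<eta>) b = Q ! d" using m2(1,2) ok by auto
    have hL: "map (ground_trm \<eta>) h \<in> L" using closed[OF o, of \<eta>] g f(2) Qd by simp
    define s5 where "s5 = s4\<lparr>mreg := (mreg s4)(rH := marr s aOHD (Suc j))\<rparr>"
    have sm5: "same {rH} {} s4 s5" by (simp add: s5_def same_def)
    have tr5: "trie s5" using same_trie[OF sm5] tr4 by simp
    have fi5: "finv s5 Q" using finv_same[OF tr4(3) sm5] by simp
    have n5: "npath s5 (mreg s rF) f" "npath s5 (marr s aQN (Suc d)) (Q ! d)"
      using f(1) D(5)[OF d(2)] same_ar[OF sm04, of aKEY] same_ar[OF sm04, of aTL] by (simp_all add: s5_def)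
    \<comment> \<open>Head constants were bounded when the rule was stored; the values of head
      variables are entries of two stored facts and thus keys below \<open>B\<close>.\<close>
    have small: "\<forall>t\<in>set h. ground_trm (marr s5 aENV) t < mreg s5 rBd"
    proof
      fix t assume t: "t \<in> set h"
      show "ground_trm (marr s5 aENV) t < mreg s5 rBd"
      proof (cases t)
        case (Cst c)
        then show ?thesis using rep t reg4 by (force simp: occ_repr_def s5_def)
      next
        case (Var x)
        then have "x \<in> args_vars h" using t by (force simp: args_vars_def)
        then have "x \<in> args_vars a \<union> args_vars b" using range[OF o] by blast
        then obtain u where "u \<in> set a \<union> set b" "x \<in> trm_vars u" by (auto simp: args_vars_def)
        then have "Var x \<in> set a \<union> set b" by (cases u) auto
        then have "\<eta> x \<in> set f \<union> set (Q ! d)" using g[symmetric] by force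
        moreover have "\<forall>y\<in>set (Q ! d). y < mreg s rBd" by (rule npath_less[OF D(1) D(4)[OF d(2)] D(5)[OF d(2)]])
        moreover have "\<forall>y\<in>set f. y < mreg s rBd" by (rule npath_less[OF D(1) f(4,1)])
        ultimately show ?thesis using Var reg4 by (auto simp: s5_def \<eta>_def)
      qed
    qed
    have pb: "patb (marr s5 aTAG) (marr s5 aVAL) (mreg s5 rH) (rev h)"
      using rep reg4 by (simp add: s5_def occ_repr_def)
    have \<eta>5: "marr s5 aENV = \<eta>" by (simp add: s5_def \<eta>_def)
    have lenh: "length h \<le> m" using len[OF o] by simp
    have w5: "wp inst_code (\<lambda>n s'. wp insert_code (\<lambda>n'. ?last (Suc (1 + (n + n')))) s') s5"
    proof (rule wp_conseq[OF wp_inst[OF pb tr5 small]], elim conjE, unfold \<eta>5)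
      fix n :: nat and s6
      assume n: "n \<le> 11 * length h + 2" and 6: "trie s6" "ext s5 s6" "isnode s6 (mreg s6 rNd)"
        "npath s6 (mreg s6 rNd) (map (ground_trm \<eta>) h)"
        and sm6: "same {rNd, rNn, rX, rH} {aTR, aKEY, aTL, aCLS} s5 s6"
      have fi6: "finv s6 Q" using finv_ext[OF fi5 6(2,1) sm6] by simp
      show "wp insert_code (\<lambda>n'. ?last (Suc (1 + (n + n')))) s6"
      proof (rule wp_conseq[OF wp_insert[OF fi6 6(3,4)]], elim conjE)
        fix n' :: nat and s7
        define Q' where "Q' = (if map (ground_trm \<eta>) h \<in> set Q then Q else Q @ [map (ground_trm \<eta>) h])"
        assume n': "n' \<le> 7" and 7: "finv s7 (if map (ground_trm \<eta>) h \<in> set Q then Q else Q @ [map (ground_trm \<eta>) h])"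
          "ext s6 s7" "\<forall>x\<le>length Q. marr s7 aQNX x = marr s6 aQNX x" and sm7: "same {rQc} {aKNOWN, aQN, aQNX, aQL} s6 s7"
        have sm47: "same Wp Rp s4 s7"
          by (rule same_trans[OF same_mono[OF sm5] same_trans[OF same_mono[OF sm6] same_mono[OF sm7]]]) auto
        have sm07: "same Wp Rp s s7"
          by (rule same_trans[OF same_mono[OF sm04] sm47]) auto
        have x7: "ext s s7"
          using ext_trans[OF tr4(2) ext_trans[OF same_ext[OF sm5] ext_trans[OF 6(2) 7(2)]]] by simp
        have q7: "marr s6 aQNX = marr s aQNX"
          using same_ar[OF sm6, of aQNX] same_ar[OF sm5, of aQNX] reg4 by simp
        have "marr s7 aENVS = marr s4 aENVS" "mreg s7 rSt = mreg s4 rSt"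
          using same_ar[OF sm7, of aENVS] same_ar[OF sm6, of aENVS] same_rg[OF sm7, of rSt] same_rg[OF sm6, of rSt]
          by (simp_all add: s5_def)
        then have "stamps s7" using stamp4 by (simp add: stamps_def)
        then have "pair_post s Q s7 Q'"
          using 7(1,3) x7 q7 Q(3) hL by (simp add: pair_post_def Q'_def)
        moreover have "map (ground_trm \<eta>) h \<in> set Q'" by (simp add: Q'_def)
        ultimately show "?last (Suc (1 + (n + n'))) s7"
          using sm07 n n' lenh by auto
      qed
    qed
    show "wp (asg rH (Arr aOHD (Reg rO)) ;; inst_code ;; insert_code) (\<lambda>n. ?last (Suc n)) s4"
      using w5 reg4 by (intro wp_seq wp_asg) (simp_all add: s5_def)
  qed
  obtain n3 s7 where n3: "runs (cond (Reg rOk) (asg rH (Arr aOHD (Reg rO)) ;; inst_code ;; insert_code) Skip) s4 n3 s7"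
    "n3 \<le> 11 * m + 15 \<and> same Wp Rp s s7 \<and>
    (\<exists>Q'. pair_post s Q s7 Q' \<and> (mreg s4 rOk \<noteq> 0 \<longrightarrow> map (ground_trm \<eta>) h \<in> set Q'))"
    using last unfolding wp_def by blast
  \<comment> \<open>Eight ticks for each cell of the two body patterns and eleven for each head cell
    make 27 times \<open>m\<close>, up to an additive constant.\<close>
  have fin: "6 + n1 + n2 + n3 \<le> 30 * m + 30 \<and> same Wp Rp s s7 \<and>
    (\<exists>Q'. pair_post s Q s7 Q' \<and>
      (\<forall>\<theta>. map (ground_trm \<theta>) a = f \<longrightarrow> map (ground_trm \<theta>) b = Q ! d \<longrightarrow> map (ground_trm \<theta>) h \<in> set Q'))"
  proof (intro conjI)
    show "6 + n1 + n2 + n3 \<le> 30 * m + 30" using n1(2) n2(2) n3(2) len[OF o] by linarith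
    show "same Wp Rp s s7" using n3(2) by blast
    obtain Q' where "pair_post s Q s7 Q'" "mreg s4 rOk \<noteq> 0 \<longrightarrow> map (ground_trm \<eta>) h \<in> set Q'" using n3(2) by blast
    then show "\<exists>Q'. pair_post s Q s7 Q' \<and>
      (\<forall>\<theta>. map (ground_trm \<theta>) a = f \<longrightarrow> map (ground_trm \<theta>) b = Q ! d \<longrightarrow> map (ground_trm \<theta>) h \<in> set Q')"
      using head by (intro exI[of _ Q']) metis
  qed
  \<comment> \<open>With all intermediate states named, each piece becomes an exact statement and
    the command sequence can be replayed.\<close>
  have r1: "wp match_code (\<lambda>n t. n = n1 \<and> t = s2) s1" using n1 unfolding wp_def by blast
  have r2: "wp match_code (\<lambda>n t. n = n2 \<and> t = s4) s3" using n2 unfolding wp_def by blast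
  have r3: "wp (cond (Reg rOk) (asg rH (Arr aOHD (Reg rO)) ;; inst_code ;; insert_code) Skip) (\<lambda>n t. n = n3 \<and> t = s7) s4"
    using n3 unfolding wp_def by blast
  have o2: "mreg s2 rO = Suc j" "mreg s2 rD = Suc d" "marr s2 aOTH = marr s aOTH" "marr s2 aQN = marr s aQN"
    using sm2 sm1 j d by (auto simp: same_def)
  have "wp pair_code (\<lambda>n t. n = 6 + n1 + n2 + n3 \<and> t = s7) s"
    unfolding pair_code_def
    apply (intro wp_seq wp_asg)
           apply simp_all
    using j apply (simp add: s1_def[symmetric] k_def[symmetric])
    apply (rule wp_conseq[OF r1])
    apply (intro wp_seq wp_asg)
      apply simp_all
    using o2 apply (simp add: s3_def[symmetric])
    apply (rule wp_conseq[OF r2])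
    apply (elim conjE, hypsubst)
    apply (rule wp_conseq[OF r3])
    apply simp
    done
  then show ?thesis by (rule wp_conseq) (use fin in blast)
qed

end

section \<open>The main loop\<close>

definition dloop_code :: ram where
  "dloop_code = loop (Reg rD) (pair_code ;; asg rD (Arr aQNX (Reg rD)))"

definition oloop_code :: ram where
  "oloop_code = loop (Reg rO)
     (asg rD (Arr aQL (Arr aOCO (Reg rO))) ;; dloop_code ;; asg rO (Arr aONX (Reg rO)))"

definition out_code :: ram where
  "out_code = loop (Reg rG) (wr (Arr aKEY (Reg rG)) ;; asg rG (Arr aTL (Reg rG)))"

definition main_code :: ram where
  "main_code = loop (Minus (Reg rQc) (Reg rQp))
     (asg rQp (Plus (Reg rQp) (Num 1)) ;; asg rF (Arr aQN (Reg rQp)) ;;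
      cond (Arr aIDB (Arr aCLS (Reg rF))) (asg rG (Reg rF) ;; out_code) Skip ;;
      asg rO (Arr aOL (Arr aCLS (Reg rF))) ;; oloop_code)"

lemma wp_out:
  assumes "npath s (mreg s rG) f"
  shows "wp out_code (\<lambda>n s'. n \<le> 3 * length f + 1 \<and> same {rG} {} s (s'\<lparr>mout := mout s\<rparr>) \<and> mout s' = mout s @ f) s"
  using assms
proof (induction f arbitrary: s)
  case Nil
  then show ?case unfolding out_code_def by (intro wp_loop_0) (auto simp: same_def)
next
  case (Cons x f)
  define t where "t = s\<lparr>mout := mout s @ [x], mreg := (mreg s)(rG := marr s aTL (mreg s rG))\<rparr>"
  have "npath t (mreg t rG) f" using Cons.prems by (simp add: t_def)
  note IH = Cons.IH[OF this]
  show ?case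
    apply (subst out_code_def)
    apply (rule wp_loop_step)
      apply simp
    subgoal using Cons.prems by simp
    unfolding out_code_def[symmetric]
    apply (intro wp_seq wp_wr wp_asg)
      apply simp_all
    apply (rule wp_conseq[where c=out_code and s=t, THEN back_subst[where P="wp out_code _"]])
      apply (rule IH)
     apply (auto simp: t_def same_def)[1]
    using Cons.prems by (simp add: t_def)
qed

lemma pair_same_static:
  assumes "same ({rSt, rOk, rI, rG, rH, rNd, rNn, rX, rQc, rD, rO, rF, rQp}) {aENV, aENVS, aTR, aKEY, aTL, aCLS, aKNOWN, aQN, aQNX, aQL} s s'"
    "static s Occ J"
  shows "static s' Occ J"
  using static_same[OF assms(1)] assms(2) by simp

context worklist
begin

lemma pair_post_trans:
  "pair_post s Q s1 Q1 \<Longrightarrow> pair_post s1 Q1 s2 Q2 \<Longrightarrow> pair_post s Q s2 Q2"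
  using ext_trans unfolding pair_post_def by fastforce

lemma pair_post_same:
  assumes "pair_post s Q s' Q'" "same W {} s' s''" "W \<subseteq> {rD, rO, rF, rQp}"
  shows "pair_post s Q s'' Q'"
proof -
  have n: "rNn \<notin> W" "rBd \<notin> W" "rQc \<notin> W" "rSt \<notin> W" using assms(3) by auto
  have "stamps s'' = stamps s'" using assms(2) n unfolding stamps_def same_def by simp
  moreover have "marr s'' = marr s'" using assms(2) by (auto simp: same_def)
  ultimately show ?thesis
    using assms(1) finv_same[OF _ assms(2) n(3) n(1,2)] ext_trans[OF _ same_ext[OF assms(2) n(1,2)]]
    unfolding pair_post_def by auto
qed

text \<open>The traversed indices \<open>ds\<close> are fixed in advance while the queue grows. They
  keep their meaning because the queue is only extended at its end.\<close>

lemma wp_dloop: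
  assumes st: "static s Occ J" and Q: "finv s Q" "stamps s" "set Q \<subseteq> L"
    and j: "mreg s rO = Suc j" "j < length Occ" "Occ ! j = (a, b, h)"
    and f: "npath s (mreg s rF) f" "f \<in> L" "length f = length a" "isnode s (mreg s rF)"
    and ds: "chain (marr s aQNX) (mreg s rD) (map Suc ds)" "\<forall>d\<in>set ds. d < length Q \<and> length (Q ! d) = length b"
  shows "wp dloop_code (\<lambda>n s'. n \<le> (30 * m + 33) * length ds + 1 \<and> same (insert rD Wp) Rp s s' \<and>
    (\<exists>Q'. pair_post s Q s' Q' \<and>
      (\<forall>d\<in>set ds. \<forall>\<theta>. map (ground_trm \<theta>) a = f \<longrightarrow> map (ground_trm \<theta>) b = Q ! d \<longrightarrow> map (ground_trm \<theta>) h \<in> set Q'))) s"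
    (is "wp _ (?P s Q ds) _")
  using st Q j(1) f(1,4) ds
proof (induction ds arbitrary: s Q)
  case Nil
  then have "pair_post s Q s Q" by (simp add: pair_post_def)
  then show ?case using Nil unfolding dloop_code_def by (intro wp_loop_0) auto
next
  case (Cons d ds)
  have d: "mreg s rD = Suc d" "d < length Q" "length (Q ! d) = length b"
    "chain (marr s aQNX) (marr s aQNX (Suc d)) (map Suc ds)" using Cons.prems by auto
  note P = wp_pair[OF Cons.prems(1-5) j(2,3) Cons.prems(6) f(2,3) Cons.prems(7) d(1-3)]
  show ?case
    apply (subst dloop_code_def)
    apply (rule wp_loop_step)
      apply simp
    subgoal using d by simp
    unfolding dloop_code_def[symmetric]
    apply (rule wp_seq)
  proof (rule wp_conseq[OF P], intro wp_asg, goal_cases)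
    case (2 n s1)
    define s2 where "s2 = s1\<lparr>mreg := (mreg s1)(rD := aval (Arr aQNX (Reg rD)) s1)\<rparr>"
    have sm2: "same {rD} {} s1 s2" by (simp add: s2_def same_def)
    have n: "n \<le> 30 * m + 30" and sm1: "same Wp Rp s s1" using 2 by blast+
    obtain Q1 where Q1: "pair_post s Q s1 Q1"
      "\<forall>\<theta>. map (ground_trm \<theta>) a = f \<longrightarrow> map (ground_trm \<theta>) b = Q ! d \<longrightarrow> map (ground_trm \<theta>) h \<in> set Q1"
      using 2 by blast
    have Q2: "pair_post s Q s2 Q1" using pair_post_same[OF Q1(1) sm2] by simp
    have sm: "same (insert rD Wp) Rp s s2"
      by (rule same_trans[OF same_mono[OF sm1] same_mono[OF sm2]]) auto
    obtain qs where qs: "Q1 = Q @ qs" using Q1(1) by (auto simp: pair_post_def)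
    have x: "\<forall>x\<le>length Q. marr s2 aQNX x = marr s aQNX x" using Q2 by (simp add: pair_post_def)
    have st2: "static s2 Occ J"
      using pair_same_static[OF same_mono[OF sm] Cons.prems(1)] by simp
    have ex: "ext s s2" using Q2 by (simp add: pair_post_def)
    have rF: "mreg s2 rF = mreg s rF" using sm by (simp add: same_def)
    have "wp dloop_code (?P s2 Q1 ds) s2"
    proof (rule Cons.IH[OF st2])
      show "finv s2 Q1" "stamps s2" "set Q1 \<subseteq> L" using Q2 by (auto simp: pair_post_def)
      show "mreg s2 rO = Suc j" using sm Cons.prems(5) by (simp add: same_def)
      show "npath s2 (mreg s2 rF) f" unfolding rF
        by (rule ext_npath[OF ex finvD(1)[OF Cons.prems(2)] Cons.prems(7,6)])
      show "isnode s2 (mreg s2 rF)" unfolding rF by (rule ext_isnode[OF ex Cons.prems(7)])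
      have "mreg s1 rD = Suc d" using d(1) sm1 by (simp add: same_def)
      then have "mreg s2 rD = marr s aQNX (Suc d)" using x d(2) by (simp add: s2_def)
      moreover have "chain (marr s2 aQNX) (marr s aQNX (Suc d)) (map Suc ds)"
        by (rule chain_cong[OF d(4)]) (use x Cons.prems(9) in \<open>auto simp: Suc_le_eq\<close>)
      ultimately show "chain (marr s2 aQNX) (mreg s2 rD) (map Suc ds)" by simp
      show "\<forall>d\<in>set ds. d < length Q1 \<and> length (Q1 ! d) = length b"
        using Cons.prems(9) by (auto simp: qs nth_append)
    qed
    then show ?case
      unfolding s2_def[symmetric]
    proof (rule wp_conseq, elim conjE exE, intro conjI)
      fix k :: nat and s3 Q3
      assume k: "k \<le> (30 * m + 33) * length ds + 1"
        and sm3: "same (insert rD Wp) Rp s2 s3"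
        and Q3: "pair_post s2 Q1 s3 Q3"
          "\<forall>d\<in>set ds. \<forall>\<theta>. map (ground_trm \<theta>) a = f \<longrightarrow> map (ground_trm \<theta>) b = Q1 ! d \<longrightarrow> map (ground_trm \<theta>) h \<in> set Q3"
      show "Suc (n + 1 + k) \<le> (30 * m + 33) * length (d # ds) + 1" using n k by simp
      show "same (insert rD Wp) Rp s s3" by (rule same_trans[OF sm sm3])
      have "set Q1 \<subseteq> set Q3" using Q3(1) by (auto simp: pair_post_def)
      then have "\<forall>d'\<in>set (d # ds). \<forall>\<theta>. map (ground_trm \<theta>) a = f \<longrightarrow> map (ground_trm \<theta>) b = Q ! d' \<longrightarrow> map (ground_trm \<theta>) h \<in> set Q3"
        using Q1(2) Q3(2) Cons.prems(9) by (auto simp: qs nth_append)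
      then show "\<exists>Q'. pair_post s Q s3 Q' \<and> (\<forall>d'\<in>set (d # ds). \<forall>\<theta>. map (ground_trm \<theta>) a = f \<longrightarrow> map (ground_trm \<theta>) b = Q ! d' \<longrightarrow> map (ground_trm \<theta>) h \<in> set Q')"
        using pair_post_trans[OF Q2 Q3(1)] by blast
    qed
  qed simp
qed

definition rel :: "nat \<Rightarrow> nat" where
  "rel c = card {g \<in> L. fcls g = c}"

text \<open>Ticks for one fact at one occurrence: a pair for each fact in the class of the other
  body pattern. The final relation sizes are used, as they bound the queue at all times.\<close>

definition ocost :: "nat \<Rightarrow> nat" where
  "ocost j = (30 * m + 33) * rel (pcls (fst (snd (Occ ! j)))) + 5"

text \<open>The queue has no duplicates and stays within \<open>L\<close>, so the list of a class
  never outgrows the final relation.\<close>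

lemma length_cells_le:
  assumes "distinct Q" "set Q \<subseteq> L"
  shows "length (filter (\<lambda>j. fcls (Q ! j) = c) [0..<length Q]) \<le> rel c"
proof -
  let ?js = "filter (\<lambda>j. fcls (Q ! j) = c) [0..<length Q]"
  have "length ?js = card (set (map ((!) Q) ?js))"
    using assms(1) by (subst distinct_card) (auto simp: distinct_map inj_on_def nth_eq_iff_index_eq)
  also have "\<dots> \<le> rel c"
    unfolding rel_def using assms(2) finL by (intro card_mono) auto
  finally show ?thesis .
qed

lemma wp_oloop:
  assumes st: "static s Occ J" and Q: "finv s Q" "stamps s" "set Q \<subseteq> L"
    and f: "npath s (mreg s rF) f" "f \<in> L" "isnode s (mreg s rF)"
    and os: "chain (marr s aONX) (mreg s rO) (map Suc os)" "\<forall>j\<in>set os. j < length Occ \<and> pcls (fst (Occ ! j)) = fcls f"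
  shows "wp oloop_code (\<lambda>n s'. n \<le> sum_list (map ocost os) + 1 \<and> same (insert rO (insert rD Wp)) Rp s s' \<and>
    (\<exists>Q'. pair_post s Q s' Q' \<and>
      (\<forall>j\<in>set os. \<forall>a b h \<theta>. Occ ! j = (a, b, h) \<longrightarrow> map (ground_trm \<theta>) a = f \<longrightarrow> map (ground_trm \<theta>) b \<in> set Q \<longrightarrow> map (ground_trm \<theta>) h \<in> set Q'))) s"
    (is "wp _ (?P s Q os) _")
  using st Q f(1,3) os
proof (induction os arbitrary: s Q)
  case Nil
  then have "pair_post s Q s Q" by (simp add: pair_post_def)
  then show ?case using Nil unfolding oloop_code_def by (intro wp_loop_0) auto
next
  case (Cons j os)
  obtain a b h where abh: "Occ ! j = (a, b, h)" by (cases "Occ ! j")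
  have j: "mreg s rO = Suc j" "j < length Occ" "pcls a = fcls f"
    "chain (marr s aONX) (marr s aONX (Suc j)) (map Suc os)" using Cons.prems abh by auto
  have o: "(a, b, h) \<in> set Occ" using j(2) abh by (metis nth_mem)
  have la: "length f = length a" using wf[OF o f(2)] j by simp
  define ds where "ds = rev (filter (\<lambda>i. fcls (Q ! i) = pcls b) [0..<length Q])"
  define s1 where "s1 = s\<lparr>mreg := (mreg s)(rD := marr s aQL (pcls b))\<rparr>"
  have sm1: "same {rD} {} s s1" by (simp add: s1_def same_def)
  have oco: "marr s aOCO (Suc j) = pcls b" using Cons.prems(1) j(2) abh by (force simp: static_def occ_repr_def)
  have pp0: "pair_post s Q s Q" using Cons.prems by (simp add: pair_post_def)
  have pp1: "pair_post s Q s1 Q" using pair_post_same[OF pp0 sm1] by simp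
  have "wp dloop_code (\<lambda>n s'. n \<le> (30 * m + 33) * length ds + 1 \<and> same (insert rD Wp) Rp s1 s' \<and>
    (\<exists>Q'. pair_post s1 Q s' Q' \<and>
      (\<forall>d\<in>set ds. \<forall>\<theta>. map (ground_trm \<theta>) a = f \<longrightarrow> map (ground_trm \<theta>) b = Q ! d \<longrightarrow> map (ground_trm \<theta>) h \<in> set Q'))) s1"
  proof (rule wp_dloop[OF _ _ _ Cons.prems(4) _ j(2) abh _ f(2) la])
    show "static s1 Occ J" using pair_same_static[OF same_mono[OF sm1] Cons.prems(1)] by simp
    show "finv s1 Q" "stamps s1" using pp1 by (auto simp: pair_post_def)
    show "mreg s1 rO = Suc j" "npath s1 (mreg s1 rF) f" "isnode s1 (mreg s1 rF)"
      using j Cons.prems by (simp_all add: s1_def isnode_def)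
    show "chain (marr s1 aQNX) (mreg s1 rD) (map Suc ds)"
      using finvD(7)[OF Cons.prems(2), of "pcls b"] by (simp add: s1_def cells_def ds_def rev_map)
    show "\<forall>d\<in>set ds. d < length Q \<and> length (Q ! d) = length b"
      using wf[OF swap[OF o]] Cons.prems(4) nth_mem by (fastforce simp: ds_def)
  qed
  note P = this
  have lds: "length ds \<le> rel (pcls b)"
    using length_cells_le[OF finvD(3)[OF Cons.prems(2)] Cons.prems(4)] by (simp add: ds_def)
  have oc: "ocost j = (30 * m + 33) * rel (pcls b) + 5" by (simp add: ocost_def abh)
  have lc: "(30 * m + 33) * length ds + 5 \<le> ocost j" unfolding oc using mult_le_mono2[OF lds, of "30 * m + 33"] by linarith
  show ?case
    apply (subst oloop_code_def)
    apply (rule wp_loop_step)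
      apply simp
    subgoal using j by simp
    unfolding oloop_code_def[symmetric]
    apply (rule wp_seq)
    apply (rule wp_asg)
     apply simp
    apply (simp only: aval.simps j(1) oco s1_def[symmetric])
    apply (rule wp_seq)
  proof (rule wp_conseq[OF P], intro wp_asg, goal_cases)
    case (2 n s2)
    define s3 where "s3 = s2\<lparr>mreg := (mreg s2)(rO := aval (Arr aONX (Reg rO)) s2)\<rparr>"
    have sm3: "same {rO} {} s2 s3" by (simp add: s3_def same_def)
    have n: "n \<le> (30 * m + 33) * length ds + 1" and sm2: "same (insert rD Wp) Rp s1 s2" using 2 by blast+
    obtain Q1 where Q1: "pair_post s1 Q s2 Q1"
      "\<forall>d\<in>set ds. \<forall>\<theta>. map (ground_trm \<theta>) a = f \<longrightarrow> map (ground_trm \<theta>) b = Q ! d \<longrightarrow> map (ground_trm \<theta>) h \<in> set Q1"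
      using 2 by blast
    have Q3: "pair_post s Q s3 Q1" using pair_post_same[OF pair_post_trans[OF pp1 Q1(1)] sm3] by simp
    have sm02: "same (insert rO (insert rD Wp)) Rp s s2"
      by (rule same_trans[OF same_mono[OF sm1] same_mono[OF sm2]]) auto
    have sm: "same (insert rO (insert rD Wp)) Rp s s3"
      by (rule same_trans[OF sm02 same_mono[OF sm3]]) auto
    obtain qs where qs: "Q1 = Q @ qs" using Q1(1) by (auto simp: pair_post_def)
    have st3: "static s3 Occ J"
      using pair_same_static[OF same_mono[OF sm] Cons.prems(1)] by simp
    have ex: "ext s s3" using Q3 by (simp add: pair_post_def)
    have rF: "mreg s3 rF = mreg s rF" using sm by (simp add: same_def)
    have onx: "marr s3 aONX = marr s aONX" "marr s2 aONX = marr s aONX" using sm sm02 by (simp_all add: same_def)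
    have "wp oloop_code (?P s3 Q1 os) s3"
    proof (rule Cons.IH[OF st3])
      show "finv s3 Q1" "stamps s3" "set Q1 \<subseteq> L" using Q3 by (auto simp: pair_post_def)
      show "npath s3 (mreg s3 rF) f" unfolding rF
        by (rule ext_npath[OF ex finvD(1)[OF Cons.prems(2)] Cons.prems(6,5)])
      show "isnode s3 (mreg s3 rF)" unfolding rF by (rule ext_isnode[OF ex Cons.prems(6)])
      have "mreg s2 rO = Suc j" using j(1) sm1 sm2 by (simp add: same_def)
      then show "chain (marr s3 aONX) (mreg s3 rO) (map Suc os)" using j(4) by (simp add: s3_def onx)
      show "\<forall>j\<in>set os. j < length Occ \<and> pcls (fst (Occ ! j)) = fcls f" using Cons.prems(8) by simp
    qed
    then show ?case
      unfolding s3_def[symmetric]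
    proof (rule wp_conseq, elim conjE exE, intro conjI)
      fix k :: nat and s4 Q4
      assume k: "k \<le> sum_list (map ocost os) + 1"
        and sm4: "same (insert rO (insert rD Wp)) Rp s3 s4"
        and Q4: "pair_post s3 Q1 s4 Q4"
          "\<forall>j\<in>set os. \<forall>a b h \<theta>. Occ ! j = (a, b, h) \<longrightarrow> map (ground_trm \<theta>) a = f \<longrightarrow> map (ground_trm \<theta>) b \<in> set Q1 \<longrightarrow> map (ground_trm \<theta>) h \<in> set Q4"
      show "Suc (1 + (n + 1) + k) \<le> sum_list (map ocost (j # os)) + 1" using n k lc by simp
      show "same (insert rO (insert rD Wp)) Rp s s4" by (rule same_trans[OF sm sm4])
      have sub: "set Q1 \<subseteq> set Q4" using Q4(1) by (auto simp: pair_post_def)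
      \<comment> \<open>A queued instance of \<open>b\<close> has the class of \<open>b\<close> and
        is therefore among the traversed cells.\<close>
      have new: "map (ground_trm \<theta>) h \<in> set Q1" if t: "map (ground_trm \<theta>) a = f" "map (ground_trm \<theta>) b \<in> set Q" for \<theta>
      proof -
        obtain d where d: "d < length Q" "Q ! d = map (ground_trm \<theta>) b" using t(2) by (metis in_set_conv_nth)
        then have "d \<in> set ds" using cls[OF swap[OF o]] by (auto simp: ds_def)
        then show ?thesis using Q1(2) t d by auto
      qed
      have "\<forall>j\<in>set (j # os). \<forall>a b h \<theta>. Occ ! j = (a, b, h) \<longrightarrow> map (ground_trm \<theta>) a = f \<longrightarrow> map (ground_trm \<theta>) b \<in> set Q \<longrightarrow> map (ground_trm \<theta>) h \<in> set Q4"
      proof (intro ballI allI impI)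
        fix j' a' b' h' \<theta>
        assume h: "j' \<in> set (j # os)" "Occ ! j' = (a', b', h')" "map (ground_trm \<theta>) a' = f" "map (ground_trm \<theta>) b' \<in> set Q"
        show "map (ground_trm \<theta>) h' \<in> set Q4"
        proof (cases "j' = j")
          case True
          then show ?thesis using new h sub abh by (metis fst_conv snd_conv subsetD)
        next
          case False
          moreover have "map (ground_trm \<theta>) b' \<in> set Q1" using h(4) by (simp add: qs)
          ultimately show ?thesis using Q4(2) h by (metis set_ConsD)
        qed
      qed
      then show "\<exists>Q'. pair_post s Q s4 Q' \<and> (\<forall>j\<in>set (j # os). \<forall>a b h \<theta>. Occ ! j = (a, b, h) \<longrightarrow> map (ground_trm \<theta>) a = f \<longrightarrow> map (ground_trm \<theta>) b \<in> set Q \<longrightarrow> map (ground_trm \<theta>) h \<in> set Q')"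
        using pair_post_trans[OF Q3 Q4(1)] by blast
    qed
  qed simp
qed

definition fcost :: "nat list \<Rightarrow> nat" where
  "fcost f = sum_list (map ocost (filter (\<lambda>j. pcls (fst (Occ ! j)) = fcls f) [0..<length Occ])) + 3 * m + 10"

text \<open>Closure is claimed for pairs of processed facts; once all facts are processed it becomes
  closure of the whole queue. The empty list is a member throughout because it plays the part of a
  missing body atom.\<close>

definition minv :: "st \<Rightarrow> nat list list \<Rightarrow> nat \<Rightarrow> bool" where
  "minv s Q p \<longleftrightarrow> static s Occ J \<and> finv s Q \<and> stamps s \<and> set Q \<subseteq> L \<and> [] \<in> set Q \<and> mreg s rQp = p \<and> p \<le> length Q \<and>
     mout s = concat (filter (\<lambda>f. fcls f \<in> J) (take p Q)) \<and>
     (\<forall>a b h \<theta>. (a, b, h) \<in> set Occ \<longrightarrow> map (ground_trm \<theta>) a \<in> set (take p Q) \<longrightarrow>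
        map (ground_trm \<theta>) b \<in> set (take p Q) \<longrightarrow> map (ground_trm \<theta>) h \<in> set Q)"

text \<open>Each pair of facts is combined at the latest when its second member is dequeued. The
  dequeued fact is matched only with the first pattern of an occurrence: pairs that have it in
  second place are covered by the swapped occurrence, and its pair with itself because it is already
  queued.\<close>

lemma wp_main_step:
  assumes I: "minv s Q p" and p: "p < length Q"
  shows "wp (asg rQp (Plus (Reg rQp) (Num 1)) ;; asg rF (Arr aQN (Reg rQp)) ;;
      cond (Arr aIDB (Arr aCLS (Reg rF))) (asg rG (Reg rF) ;; out_code) Skip ;;
      asg rO (Arr aOL (Arr aCLS (Reg rF))) ;; oloop_code)
    (\<lambda>n s'. Suc n \<le> fcost (Q ! p) \<and> (\<exists>qs. minv s' (Q @ qs) (Suc p))) s"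
proof -
  have I': "static s Occ J" "finv s Q" "stamps s" "set Q \<subseteq> L" "[] \<in> set Q" "mreg s rQp = p"
    "mout s = concat (filter (\<lambda>f. fcls f \<in> J) (take p Q))"
    "\<And>a b h \<theta>. (a, b, h) \<in> set Occ \<Longrightarrow> map (ground_trm \<theta>) a \<in> set (take p Q) \<Longrightarrow>
        map (ground_trm \<theta>) b \<in> set (take p Q) \<Longrightarrow> map (ground_trm \<theta>) h \<in> set Q"
    using I unfolding minv_def by blast+
  note D = finvD[OF I'(2)]
  define f where "f = Q ! p"
  have fL: "f \<in> L" using I'(4) p by (auto simp: f_def)
  define F where "F = marr s aQN (Suc p)"
  have F: "isnode s F" "npath s F f" using D(4,5)[OF p] by (auto simp: F_def f_def)
  have cF: "marr s aCLS F = fcls f" by (rule npath_cls[OF D(1) F])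
  define s1 where "s1 = s\<lparr>mreg := (mreg s)(rQp := Suc p, rF := F)\<rparr>"
  define os where "os = rev (filter (\<lambda>j. pcls (fst (Occ ! j)) = fcls f) [0..<length Occ])"
  define P where "P = (\<lambda>n s'. n \<le> sum_list (map ocost os) + 2 \<and> (\<exists>qs. minv s' (Q @ qs) (Suc p)))"
  have ol: "wp (asg rO (Arr aOL (Arr aCLS (Reg rF))) ;; oloop_code) P s2"
    if sm2: "same {rQp, rF, rG} {} s (s2\<lparr>mout := mout s\<rparr>)" "mreg s2 rQp = Suc p" "mreg s2 rF = F"
      "mout s2 = mout s @ (if fcls f \<in> J then f else [])" for s2
  proof -
    define s3 where "s3 = s2\<lparr>mreg := (mreg s2)(rO := marr s aOL (fcls f))\<rparr>"
    have ar2: "marr s2 = marr s" using sm2(1) by (auto simp: same_def)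
    have sm3: "same {rQp, rF, rG, rO} {} s (s3\<lparr>mout := mout s\<rparr>)" using sm2(1) by (auto simp: same_def s3_def)
    \<comment> \<open>The invariants do not mention the output, so the frame condition can be
      applied to the state with the old output restored.\<close>
    have op_irr: "static (s3\<lparr>mout := mout s\<rparr>) Occ J = static s3 Occ J" "finv (s3\<lparr>mout := mout s\<rparr>) Q = finv s3 Q"
      "stamps (s3\<lparr>mout := mout s\<rparr>) = stamps s3"
      by (simp_all add: static_def occ_repr_def finv_def trie_def isnode_def stamps_def)
    have s3: "static s3 Occ J" "finv s3 Q"
      using static_same[OF sm3, of Occ J] finv_same[OF I'(2) sm3] I'(1) unfolding op_irr by simp_all
    have st3: "stamps s3" using I'(3) sm2(1) ar2 unfolding stamps_def s3_def same_def by simp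
    have r3: "mreg s3 rF = F" "mreg s3 rQp = Suc p" "mout s3 = mout s2" using sm2 by (simp_all add: s3_def)
    have nB: "isnode s3 F" "npath s3 F f"
      using F sm2(1) ar2 by (simp_all add: s3_def isnode_def same_def)
    have w: "wp oloop_code (\<lambda>n s'. n \<le> sum_list (map ocost os) + 1 \<and> same (insert rO (insert rD Wp)) Rp s3 s' \<and>
    (\<exists>Q'. pair_post s3 Q s' Q' \<and>
      (\<forall>j\<in>set os. \<forall>a b h \<theta>. Occ ! j = (a, b, h) \<longrightarrow> map (ground_trm \<theta>) a = f \<longrightarrow> map (ground_trm \<theta>) b \<in> set Q \<longrightarrow> map (ground_trm \<theta>) h \<in> set Q'))) s3"
    proof (rule wp_oloop[OF s3 st3 I'(4)])
      show "npath s3 (mreg s3 rF) f" "f \<in> L" "isnode s3 (mreg s3 rF)" unfolding r3 using nB fL by auto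
      have "chain (marr s aONX) (marr s aOL (fcls f)) (cells (\<lambda>j. pcls (fst (Occ ! j))) (length Occ) (fcls f))"
        using I'(1) by (simp add: static_def)
      then show "chain (marr s3 aONX) (mreg s3 rO) (map Suc os)"
        by (simp add: s3_def ar2 os_def cells_def rev_map)
      show "\<forall>j\<in>set os. j < length Occ \<and> pcls (fst (Occ ! j)) = fcls f" by (auto simp: os_def)
    qed
    have "wp oloop_code (\<lambda>n. P (1 + n)) s3"
    proof (rule wp_conseq[OF w], elim conjE exE)
      fix n :: nat and s4 Q'
      assume n: "n \<le> sum_list (map ocost os) + 1" and sm4: "same (insert rO (insert rD Wp)) Rp s3 s4"
        and Q': "pair_post s3 Q s4 Q'"
          "\<forall>j\<in>set os. \<forall>a b h \<theta>. Occ ! j = (a, b, h) \<longrightarrow> map (ground_trm \<theta>) a = f \<longrightarrow> map (ground_trm \<theta>) b \<in> set Q \<longrightarrow> map (ground_trm \<theta>) h \<in> set Q'"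
      obtain qs where qs: "Q' = Q @ qs" using Q'(1) by (auto simp: pair_post_def)
      have tk: "take (Suc p) Q' = take p Q @ [f]" using p by (simp add: qs f_def take_Suc_conv_app_nth)
      have sub: "set (take p Q) \<union> {f} \<subseteq> set Q" using p by (auto simp: f_def dest: in_set_takeD)
      have A: "map (ground_trm \<theta>) h \<in> set Q'"
        if o: "(a, b, h) \<in> set Occ" and af: "map (ground_trm \<theta>) a = f" and bf: "map (ground_trm \<theta>) b \<in> set Q" for a b h \<theta>
      proof -
        obtain j where j: "j < length Occ" "Occ ! j = (a, b, h)" using o by (metis in_set_conv_nth)
        have "pcls a = fcls f" using cls[OF o, of \<theta>] af by simp
        then have "j \<in> set os" using j by (simp add: os_def)
        then show ?thesis using Q'(2) j af bf by blast
      qed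
      have "minv s4 Q' (Suc p)"
        unfolding minv_def tk
      proof (intro conjI allI impI)
        show "static s4 Occ J" using pair_same_static[OF same_mono[OF sm4] s3(1)] by simp
        show "finv s4 Q'" "stamps s4" "set Q' \<subseteq> L" using Q'(1) by (auto simp: pair_post_def)
        show "[] \<in> set Q'" using I'(5) by (simp add: qs)
        show "mreg s4 rQp = Suc p" using sm4 r3 by (simp add: same_def)
        show "Suc p \<le> length Q'" using p by (simp add: qs)
        have "mout s4 = mout s3" using sm4 by (simp add: same_def)
        then show "mout s4 = concat (filter (\<lambda>f. fcls f \<in> J) (take p Q @ [f]))"
          using sm2(4) I'(7) r3 by simp
      next
        fix a b h \<theta>
        assume o: "(a, b, h) \<in> set Occ" and ab: "map (ground_trm \<theta>) a \<in> set (take p Q @ [f])"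
          "map (ground_trm \<theta>) b \<in> set (take p Q @ [f])"
        consider "map (ground_trm \<theta>) a = f" | "map (ground_trm \<theta>) b = f"
          | "map (ground_trm \<theta>) a \<in> set (take p Q)" "map (ground_trm \<theta>) b \<in> set (take p Q)"
          using ab by auto
        then show "map (ground_trm \<theta>) h \<in> set Q'"
        proof cases
          case 1
          then show ?thesis using A[OF o] ab(2) sub by auto
        next
          case 2
          then show ?thesis using A[OF swap[OF o]] ab(1) sub by auto
        next
          case 3
          then show ?thesis using I'(8)[OF o] by (simp add: qs)
        qed
      qed
      then show "P (1 + n) s4" using n qs unfolding P_def by auto
    qed
    moreover have "aval (Arr aOL (Arr aCLS (Reg rF))) s2 = marr s aOL (fcls f)" using sm2(3) ar2 cF by simp
    ultimately show ?thesis
      by (intro wp_seq wp_asg) (simp_all add: s3_def)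
  qed
  let ?post = "\<lambda>n s'. n \<le> fcost f \<and> (\<exists>qs. minv s' (Q @ qs) (Suc p))"
  let ?rest = "asg rO (Arr aOL (Arr aCLS (Reg rF))) ;; oloop_code"
  have c1: "wp (cond (Arr aIDB (Arr aCLS (Reg rF))) (asg rG (Reg rF) ;; out_code) Skip)
    (\<lambda>n. wp ?rest
      (\<lambda>k. ?post (3 + n + k))) s1"
  proof (rule wp_cond)
    show "ecost (Arr aIDB (Arr aCLS (Reg rF))) \<le> 100" by simp
    have idb: "aval (Arr aIDB (Arr aCLS (Reg rF))) s1 \<noteq> 0 \<longleftrightarrow> fcls f \<in> J"
      using I'(1) cF by (simp add: static_def s1_def)
    have so: "sum_list (map ocost os) + 3 * m + 10 = fcost f"
      by (simp add: fcost_def os_def rev_map[symmetric] sum_list_rev)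
    {
      assume "aval (Arr aIDB (Arr aCLS (Reg rF))) s1 = 0"
      then have "fcls f \<notin> J" using idb by simp
      then have "wp ?rest P s1"
        by (intro ol) (simp_all add: s1_def same_def)
      then show "wp Skip (\<lambda>n. wp ?rest
      (\<lambda>k. ?post (3 + Suc n + k))) s1"
        by (intro wp_skip) (erule wp_conseq, use so in \<open>auto simp: P_def\<close>)
    next
      assume "aval (Arr aIDB (Arr aCLS (Reg rF))) s1 \<noteq> 0"
      then have fJ: "fcls f \<in> J" using idb by simp
      define s2 where "s2 = s1\<lparr>mreg := (mreg s1)(rG := F)\<rparr>"
      have "npath s2 (mreg s2 rG) f" using F by (simp add: s2_def s1_def)
      note w = wp_out[OF this]
      have "wp out_code (\<lambda>n. wp ?rest
      (\<lambda>k. ?post (3 + Suc (1 + n) + k))) s2"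
      proof (rule wp_conseq[OF w], elim conjE)
        fix n s3 assume h: "n \<le> 3 * length f + 1" "same {rG} {} s2 (s3\<lparr>mout := mout s2\<rparr>)" "mout s3 = mout s2 @ f"
        have "wp ?rest P s3"
          by (rule ol) (use h fJ in \<open>auto simp: s2_def s1_def same_def\<close>)
        then show "wp ?rest
          (\<lambda>k. ?post (3 + Suc (1 + n) + k)) s3"
          by (rule wp_conseq) (use so h(1) lenL[OF fL] in \<open>auto simp: P_def\<close>)
      qed
      then show "wp (asg rG (Reg rF) ;; out_code) (\<lambda>n. wp ?rest
      (\<lambda>k. ?post (3 + Suc n + k))) s1"
        by (intro wp_seq wp_asg) (simp_all add: s2_def s1_def)
    }
  qed
  show ?thesis
    apply (rule wp_seq)
    apply (rule wp_asg)
     apply simp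
    apply (rule wp_seq)
    apply (rule wp_asg)
     apply simp
    apply (rule wp_seq)
    using c1 I'(6) by (simp add: s1_def F_def f_def numeral_3_eq_3)
qed

text \<open>Processed facts are distinct members of the finite set \<open>L\<close>, so
  \<open>card L - p\<close> decreases. Each fact is charged once, which gives a sum over
  \<open>L\<close> independent of the order of the queue.\<close>

lemma wp_main:
  assumes "minv s Q p"
  shows "wp main_code (\<lambda>n s'. n \<le> (\<Sum>f\<in>L - set (take p Q). fcost f) + 1 \<and> (\<exists>Q'. minv s' Q' (length Q'))) s"
  using assms
proof (induction "card L - p" arbitrary: s Q p rule: less_induct)
  case less
  note I = less.prems
  have Q: "finv s Q" "set Q \<subseteq> L" "mreg s rQp = p" "p \<le> length Q" using I unfolding minv_def by blast+
  note D = finvD[OF Q(1)]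
  show ?case
  proof (cases "p < length Q")
    case False
    then have "wp main_code (\<lambda>n s'. n = 1 \<and> s' = s) s"
      unfolding main_code_def using D(2) Q by (intro wp_loop_0) simp_all
    moreover have "p = length Q" using False Q(4) by simp
    ultimately show ?thesis using I by (elim wp_conseq) auto
  next
    case True
    have "length Q = card (set Q)" using D(3) by (simp add: distinct_card)
    also have "\<dots> \<le> card L" using Q(2) finL by (rule card_mono[rotated])
    finally have pL: "p < card L" using True by simp
    have fn: "Q ! p \<in> L" "Q ! p \<notin> set (take p Q)"
      subgoal using nth_mem[OF True] Q(2) by blast
      subgoal using True D(3) by (auto simp: in_set_conv_nth nth_eq_iff_index_eq)
      done
    show ?thesis
      apply (subst main_code_def)
      apply (rule wp_loop_step)
        apply simp
      subgoal using True D(2) Q(3) by simp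
      unfolding main_code_def[symmetric]
    proof (rule wp_conseq[OF wp_main_step[OF I True]], elim conjE exE)
      fix n s1 qs
      assume n: "Suc n \<le> fcost (Q ! p)" and I1: "minv s1 (Q @ qs) (Suc p)"
      have tk: "take (Suc p) (Q @ qs) = take p Q @ [Q ! p]" using True by (simp add: take_Suc_conv_app_nth)
      have s: "L - set (take p Q) = insert (Q ! p) (L - set (take (Suc p) (Q @ qs)))" "Q ! p \<notin> L - set (take (Suc p) (Q @ qs))"
        unfolding tk using fn by auto
      have sm: "(\<Sum>f\<in>L - set (take p Q). fcost f) = fcost (Q ! p) + (\<Sum>f\<in>L - set (take (Suc p) (Q @ qs)). fcost f)"
        unfolding s(1) by (rule sum.insert) (use finL s(2) in auto)
      have "card L - Suc p < card L - p" using pL by simp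
      from less.hyps[OF this I1] show "wp main_code (\<lambda>k s'. Suc (n + k) \<le> (\<Sum>f\<in>L - set (take p Q). fcost f) + 1 \<and> (\<exists>Q'. minv s' Q' (length Q'))) s1"
        by (rule wp_conseq) (use n sm in auto)
    qed
  qed
qed

end

section \<open>Reading the input\<close>

text \<open>\<open>rBd\<close> is started at 1 and adds up all stored values. It thereby exceeds
  each of them without any comparison.\<close>

definition push_code :: ram where
  "push_code = asg rCnt (Plus (Reg rCnt) (Num 1)) ;; sto aTAG (Reg rCnt) (Reg rTg) ;;
     sto aVAL (Reg rCnt) (Reg rX) ;; asg rBd (Plus (Reg rBd) (Reg rX))"

definition args_code :: ram where
  "args_code = loop (Reg rL)
     (asg rL (Minus (Reg rL) (Num 1)) ;; cond (Reg rFlag) (rd rTg) (asg rTg (Num 1)) ;;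
      asg rTg (Plus (Reg rTg) (Num 1)) ;; rd rX ;; push_code)"

text \<open>The cell skipped at the beginning is never written; its tag 0 separates the pattern from
  the preceding one.\<close>

definition atom_code :: ram where
  "atom_code = asg rCnt (Plus (Reg rCnt) (Num 1)) ;; asg rTg (Num 2) ;;
     rd rX ;; asg rCl (Plus (Reg rX) (Num 1)) ;; push_code ;;
     rd rX ;; asg rL (Reg rX) ;; push_code ;; args_code"

text \<open>A fact is stored as its encoding, so predicate and arity are the first two constants of a pattern.\<close>

definition pat :: "atom \<Rightarrow> trm list" where
  "pat a = Cst (fst a) # Cst (length (snd a)) # snd a"

text \<open>The flag is unset while the database is read: the atoms are then ground and carry no tags.\<close>

definition enc_args :: "bool \<Rightarrow> trm list \<Rightarrow> nat list" where
  "enc_args fl ts = (if fl then concat (map encode_trm ts) else map tval ts)"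

definition enc_atom :: "bool \<Rightarrow> atom \<Rightarrow> nat list" where
  "enc_atom fl a = fst a # length (snd a) # enc_args fl (snd a)"

definition readable :: "bool \<Rightarrow> trm list \<Rightarrow> bool" where
  "readable fl ts \<longleftrightarrow> fl \<or> (\<forall>t\<in>set ts. \<exists>c. t = Cst c)"

definition wrote :: "st \<Rightarrow> st \<Rightarrow> nat \<Rightarrow> trm list \<Rightarrow> bool" where
  "wrote s s' c ts \<longleftrightarrow>
     (\<forall>i<length ts. marr s' aTAG (c + 1 + i) = tag (ts ! i) \<and> marr s' aVAL (c + 1 + i) = tval (ts ! i)) \<and>
     (\<forall>x. x \<le> c \<or> c + length ts < x \<longrightarrow> marr s' aTAG x = marr s aTAG x \<and> marr s' aVAL x = marr s aVAL x)"

lemma wrote_Nil [simp]: "wrote s s c []"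
  by (simp add: wrote_def)

lemma wrote_Cons:
  assumes "wrote s s' c [t]" "wrote s' s'' (Suc c) ts"
  shows "wrote s s'' c (t # ts)"
  unfolding wrote_def
proof (intro conjI allI impI)
  fix i assume i: "i < length (t # ts)"
  have "marr s'' aTAG (c + 1 + i) = tag ((t # ts) ! i) \<and> marr s'' aVAL (c + 1 + i) = tval ((t # ts) ! i)"
    using assms i by (cases i) (auto simp: wrote_def)
  then show "marr s'' aTAG (c + 1 + i) = tag ((t # ts) ! i)" "marr s'' aVAL (c + 1 + i) = tval ((t # ts) ! i)" by auto
qed (use assms in \<open>auto simp: wrote_def\<close>)

lemma wrote_patf: "wrote s s' c ts \<Longrightarrow> marr s aTAG (c + 1 + length ts) = 0 \<Longrightarrow> patf (marr s' aTAG) (marr s' aVAL) (c + 1) ts"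
proof -
  assume w: "wrote s s' c ts" "marr s aTAG (c + 1 + length ts) = 0"
  have "patf T V p ts" if "\<forall>i<length ts. T (p + i) = tag (ts ! i) \<and> V (p + i) = tval (ts ! i)" "T (p + length ts) = 0"
    for T V p and ts :: "trm list"
    using that
  proof (induction ts arbitrary: p)
    case (Cons t ts)
    have "T (Suc p + i) = tag (ts ! i) \<and> V (Suc p + i) = tval (ts ! i)" if "i < length ts" for i
      using Cons.prems(1)[rule_format, of "Suc i"] that by simp
    then have "patf T V (Suc p) ts" using Cons.prems by (intro Cons.IH) auto
    then show ?case using Cons.prems by (auto dest: spec[of _ 0])
  qed auto
  then show ?thesis using w by (auto simp: wrote_def)
qed

lemma wrote_patb: "wrote s s' c ts \<Longrightarrow> marr s aTAG c = 0 \<Longrightarrow> patb (marr s' aTAG) (marr s' aVAL) (c + length ts) (rev ts)"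
proof -
  assume w: "wrote s s' c ts" "marr s aTAG c = 0"
  have "patb T V (c + length ts) (rev ts)" if "\<forall>i<length ts. T (c + 1 + i) = tag (ts ! i) \<and> V (c + 1 + i) = tval (ts ! i)" "T c = 0"
    for T V c and ts :: "trm list"
    using that
  proof (induction ts rule: rev_induct)
    case (snoc t ts)
    then have "patb T V (c + length ts) (rev ts)" by (auto simp: nth_append)
    then show ?case using snoc.prems(1)[rule_format, of "length ts"] by simp
  qed auto
  then show ?thesis using w by (auto simp: wrote_def)
qed

lemma wp_push:
  assumes "mreg s rTg = tag t" "mreg s rX = tval t"
  shows "wp push_code (\<lambda>n s'. n \<le> 4 \<and> wrote s s' (mreg s rCnt) [t] \<and> mreg s' rCnt = Suc (mreg s rCnt) \<and>
    mreg s' rBd = mreg s rBd + tval t \<and> minp s' = minp s \<and> same {rCnt, rBd} {aTAG, aVAL} s s') s"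
  unfolding push_code_def
  apply (intro wp_seq wp_asg wp_sto)
  using assms by (simp_all add: wrote_def same_def)

lemma wp_args:
  assumes "minp s = enc_args (mreg s rFlag \<noteq> 0) ts @ rest" "readable (mreg s rFlag \<noteq> 0) ts" "mreg s rL = length ts"
  shows "wp args_code (\<lambda>n s'. n \<le> 11 * length ts + 1 \<and> wrote s s' (mreg s rCnt) ts \<and>
    mreg s' rCnt = mreg s rCnt + length ts \<and> mreg s' rBd = mreg s rBd + sum_list (map tval ts) \<and> minp s' = rest \<and>
    same {rL, rTg, rX, rCnt, rBd} {aTAG, aVAL} s (s'\<lparr>minp := minp s\<rparr>)) s"
    (is "wp _ (?Q s ts) _")
  using assms
proof (induction ts arbitrary: s)
  case Nil
  then show ?case unfolding args_code_def by (intro wp_loop_0) (auto simp: enc_args_def same_def)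
next
  case (Cons t ts)
  define fl where "fl = (mreg s rFlag \<noteq> 0)"
  define s1 where "s1 = s\<lparr>mreg := (mreg s)(rL := length ts, rTg := tag t, rX := tval t), minp := enc_args fl ts @ rest\<rparr>"
  have sm1: "same {rL, rTg, rX} {} s (s1\<lparr>minp := minp s\<rparr>)" by (simp add: s1_def same_def)
  have P: "wp push_code (\<lambda>n s'. n \<le> 4 \<and> wrote s1 s' (mreg s1 rCnt) [t] \<and> mreg s' rCnt = Suc (mreg s1 rCnt) \<and>
    mreg s' rBd = mreg s1 rBd + tval t \<and> minp s' = minp s1 \<and> same {rCnt, rBd} {aTAG, aVAL} s1 s') s1"
    by (rule wp_push) (simp_all add: s1_def)
  have W: "wp push_code (\<lambda>n. wp args_code (\<lambda>k. ?Q s (t # ts) (6 + n + k))) s1"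
  proof (rule wp_conseq[OF P], elim conjE)
    fix n :: nat and s2
    assume n: "n \<le> 4" and w2: "wrote s1 s2 (mreg s1 rCnt) [t]" "mreg s2 rCnt = Suc (mreg s1 rCnt)"
      "mreg s2 rBd = mreg s1 rBd + tval t" "minp s2 = minp s1" and sm2: "same {rCnt, rBd} {aTAG, aVAL} s1 s2"
    have f: "mreg s2 rFlag = mreg s rFlag" "mreg s2 rL = length ts" using sm2 by (auto simp: same_def s1_def)
    have "wp args_code (?Q s2 ts) s2"
      by (rule Cons.IH) (use f w2 Cons.prems(2) in \<open>auto simp: s1_def fl_def readable_def\<close>)
    then show "wp args_code (\<lambda>k. ?Q s (t # ts) (6 + n + k)) s2"
    proof (rule wp_conseq, elim conjE, intro conjI)
      fix k :: nat and s3
      assume h: "k \<le> 11 * length ts + 1" "wrote s2 s3 (mreg s2 rCnt) ts"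
        "mreg s3 rCnt = mreg s2 rCnt + length ts" "mreg s3 rBd = mreg s2 rBd + sum_list (map tval ts)" "minp s3 = rest"
        "same {rL, rTg, rX, rCnt, rBd} {aTAG, aVAL} s2 (s3\<lparr>minp := minp s2\<rparr>)"
      show "6 + n + k \<le> 11 * length (t # ts) + 1" using n h(1) by simp
      have "wrote s s2 (mreg s rCnt) [t]" using w2(1) by (simp add: wrote_def s1_def)
      then show "wrote s s3 (mreg s rCnt) (t # ts)"
        by (rule wrote_Cons) (use h(2) w2(2) in \<open>simp add: s1_def\<close>)
      show "mreg s3 rCnt = mreg s rCnt + length (t # ts)" "mreg s3 rBd = mreg s rBd + sum_list (map tval (t # ts))" "minp s3 = rest"
        using h w2 by (simp_all add: s1_def)
      show "same {rL, rTg, rX, rCnt, rBd} {aTAG, aVAL} s (s3\<lparr>minp := minp s\<rparr>)"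
        using sm1 sm2 h(6) by (auto simp: same_def)
    qed
  qed
  have L: "mreg s rL = Suc (length ts)" using Cons.prems by simp
  show ?case
  proof (cases fl)
    case True
    obtain x where ipx: "minp s = x # tval t # enc_args fl ts @ rest" "Suc x = tag t"
      using Cons.prems(1) True by (cases t) (auto simp: enc_args_def fl_def)
    show ?thesis
      apply (subst args_code_def)
      apply (rule wp_loop_step)
        apply simp
      subgoal using L by simp
      unfolding args_code_def[symmetric]
      apply (intro wp_seq wp_asg wp_cond)
          apply simp
         apply simp
      subgoal
        apply (rule wp_rd)
        using ipx(1) apply simp
        apply (intro wp_seq wp_asg)
         apply simp
        apply (rule wp_rd)
         apply simp
        using W L ipx(2) by (simp add: s1_def)
      using True by (simp_all add: fl_def)
  next
    case False
    then have ipx: "minp s = tval t # enc_args fl ts @ rest" "tag t = 2"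
      using Cons.prems(1,2) by (auto simp: enc_args_def fl_def readable_def)
    show ?thesis
      apply (subst args_code_def)
      apply (rule wp_loop_step)
        apply simp
      subgoal using L by simp
      unfolding args_code_def[symmetric]
      apply (intro wp_seq wp_asg wp_cond)
          apply simp
         apply simp
      subgoal using False by (simp add: fl_def)
        apply simp
       apply simp
      apply (rule wp_rd)
       apply (simp add: ipx(1))
      using W L ipx(2) by (simp add: s1_def numeral_2_eq_2)
  qed
qed

definition grow :: "st \<Rightarrow> st \<Rightarrow> bool" where
  "grow s s' \<longleftrightarrow> (\<forall>x \<le> mreg s rCnt + 1. marr s' aTAG x = marr s aTAG x \<and> marr s' aVAL x = marr s aVAL x) \<and>
     mreg s rCnt \<le> mreg s' rCnt \<and> mreg s rBd \<le> mreg s' rBd \<and> (\<forall>x>mreg s' rCnt. marr s' aTAG x = 0)"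

lemma wp_atom:
  assumes minp: "minp s = enc_atom (mreg s rFlag \<noteq> 0) a @ rest" "readable (mreg s rFlag \<noteq> 0) (snd a)"
    and z: "\<forall>x>mreg s rCnt. marr s aTAG x = 0" and Bd: "1 \<le> mreg s rBd"
  shows "wp atom_code (\<lambda>n s'. n \<le> 11 * length (snd a) + 16 \<and> grow s s' \<and> minp s' = rest \<and> mreg s' rCl = pcls (pat a) \<and>
    patf (marr s' aTAG) (marr s' aVAL) (mreg s rCnt + 2) (pat a) \<and> patb (marr s' aTAG) (marr s' aVAL) (mreg s' rCnt) (rev (pat a)) \<and>
    mreg s rCnt + 2 + length (pat a) = mreg s' rCnt + 1 \<and> (\<forall>t\<in>set (pat a). tval t < mreg s' rBd) \<and>
    same {rL, rTg, rX, rCnt, rBd, rCl} {aTAG, aVAL} s (s'\<lparr>minp := minp s\<rparr>)) s"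
    (is "wp _ ?Q _")
proof -
  let ?p = "fst a" and ?l = "length (snd a)"
  define fl where "fl = (mreg s rFlag \<noteq> 0)"
  define s1 where "s1 = s\<lparr>minp := ?l # enc_args fl (snd a) @ rest, mreg := (mreg s)(rCnt := Suc (mreg s rCnt), rTg := 2, rX := ?p, rCl := Suc ?p)\<rparr>"
  have P1: "wp push_code (\<lambda>n s'. n \<le> 4 \<and> wrote s1 s' (mreg s1 rCnt) [Cst ?p] \<and> mreg s' rCnt = Suc (mreg s1 rCnt) \<and>
    mreg s' rBd = mreg s1 rBd + tval (Cst ?p) \<and> minp s' = minp s1 \<and> same {rCnt, rBd} {aTAG, aVAL} s1 s') s1"
    by (rule wp_push) (simp_all add: s1_def)
  have "wp push_code (\<lambda>n. wp (rd rX ;; asg rL (Reg rX) ;; push_code ;; args_code) (\<lambda>k. ?Q (4 + n + k))) s1"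
  proof (rule wp_conseq[OF P1], elim conjE)
    fix n :: nat and s2
    assume n2: "n \<le> 4" and w2: "wrote s1 s2 (mreg s1 rCnt) [Cst ?p]" "mreg s2 rCnt = Suc (mreg s1 rCnt)"
      "mreg s2 rBd = mreg s1 rBd + tval (Cst ?p)" "minp s2 = minp s1" and sm2: "same {rCnt, rBd} {aTAG, aVAL} s1 s2"
    define s3 where "s3 = s2\<lparr>minp := enc_args fl (snd a) @ rest, mreg := (mreg s2)(rX := ?l, rL := ?l)\<rparr>"
    have P3: "wp push_code (\<lambda>n s'. n \<le> 4 \<and> wrote s3 s' (mreg s3 rCnt) [Cst ?l] \<and> mreg s' rCnt = Suc (mreg s3 rCnt) \<and>
      mreg s' rBd = mreg s3 rBd + tval (Cst ?l) \<and> minp s' = minp s3 \<and> same {rCnt, rBd} {aTAG, aVAL} s3 s') s3"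
      by (rule wp_push) (use sm2 in \<open>simp_all add: s3_def same_def s1_def\<close>)
    have "wp push_code (\<lambda>m. wp args_code (\<lambda>k. ?Q (4 + n + (2 + m + k)))) s3"
    proof (rule wp_conseq[OF P3], elim conjE)
      fix m :: nat and s4
      assume n4: "m \<le> 4" and w4: "wrote s3 s4 (mreg s3 rCnt) [Cst ?l]" "mreg s4 rCnt = Suc (mreg s3 rCnt)"
        "mreg s4 rBd = mreg s3 rBd + tval (Cst ?l)" "minp s4 = minp s3" and sm4: "same {rCnt, rBd} {aTAG, aVAL} s3 s4"
      have "mreg s4 rFlag = mreg s rFlag" "mreg s4 rL = ?l" using sm4 sm2 by (auto simp: same_def s3_def s1_def)
      then have "wp args_code (\<lambda>n s'. n \<le> 11 * ?l + 1 \<and> wrote s4 s' (mreg s4 rCnt) (snd a) \<and>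
        mreg s' rCnt = mreg s4 rCnt + ?l \<and> mreg s' rBd = mreg s4 rBd + sum_list (map tval (snd a)) \<and> minp s' = rest \<and>
        same {rL, rTg, rX, rCnt, rBd} {aTAG, aVAL} s4 (s'\<lparr>minp := minp s4\<rparr>)) s4"
        by (intro wp_args) (use w4 minp(2) in \<open>simp_all add: s3_def fl_def\<close>)
      then show "wp args_code (\<lambda>k. ?Q (4 + n + (2 + m + k))) s4"
      proof (rule wp_conseq, elim conjE)
        fix k :: nat and s5
        assume n5: "k \<le> 11 * ?l + 1" and w5: "wrote s4 s5 (mreg s4 rCnt) (snd a)"
          "mreg s5 rCnt = mreg s4 rCnt + ?l" "mreg s5 rBd = mreg s4 rBd + sum_list (map tval (snd a))" "minp s5 = rest"
          and sm5: "same {rL, rTg, rX, rCnt, rBd} {aTAG, aVAL} s4 (s5\<lparr>minp := minp s4\<rparr>)"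
        \<comment> \<open>\<open>c\<close> is the skipped cell: it stops the backward reading, just
          as the untouched cell after the pattern stops the forward reading.\<close>
        define c where "c = Suc (mreg s rCnt)"
        have cnt: "mreg s1 rCnt = c" "mreg s3 rCnt = Suc c" "mreg s4 rCnt = Suc (Suc c)" "mreg s5 rCnt = c + length (pat a)"
          using w2(2) w4(2) w5(2) by (simp_all add: s1_def s3_def c_def pat_def)
        have "wrote s3 s5 (Suc c) (Cst ?l # snd a)"
          by (rule wrote_Cons[of _ s4]) (use w4(1) w5(1) cnt in simp_all)
        then have "wrote s2 s5 (Suc c) (Cst ?l # snd a)" by (simp add: wrote_def s3_def)
        moreover have "wrote s s2 c [Cst ?p]" using w2(1) cnt by (simp add: wrote_def s1_def)
        ultimately have W: "wrote s s5 c (pat a)" unfolding pat_def using wrote_Cons by blast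
        have pf: "patf (marr s5 aTAG) (marr s5 aVAL) (mreg s rCnt + 2) (pat a)"
          using wrote_patf[OF W] z by (simp add: c_def)
        have pb: "patb (marr s5 aTAG) (marr s5 aVAL) (mreg s5 rCnt) (rev (pat a))"
          using wrote_patb[OF W] z cnt by (simp add: c_def)
        have bd: "mreg s5 rBd = mreg s rBd + sum_list (map tval (pat a))"
          using w5(3) w4(3) w2(3) by (simp add: s1_def s3_def pat_def)
        have g: "grow s s5"
          using W cnt bd z by (auto simp: grow_def wrote_def c_def)
        have tv: "\<forall>t\<in>set (pat a). tval t < mreg s5 rBd"
        proof
          fix t assume "t \<in> set (pat a)"
          then have "tval t \<le> sum_list (map tval (pat a))" by (intro member_le_sum_list) auto
          then show "tval t < mreg s5 rBd" using bd Bd by simp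
        qed
        have sm: "same {rL, rTg, rX, rCnt, rBd, rCl} {aTAG, aVAL} s (s5\<lparr>minp := minp s\<rparr>)"
          using sm2 sm4 sm5 by (auto simp: same_def s1_def s3_def)
        have cl: "mreg s5 rCl = pcls (pat a)"
          using sm2 sm4 sm5 by (auto simp: same_def s1_def s3_def pat_def)
        have "4 + n + (2 + m + k) \<le> 11 * length (snd a) + 16" using n2 n4 n5 by simp
        then show "?Q (4 + n + (2 + m + k)) s5"
          using g w5(4) cl pf pb tv sm cnt by (simp add: c_def)
      qed
    qed
    moreover have "minp s2 = ?l # enc_args fl (snd a) @ rest" using w2(4) by (simp add: s1_def)
    ultimately show "wp (rd rX ;; asg rL (Reg rX) ;; push_code ;; args_code) (\<lambda>k. ?Q (4 + n + k)) s2"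
      by (intro wp_seq wp_rd[where xs="enc_args fl (snd a) @ rest" and x="?l"] wp_asg) (simp_all add: s3_def)
  qed
  then show ?thesis
    unfolding atom_code_def
    apply (intro wp_seq wp_asg)
      apply simp
     apply simp
    apply (rule wp_rd)
    using minp(1) apply (simp add: enc_atom_def)
    apply (intro wp_seq wp_asg)
     apply simp
    by (simp add: s1_def fl_def)
qed

lemma patf_cong:
  "patf T V p ps \<Longrightarrow> \<forall>x\<le>p + length ps. T' x = T x \<and> V' x = V x \<Longrightarrow> patf T' V' p ps"
  by (induction ps arbitrary: p) auto

lemma patb_cong: "patb T V p ps \<Longrightarrow> \<forall>x\<le>p. T' x = T x \<and> V' x = V x \<Longrightarrow> patb T' V' p ps"
  by (induction ps arbitrary: p) auto

section \<open>Stored rules and their occurrences\<close>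

definition at_pat :: "st \<Rightarrow> nat \<Rightarrow> trm list \<Rightarrow> bool" where
  "at_pat s p a \<longleftrightarrow> patf (marr s aTAG) (marr s aVAL) p a \<and> p + length a \<le> mreg s rCnt + 1"

definition at_head :: "st \<Rightarrow> nat \<Rightarrow> trm list \<Rightarrow> bool" where
  "at_head s p h \<longleftrightarrow> patb (marr s aTAG) (marr s aVAL) p (rev h) \<and> p \<le> mreg s rCnt \<and> (\<forall>t\<in>set h. tval t < mreg s rBd)"

lemma at_pat_grow: "at_pat s p a \<Longrightarrow> grow s s' \<Longrightarrow> at_pat s' p a"
  unfolding at_pat_def grow_def by (auto intro: patf_cong)

lemma at_head_grow: "at_head s p h \<Longrightarrow> grow s s' \<Longrightarrow> at_head s' p h"
  unfolding at_head_def grow_def by (auto intro!: patb_cong[where p=p and T="marr s aTAG" and V="marr s aVAL"])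

text \<open>Cell 0 keeps tag 0 and serves as the empty pattern of missing body atoms. All pattern
  addresses are bounded in terms of \<open>rCnt\<close>, so later reading cannot overwrite a
  registered rule.\<close>

definition rinv :: "st \<Rightarrow> occ list \<Rightarrow> nat set \<Rightarrow> bool" where
  "rinv s Occ J \<longleftrightarrow> static s Occ J \<and> 1 \<le> mreg s rBd \<and> marr s aTAG 0 = 0 \<and> (\<forall>x>mreg s rCnt. marr s aTAG x = 0) \<and>
     (\<forall>j<length Occ. at_pat s (marr s aOWN (Suc j)) (fst (Occ ! j)) \<and> at_pat s (marr s aOTH (Suc j)) (fst (snd (Occ ! j))) \<and>
        at_head s (marr s aOHD (Suc j)) (snd (snd (Occ ! j))))"

lemma rinv_grow:
  assumes I: "rinv s Occ J" and g: "grow s s'" and sm: "same W R s (s'\<lparr>minp := minp s\<rparr>)"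
    and W: "rOc \<notin> W" "R \<inter> {aOWN, aOTH, aOCO, aOHD, aONX, aOL} = {}"
    and J: "\<forall>c. marr s' aIDB c \<noteq> 0 \<longleftrightarrow> c \<in> J'"
  shows "rinv s' Occ J'"
proof -
  have e: "mreg s' rOc = mreg s rOc" "marr s' aOWN = marr s aOWN" "marr s' aOTH = marr s aOTH" "marr s' aOCO = marr s aOCO"
    "marr s' aOHD = marr s aOHD" "marr s' aONX = marr s aONX" "marr s' aOL = marr s aOL"
    using sm W by (auto simp: same_def)
  have p: "at_pat s' (marr s aOWN (Suc j)) (fst (Occ ! j)) \<and> at_pat s' (marr s aOTH (Suc j)) (fst (snd (Occ ! j))) \<and>
        at_head s' (marr s aOHD (Suc j)) (snd (snd (Occ ! j)))" if "j < length Occ" for j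
    using I that at_pat_grow[OF _ g] at_head_grow[OF _ g] unfolding rinv_def by blast
  have "occ_repr s' (Suc j) (Occ ! j)" if "j < length Occ" for j
    using p[OF that] I that unfolding rinv_def static_def occ_repr_def at_pat_def at_head_def e
    by (cases "Occ ! j") force
  then have "static s' Occ J'" using I J unfolding static_def e rinv_def by blast
  then show ?thesis
    using I g p unfolding rinv_def e grow_def by auto
qed

lemma grow_trans: "grow s s' \<Longrightarrow> grow s' s'' \<Longrightarrow> grow s s''"
  unfolding grow_def by auto

lemma grow_same:
  assumes "same W R s (s'\<lparr>minp := minp s\<rparr>)" "rCnt \<notin> W" "rBd \<notin> W" "aTAG \<notin> R" "aVAL \<notin> R" "\<forall>x>mreg s rCnt. marr s aTAG x = 0"
  shows "grow s s'"
  using assms by (simp add: grow_def same_def)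

text \<open>The occurrence is linked into the list of its own class \<open>c\<close>; the class
  \<open>c'\<close> is stored to find the facts it has to be combined with.\<close>

definition reg_code :: "var \<Rightarrow> var \<Rightarrow> var \<Rightarrow> var \<Rightarrow> ram" where
  "reg_code b c b' c' = asg rOc (Plus (Reg rOc) (Num 1)) ;; sto aOWN (Reg rOc) (Reg b) ;; sto aOTH (Reg rOc) (Reg b') ;;
     sto aOCO (Reg rOc) (Reg c') ;; sto aOHD (Reg rOc) (Reg rHd) ;; sto aONX (Reg rOc) (Arr aOL (Reg c)) ;;
     sto aOL (Reg c) (Reg rOc)"

lemma wp_reg:
  assumes I: "rinv s Occ J" and n: "b \<noteq> rOc" "c \<noteq> rOc" "b' \<noteq> rOc" "c' \<noteq> rOc"
    and a: "at_pat s (mreg s b) a" "mreg s c = pcls a" "at_pat s (mreg s b') a'" "mreg s c' = pcls a'" "at_head s (mreg s rHd) h"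
  shows "wp (reg_code b c b' c') (\<lambda>n s'. n \<le> 7 \<and> rinv s' (Occ @ [(a, a', h)]) J \<and>
    same {rOc} {aOWN, aOTH, aOCO, aOHD, aONX, aOL} s s') s"
proof -
  define k where "k = length Occ"
  have k: "mreg s rOc = k" using I by (simp add: rinv_def static_def k_def)
  define s' where "s' = s\<lparr>mreg := (mreg s)(rOc := Suc k), marr := (marr s)(aOWN := (marr s aOWN)(Suc k := mreg s b),
    aOTH := (marr s aOTH)(Suc k := mreg s b'), aOCO := (marr s aOCO)(Suc k := mreg s c'), aOHD := (marr s aOHD)(Suc k := mreg s rHd),
    aONX := (marr s aONX)(Suc k := marr s aOL (pcls a)), aOL := (marr s aOL)(pcls a := Suc k))\<rparr>"
  have w: "wp (reg_code b c b' c') (\<lambda>n t. n \<le> 7 \<and> t = s') s"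
    unfolding reg_code_def
    apply (intro wp_seq wp_asg wp_sto)
    using n a k by (simp_all add: s'_def)
  have at: "at_pat s' = at_pat s" "at_head s' = at_head s" by (simp_all add: s'_def at_pat_def at_head_def fun_eq_iff)
  have p: "at_pat s' (marr s' aOWN (Suc j)) (fst ((Occ @ [(a, a', h)]) ! j)) \<and>
       at_pat s' (marr s' aOTH (Suc j)) (fst (snd ((Occ @ [(a, a', h)]) ! j))) \<and>
       at_head s' (marr s' aOHD (Suc j)) (snd (snd ((Occ @ [(a, a', h)]) ! j)))" if "j < length (Occ @ [(a, a', h)])" for j
  proof (cases "j = k")
    case True
    then show ?thesis using a unfolding at by (simp add: s'_def k_def)
  next
    case False
    then show ?thesis using that I unfolding at by (simp add: s'_def k_def nth_append rinv_def)
  qed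
  have oc: "marr s' aOCO (Suc j) = pcls (fst (snd ((Occ @ [(a, a', h)]) ! j)))" if "j < length (Occ @ [(a, a', h)])" for j
  proof (cases "j = k")
    case True
    then show ?thesis using a by (simp add: s'_def k_def)
  next
    case False
    then have j: "j < length Occ" using that k_def by simp
    then have "occ_repr s (Suc j) (Occ ! j)" using I by (simp add: rinv_def static_def)
    then show ?thesis using False j by (cases "Occ ! j") (simp add: s'_def k_def nth_append occ_repr_def)
  qed
  have rep: "occ_repr s' (Suc j) ((Occ @ [(a, a', h)]) ! j)" if "j < length (Occ @ [(a, a', h)])" for j
    using p[OF that] oc[OF that] unfolding occ_repr_def at_pat_def at_head_def
    by (cases "(Occ @ [(a, a', h)]) ! j") simp
  have "chain (marr s' aONX) (marr s' aOL c) (cells (\<lambda>j. pcls (fst ((Occ @ [(a, a', h)]) ! j))) (length (Occ @ [(a, a', h)])) c)" for c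
    using chain_push[of "marr s aONX" "marr s aOL" "\<lambda>j. pcls (fst (Occ ! j))" k "\<lambda>j. pcls (fst ((Occ @ [(a, a', h)]) ! j))" "pcls a" c] I
    by (simp add: s'_def k_def nth_append rinv_def static_def)
  moreover have "mreg s' rOc = length (Occ @ [(a, a', h)])" by (simp add: s'_def k_def)
  moreover have "\<forall>c. marr s' aIDB c \<noteq> 0 \<longleftrightarrow> c \<in> J" using I by (simp add: s'_def rinv_def static_def)
  ultimately have "static s' (Occ @ [(a, a', h)]) J" using rep unfolding static_def by blast
  moreover have "1 \<le> mreg s' rBd \<and> marr s' aTAG 0 = 0 \<and> (\<forall>x>mreg s' rCnt. marr s' aTAG x = 0)" using I by (simp add: s'_def rinv_def)
  ultimately have "rinv s' (Occ @ [(a, a', h)]) J" using p unfolding rinv_def by blast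
  moreover have "same {rOc} {aOWN, aOTH, aOCO, aOHD, aONX, aOL} s s'" by (simp add: s'_def same_def)
  ultimately show ?thesis by (intro wp_conseq[OF w]) blast
qed

text \<open>Padding to two patterns: a missing body becomes the empty pattern twice, a single atom
  is taken twice. A nonempty body also marks the class of the head in \<open>aIDB\<close>, following
  the definition of IDB predicates.\<close>

definition body_code :: ram where
  "body_code = asg rB1 (Num 0) ;; asg rC1 (Num 0) ;; asg rB2 (Num 0) ;; asg rC2 (Num 0) ;;
     cond (Reg rM)
       (sto aIDB (Reg rP) (Num 1) ;; asg rB1 (Plus (Reg rCnt) (Num 2)) ;; atom_code ;;
        asg rC1 (Reg rCl) ;; asg rB2 (Reg rB1) ;; asg rC2 (Reg rC1) ;;
        cond (Minus (Reg rM) (Num 1))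
          (asg rB2 (Plus (Reg rCnt) (Num 2)) ;; atom_code ;; asg rC2 (Reg rCl)) Skip)
       Skip"

fun body_pats :: "atom list \<Rightarrow> trm list \<times> trm list" where
  "body_pats [] = ([], [])"
| "body_pats [x] = (pat x, pat x)"
| "body_pats (x # y # xs) = (pat x, pat y)"

abbreviation (input) Wa :: "var set" where
  "Wa \<equiv> {rL, rTg, rX, rCnt, rBd, rCl, rB1, rC1, rB2, rC2}"

lemma pcls_pat [simp]: "pcls (pat a) = Suc (fst a)"
  by (simp add: pat_def)

lemma wp_atom_at:
  assumes I: "rinv s Occ J" and minp: "minp s = enc_atom (mreg s rFlag \<noteq> 0) a @ rest" "readable (mreg s rFlag \<noteq> 0) (snd a)"
  shows "wp atom_code (\<lambda>n s'. n \<le> 11 * length (snd a) + 16 \<and> grow s s' \<and> minp s' = rest \<and> mreg s' rCl = Suc (fst a) \<and>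
    at_pat s' (mreg s rCnt + 2) (pat a) \<and> at_head s' (mreg s' rCnt) (pat a) \<and> rinv s' Occ J \<and>
    same {rL, rTg, rX, rCnt, rBd, rCl} {aTAG, aVAL} s (s'\<lparr>minp := minp s\<rparr>)) s"
proof (rule wp_conseq[OF wp_atom[OF minp]])
  show "\<forall>x>mreg s rCnt. marr s aTAG x = 0" "1 \<le> mreg s rBd" using I by (auto simp: rinv_def)
  fix n s'
  assume *: "n \<le> 11 * length (snd a) + 16 \<and> grow s s' \<and> minp s' = rest \<and> mreg s' rCl = pcls (pat a) \<and>
    patf (marr s' aTAG) (marr s' aVAL) (mreg s rCnt + 2) (pat a) \<and> patb (marr s' aTAG) (marr s' aVAL) (mreg s' rCnt) (rev (pat a)) \<and>
    mreg s rCnt + 2 + length (pat a) = mreg s' rCnt + 1 \<and> (\<forall>t\<in>set (pat a). tval t < mreg s' rBd) \<and>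
    same {rL, rTg, rX, rCnt, rBd, rCl} {aTAG, aVAL} s (s'\<lparr>minp := minp s\<rparr>)"
  then have "rinv s' Occ J"
    by (intro rinv_grow[OF I, of s' "{rL, rTg, rX, rCnt, rBd, rCl}" "{aTAG, aVAL}"])
      (use I in \<open>auto simp: rinv_def static_def same_def\<close>)
  then show "n \<le> 11 * length (snd a) + 16 \<and> grow s s' \<and> minp s' = rest \<and> mreg s' rCl = Suc (fst a) \<and>
    at_pat s' (mreg s rCnt + 2) (pat a) \<and> at_head s' (mreg s' rCnt) (pat a) \<and> rinv s' Occ J \<and>
    same {rL, rTg, rX, rCnt, rBd, rCl} {aTAG, aVAL} s (s'\<lparr>minp := minp s\<rparr>)"
    using * by (simp add: at_pat_def at_head_def)
qed

definition jset :: "rule \<Rightarrow> nat set" where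
  "jset R = (if rbody R = [] then {} else {Suc (fst (rhead R))})"

definition body_post :: "st \<Rightarrow> atom list \<Rightarrow> occ list \<Rightarrow> nat set \<Rightarrow> nat list \<Rightarrow> st \<Rightarrow> bool" where
  "body_post s body Occ J' rest s' \<longleftrightarrow> grow s s' \<and> minp s' = rest \<and> rinv s' Occ J' \<and>
     at_pat s' (mreg s' rB1) (fst (body_pats body)) \<and> mreg s' rC1 = pcls (fst (body_pats body)) \<and>
     at_pat s' (mreg s' rB2) (snd (body_pats body)) \<and> mreg s' rC2 = pcls (snd (body_pats body)) \<and>
     same Wa {aTAG, aVAL, aIDB} s (s'\<lparr>minp := minp s\<rparr>)"

lemma wp_body:
  assumes I: "rinv s Occ J" and minp: "minp s = concat (map (enc_atom True) body) @ rest"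
    and fl: "body \<noteq> [] \<Longrightarrow> mreg s rFlag \<noteq> 0" and len: "length body \<le> 2" "\<forall>a\<in>set body. length (snd a) \<le> k"
    and M: "mreg s rM = length body"
  shows "wp body_code (\<lambda>n s'. n \<le> 22 * k + 50 \<and>
    body_post s body Occ (if body = [] then J else insert (mreg s rP) J) rest s') s"
proof -
  have z: "\<forall>x>mreg s rCnt. marr s aTAG x = 0" using I by (simp add: rinv_def)
  define s1 where "s1 = s\<lparr>mreg := (mreg s)(rB1 := 0, rC1 := 0, rB2 := 0, rC2 := 0)\<rparr>"
  have sm1: "same {rB1, rC1, rB2, rC2} {} s (s1\<lparr>minp := minp s\<rparr>)" by (simp add: s1_def same_def)
  have J: "\<forall>c. marr s aIDB c \<noteq> 0 \<longleftrightarrow> c \<in> J" using I by (simp add: rinv_def static_def)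
  have g1: "grow s s1" using grow_same[OF sm1] z by simp
  have I1: "rinv s1 Occ J" by (rule rinv_grow[OF I g1 sm1]) (use J in \<open>auto simp: s1_def\<close>)
  have Q: "wp (cond (Reg rM)
       (sto aIDB (Reg rP) (Num 1) ;; asg rB1 (Plus (Reg rCnt) (Num 2)) ;; atom_code ;;
        asg rC1 (Reg rCl) ;; asg rB2 (Reg rB1) ;; asg rC2 (Reg rC1) ;;
        cond (Minus (Reg rM) (Num 1))
          (asg rB2 (Plus (Reg rCnt) (Num 2)) ;; atom_code ;; asg rC2 (Reg rCl)) Skip)
       Skip) (\<lambda>n s'. 4 + n \<le> 22 * k + 50 \<and>
         body_post s body Occ (if body = [] then J else insert (mreg s rP) J) rest s') s1" (is "wp ?c ?Q s1")
  proof (cases body)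
    case Nil
    have "at_pat s1 0 []" using I1 by (simp add: at_pat_def rinv_def)
    then have "body_post s body Occ J rest s1"
      using g1 I1 same_mono[OF sm1, of Wa "{aTAG, aVAL, aIDB}"] minp Nil by (simp add: body_post_def s1_def)
    moreover have "mreg s1 rM = 0" using M Nil by (simp add: s1_def)
    ultimately have "wp ?c (\<lambda>n s'. n \<le> 2 \<and> s' = s1) s1" by (intro wp_cond wp_skip) simp_all
    then show ?thesis by (rule wp_conseq) (use \<open>body_post s body Occ J rest s1\<close> Nil in auto)
  next
    case (Cons x xs)
    define J' where "J' = insert (mreg s rP) J"
    have flag: "mreg s rFlag \<noteq> 0" using fl Cons by simp
    define s2 where "s2 = s1\<lparr>marr := (marr s1)(aIDB := (marr s1 aIDB)(mreg s rP := 1)), mreg := (mreg s1)(rB1 := mreg s rCnt + 2)\<rparr>"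
    have sm2: "same {rB1} {aIDB} s1 (s2\<lparr>minp := minp s1\<rparr>)" by (simp add: s2_def same_def)
    have z1: "\<forall>x>mreg s1 rCnt. marr s1 aTAG x = 0" using z by (simp add: s1_def)
    have g2: "grow s1 s2" using grow_same[OF sm2] z1 by simp
    have I2: "rinv s2 Occ J'" by (rule rinv_grow[OF I1 g2 sm2]) (use J in \<open>auto simp: s2_def s1_def J'_def\<close>)
    have f2: "mreg s2 rFlag \<noteq> 0" "mreg s2 rCnt = mreg s rCnt" "mreg s2 rB1 = mreg s rCnt + 2" using flag by (simp_all add: s2_def s1_def)
    have ip2: "minp s2 = enc_atom (mreg s2 rFlag \<noteq> 0) x @ concat (map (enc_atom True) xs) @ rest"
      using minp Cons f2 by (simp add: s2_def s1_def)
    note A = wp_atom_at[OF I2 ip2] 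
    have lx: "length (snd x) \<le> k" using len Cons by simp
    have W: "wp atom_code (\<lambda>n. wp (asg rC1 (Reg rCl) ;; asg rB2 (Reg rB1) ;; asg rC2 (Reg rC1) ;;
        cond (Minus (Reg rM) (Num 1))
          (asg rB2 (Plus (Reg rCnt) (Num 2)) ;; atom_code ;; asg rC2 (Reg rCl)) Skip)
        (\<lambda>m s'. 7 + (n + m) \<le> 22 * k + 50 \<and> body_post s body Occ J' rest s')) s2"
    proof (rule wp_conseq[OF A], goal_cases)
      case 1 then show ?case using f2 by (simp add: readable_def)
    next
      case (2 n s3)
      then have n: "n \<le> 11 * length (snd x) + 16" and g3: "grow s2 s3" and ip3: "minp s3 = concat (map (enc_atom True) xs) @ rest"
        and cl: "mreg s3 rCl = Suc (fst x)" and ap: "at_pat s3 (mreg s2 rCnt + 2) (pat x)" and I3: "rinv s3 Occ J'"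
        and sm3: "same {rL, rTg, rX, rCnt, rBd, rCl} {aTAG, aVAL} s2 (s3\<lparr>minp := minp s2\<rparr>)" by blast+
      have B1: "mreg s3 rB1 = mreg s2 rCnt + 2" using sm3 f2 by (simp add: same_def)
      define s4 where "s4 = s3\<lparr>mreg := (mreg s3)(rC1 := Suc (fst x), rB2 := mreg s3 rB1, rC2 := Suc (fst x))\<rparr>"
      have sm4: "same {rC1, rB2, rC2} {} s3 (s4\<lparr>minp := minp s3\<rparr>)" by (simp add: s4_def same_def)
      have z3: "\<forall>x>mreg s3 rCnt. marr s3 aTAG x = 0" using I3 by (simp add: rinv_def)
      have g4: "grow s3 s4" using grow_same[OF sm4] z3 by simp
      have J3: "\<forall>c. marr s3 aIDB c \<noteq> 0 \<longleftrightarrow> c \<in> J'" using I3 by (simp add: rinv_def static_def)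
      have I4: "rinv s4 Occ J'" by (rule rinv_grow[OF I3 g4 sm4]) (use J3 in \<open>auto simp: s4_def\<close>)
      have g04: "grow s s4" using g1 g2 g3 g4 grow_trans by blast
      have ap4: "at_pat s4 (mreg s4 rB1) (pat x)" using ap B1 by (simp add: s4_def at_pat_def)
      have sm04: "same Wa {aTAG, aVAL, aIDB} s (s4\<lparr>minp := minp s\<rparr>)"
        using sm1 sm2 sm3 sm4 by (auto simp: same_def)
      have rM4: "mreg s4 rM = Suc (length xs)" using sm04 M Cons by (simp add: same_def)
      have last: "wp (cond (Minus (Reg rM) (Num 1))
          (asg rB2 (Plus (Reg rCnt) (Num 2)) ;; atom_code ;; asg rC2 (Reg rCl)) Skip)
          (\<lambda>m s'. m \<le> 11 * k + 20 \<and> body_post s body Occ J' rest s') s4"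
      proof (rule wp_cond)
        assume "aval (Minus (Reg rM) (Num 1)) s4 = 0"
        then have xs: "xs = []" using rM4 by simp
        have "body_post s body Occ J' rest s4"
          using g04 I4 ap4 sm04 ip3 by (simp add: body_post_def Cons xs s4_def)
        then show "wp Skip (\<lambda>n s'. Suc n \<le> 11 * k + 20 \<and> body_post s body Occ J' rest s') s4"
          by (intro wp_skip) simp
      next
        assume "aval (Minus (Reg rM) (Num 1)) s4 \<noteq> 0"
        then have "xs \<noteq> []" using rM4 by auto
        then obtain y where y: "xs = [y]" using len Cons by (cases xs) auto
        define s5 where "s5 = s4\<lparr>mreg := (mreg s4)(rB2 := mreg s4 rCnt + 2)\<rparr>"
        have sm5: "same {rB2} {} s4 (s5\<lparr>minp := minp s4\<rparr>)" by (simp add: s5_def same_def)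
        have z4: "\<forall>x>mreg s4 rCnt. marr s4 aTAG x = 0" using I4 by (simp add: rinv_def)
        have g5: "grow s4 s5" using grow_same[OF sm5] z4 by simp
        have I5: "rinv s5 Occ J'" by (rule rinv_grow[OF I4 g5 sm5]) (use J3 in \<open>auto simp: s4_def s5_def\<close>)
        have f5: "mreg s5 rFlag \<noteq> 0" using sm04 flag by (simp add: s5_def same_def)
        have ip5: "minp s5 = enc_atom (mreg s5 rFlag \<noteq> 0) y @ rest" using ip3 f5 by (simp add: s5_def s4_def y)
        note A5 = wp_atom_at[OF I5 ip5]
        have ly: "length (snd y) \<le> k" using len Cons y by simp
        have "wp atom_code (\<lambda>n. wp (asg rC2 (Reg rCl)) (\<lambda>m s'. Suc (1 + (n + m)) \<le> 11 * k + 20 \<and> body_post s body Occ J' rest s')) s5"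
        proof (rule wp_conseq[OF A5], goal_cases)
          case 1 then show ?case using f5 by (simp add: readable_def)
        next
          case (2 n s6)
          then have n: "n \<le> 11 * length (snd y) + 16" and g6: "grow s5 s6" and ip6: "minp s6 = rest"
            and cl6: "mreg s6 rCl = Suc (fst y)" and ap6: "at_pat s6 (mreg s5 rCnt + 2) (pat y)" and I6: "rinv s6 Occ J'"
            and sm6: "same {rL, rTg, rX, rCnt, rBd, rCl} {aTAG, aVAL} s5 (s6\<lparr>minp := minp s5\<rparr>)" by blast+
          define s7 where "s7 = s6\<lparr>mreg := (mreg s6)(rC2 := Suc (fst y))\<rparr>"
          have sm7: "same {rC2} {} s6 (s7\<lparr>minp := minp s6\<rparr>)" by (simp add: s7_def same_def)
          have z6: "\<forall>x>mreg s6 rCnt. marr s6 aTAG x = 0" using I6 by (simp add: rinv_def)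
          have g7: "grow s6 s7" using grow_same[OF sm7] z6 by simp
          have J6: "\<forall>c. marr s6 aIDB c \<noteq> 0 \<longleftrightarrow> c \<in> J'" using I6 by (simp add: rinv_def static_def)
          have I7: "rinv s7 Occ J'" by (rule rinv_grow[OF I6 g7 sm7]) (use J6 in \<open>auto simp: s7_def\<close>)
          have g47: "grow s4 s7" using g5 g6 g7 grow_trans by blast
          have "mreg s7 rB1 = mreg s4 rB1" "mreg s7 rC1 = Suc (fst x)" "mreg s7 rB2 = mreg s5 rCnt + 2"
            using sm6 by (simp_all add: same_def s7_def s5_def s4_def)
          moreover have "at_pat s7 (mreg s4 rB1) (pat x)" using at_pat_grow[OF ap4 g47] .
          moreover have "at_pat s7 (mreg s5 rCnt + 2) (pat y)" using at_pat_grow[OF ap6 g7] .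
          moreover have "same Wa {aTAG, aVAL, aIDB} s (s7\<lparr>minp := minp s\<rparr>)"
            using sm04 sm5 sm6 sm7 by (auto simp: same_def)
          ultimately have "body_post s body Occ J' rest s7"
            using grow_trans[OF g04 g47] I7 ip6 by (simp add: body_post_def Cons y s7_def)
          then show ?case using n ly cl6 by (intro wp_asg) (simp_all add: s7_def)
        qed
        then show "wp (asg rB2 (Plus (Reg rCnt) (Num 2)) ;; atom_code ;; asg rC2 (Reg rCl))
            (\<lambda>n s'. Suc n \<le> 11 * k + 20 \<and> body_post s body Occ J' rest s') s4"
          by (intro wp_seq[where c="asg rB2 _"] wp_asg wp_seq[where c="atom_code"]) (simp_all add: s5_def)
      qed simp
      then show ?case
        by (intro wp_seq[where c="asg _ _"] wp_asg; simp add: cl s4_def[symmetric])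
          (erule wp_conseq, use n lx in simp)
    qed
    have "mreg s1 rM \<noteq> 0" using M Cons by (simp add: s1_def)
    then show ?thesis
      using W Cons by (intro wp_cond wp_seq[where c="sto _ _ _"] wp_sto wp_seq[where c="asg _ _"] wp_asg wp_seq[where c=atom_code])
        (simp_all add: s2_def s1_def J'_def)
  qed
  then show ?thesis
    unfolding body_code_def by (intro wp_seq wp_asg) (simp_all add: s1_def)
qed

text \<open>Program rules and database facts share this code. With the flag unset no body length is
  read, and the fact becomes a rule with empty body.\<close>

definition rule_code :: ram where
  "rule_code = atom_code ;; asg rHd (Reg rCnt) ;; asg rP (Reg rCl) ;; asg rM (Num 0) ;;
     cond (Reg rFlag) (rd rM) Skip ;; body_code ;; reg_code rB1 rC1 rB2 rC2 ;; reg_code rB2 rC2 rB1 rC1"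

definition rules_code :: ram where
  "rules_code = loop (Reg rNr) (asg rNr (Minus (Reg rNr) (Num 1)) ;; rule_code)"

definition enc_rule :: "bool \<Rightarrow> rule \<Rightarrow> nat list" where
  "enc_rule fl R = enc_atom fl (rhead R) @
     (if fl then length (rbody R) # concat (map (enc_atom True) (rbody R)) else [])"

definition occs_of :: "rule \<Rightarrow> occ list" where
  "occs_of R = (let (a, b) = body_pats (rbody R); h = pat (rhead R) in [(a, b, h), (b, a, h)])"

definition rule_ok :: "bool \<Rightarrow> nat \<Rightarrow> rule \<Rightarrow> bool" where
  "rule_ok fl k R \<longleftrightarrow> readable fl (snd (rhead R)) \<and> (\<not> fl \<longrightarrow> rbody R = []) \<and> length (rbody R) \<le> 2 \<and>
     (\<forall>a\<in>set (rhead R # rbody R). length (snd a) \<le> k)"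

abbreviation (input) Wr :: "var set" where
  "Wr \<equiv> {rL, rTg, rX, rCnt, rBd, rCl, rB1, rC1, rB2, rC2, rHd, rP, rM, rOc}"
abbreviation (input) Rr :: "arr set" where
  "Rr \<equiv> {aTAG, aVAL, aIDB, aOWN, aOTH, aOCO, aOHD, aONX, aOL}"

lemma wp_rule:
  assumes I: "rinv s Occ J" and minp: "minp s = enc_rule fl R @ rest" and fl: "(mreg s rFlag \<noteq> 0) = fl"
    and ok: "rule_ok fl k R"
  shows "wp rule_code (\<lambda>n s'. n \<le> 33 * k + 90 \<and> minp s' = rest \<and> rinv s' (Occ @ occs_of R) (J \<union> jset R) \<and>
    same Wr Rr s (s'\<lparr>minp := minp s\<rparr>)) s" (is "wp _ ?Q _")
proof -
  define a b h where "a = fst (body_pats (rbody R))" and "b = snd (body_pats (rbody R))" and "h = pat (rhead R)"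
  have oc: "occs_of R = [(a, b, h), (b, a, h)]" by (simp add: occs_of_def a_def b_def h_def Let_def split: prod.splits)
  define tl1 where "tl1 = (if fl then length (rbody R) # concat (map (enc_atom True) (rbody R)) else []) @ rest"
  have ip1: "minp s = enc_atom (mreg s rFlag \<noteq> 0) (rhead R) @ tl1" using minp unfolding fl by (simp add: enc_rule_def tl1_def)
  have lk: "length (snd (rhead R)) \<le> k" "\<forall>a\<in>set (rbody R). length (snd a) \<le> k" "length (rbody R) \<le> 2"
    using ok by (auto simp: rule_ok_def)
  note A = wp_atom_at[OF I ip1]
  have "wp atom_code (\<lambda>n. wp (asg rHd (Reg rCnt) ;; asg rP (Reg rCl) ;; asg rM (Num 0) ;;
     cond (Reg rFlag) (rd rM) Skip ;; body_code ;; reg_code rB1 rC1 rB2 rC2 ;; reg_code rB2 rC2 rB1 rC1)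
     (\<lambda>m. ?Q (n + m))) s"
  proof (rule wp_conseq[OF A], goal_cases)
    case 1 then show ?case using ok unfolding fl by (simp add: rule_ok_def)
  next
    case (2 n s1)
    then have n: "n \<le> 11 * length (snd (rhead R)) + 16" and ip1': "minp s1 = tl1" and cl: "mreg s1 rCl = Suc (fst (rhead R))"
      and hd1: "at_head s1 (mreg s1 rCnt) h" and I1: "rinv s1 Occ J"
      and sm1: "same {rL, rTg, rX, rCnt, rBd, rCl} {aTAG, aVAL} s (s1\<lparr>minp := minp s\<rparr>)"
      unfolding h_def by blast+
    define s2 where "s2 = s1\<lparr>mreg := (mreg s1)(rHd := mreg s1 rCnt, rP := Suc (fst (rhead R)), rM := length (rbody R)),
      minp := concat (map (enc_atom True) (rbody R)) @ rest\<rparr>"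
    have sm2: "same {rHd, rP, rM} {} s1 (s2\<lparr>minp := minp s1\<rparr>)" by (simp add: s2_def same_def)
    have z1: "\<forall>x>mreg s1 rCnt. marr s1 aTAG x = 0" using I1 by (simp add: rinv_def)
    have g2: "grow s1 s2" using grow_same[OF sm2] z1 by simp
    have J1: "\<forall>c. marr s1 aIDB c \<noteq> 0 \<longleftrightarrow> c \<in> J" using I1 by (simp add: rinv_def static_def)
    have I2: "rinv s2 Occ J" by (rule rinv_grow[OF I1 g2 sm2]) (use J1 in \<open>auto simp: s2_def\<close>)
    have hd2: "at_head s2 (mreg s2 rHd) h" using hd1 by (simp add: s2_def at_head_def)
    have B: "wp body_code (\<lambda>n s'. n \<le> 22 * k + 50 \<and>
      body_post s2 (rbody R) Occ (if rbody R = [] then J else insert (mreg s2 rP) J) rest s') s2"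
    proof (rule wp_body[OF I2])
      show "rbody R \<noteq> [] \<Longrightarrow> mreg s2 rFlag \<noteq> 0" using ok fl sm1 by (auto simp: rule_ok_def same_def s2_def)
    qed (use lk in \<open>simp_all add: s2_def\<close>)
    have J2: "(if rbody R = [] then J else insert (mreg s2 rP) J) = J \<union> jset R" by (simp add: jset_def s2_def)
    have W: "wp body_code (\<lambda>m. wp (reg_code rB1 rC1 rB2 rC2 ;; reg_code rB2 rC2 rB1 rC1)
      (\<lambda>m'. ?Q (5 + (n + (m + m'))))) s2"
    proof (rule wp_conseq[OF B], elim conjE, unfold J2)
      fix m s3 assume m: "m \<le> 22 * k + 50" and bp: "body_post s2 (rbody R) Occ (J \<union> jset R) rest s3"
      have I3: "rinv s3 Occ (J \<union> jset R)" and g3: "grow s2 s3" and ip3: "minp s3 = rest"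
        and sm3: "same Wa {aTAG, aVAL, aIDB} s2 (s3\<lparr>minp := minp s2\<rparr>)"
        and ap3: "at_pat s3 (mreg s3 rB1) a" "mreg s3 rC1 = pcls a" "at_pat s3 (mreg s3 rB2) b" "mreg s3 rC2 = pcls b"
        using bp unfolding body_post_def a_def b_def by blast+
      have "mreg s3 rHd = mreg s2 rHd" using sm3 by (simp add: same_def)
      then have hd3: "at_head s3 (mreg s3 rHd) h" using at_head_grow[OF hd2 g3] by simp
      have R1: "wp (reg_code rB1 rC1 rB2 rC2) (\<lambda>n s'. n \<le> 7 \<and> rinv s' (Occ @ [(a, b, h)]) (J \<union> jset R) \<and>
        same {rOc} {aOWN, aOTH, aOCO, aOHD, aONX, aOL} s3 s') s3"
        by (rule wp_reg[OF I3 _ _ _ _ ap3 hd3]) simp_all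
      show "wp (reg_code rB1 rC1 rB2 rC2 ;; reg_code rB2 rC2 rB1 rC1)
      (\<lambda>m'. ?Q (5 + (n + (m + m')))) s3"
      proof (rule wp_seq, rule wp_conseq[OF R1], elim conjE)
        fix n4 :: nat and s4
        assume n4: "n4 \<le> 7" and I4: "rinv s4 (Occ @ [(a, b, h)]) (J \<union> jset R)"
          and sm4: "same {rOc} {aOWN, aOTH, aOCO, aOHD, aONX, aOL} s3 s4"
        have e4: "mreg s4 rB1 = mreg s3 rB1" "mreg s4 rC1 = mreg s3 rC1" "mreg s4 rB2 = mreg s3 rB2" "mreg s4 rC2 = mreg s3 rC2" "mreg s4 rHd = mreg s3 rHd"
          using sm4 by (simp_all add: same_def)
        have at: "at_pat s4 = at_pat s3" "at_head s4 = at_head s3"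
          by (rule ext, rule ext, simp add: at_pat_def at_head_def same_rg[OF sm4] same_ar[OF sm4])+
        have "wp (reg_code rB2 rC2 rB1 rC1) (\<lambda>n s'. n \<le> 7 \<and> rinv s' ((Occ @ [(a, b, h)]) @ [(b, a, h)]) (J \<union> jset R) \<and>
          same {rOc} {aOWN, aOTH, aOCO, aOHD, aONX, aOL} s4 s') s4"
          by (rule wp_reg[OF I4]) (use ap3 hd3 in \<open>simp_all add: e4 at\<close>)
        then show "wp (reg_code rB2 rC2 rB1 rC1) (\<lambda>n5. ?Q (5 + (n + (m + (n4 + n5))))) s4"
        proof (rule wp_conseq, elim conjE, intro conjI)
          fix n5 :: nat and s5
          assume n5: "n5 \<le> 7" and I5: "rinv s5 ((Occ @ [(a, b, h)]) @ [(b, a, h)]) (J \<union> jset R)"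
            and sm5: "same {rOc} {aOWN, aOTH, aOCO, aOHD, aONX, aOL} s4 s5"
          show "5 + (n + (m + (n4 + n5))) \<le> 33 * k + 90" using n m n4 n5 lk by simp
          show "minp s5 = rest" using sm4 sm5 ip3 by (simp add: same_def)
          show "rinv s5 (Occ @ occs_of R) (J \<union> jset R)" using I5 by (simp add: oc)
          show "same Wr Rr s (s5\<lparr>minp := minp s\<rparr>)" using sm1 sm2 sm3 sm4 sm5 by (auto simp: same_def)
        qed
      qed
    qed
    have f1: "(mreg s1 rFlag \<noteq> 0) = fl" using fl sm1 by (auto simp: same_def)
    show ?case
    proof (cases fl)
      case True
      then have "minp s1 = length (rbody R) # concat (map (enc_atom True) (rbody R)) @ rest" using ip1' by (simp add: tl1_def)
      then show ?thesis
        using W f1 True cl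
        by (intro wp_seq[where c="asg _ _"] wp_asg wp_seq[where c="cond _ _ _"] wp_cond wp_rd wp_skip wp_seq[where c=body_code])
          (simp_all add: s2_def)
    next
      case False
      then have b: "rbody R = []" using ok by (simp add: rule_ok_def)
      have "s2 = s1\<lparr>mreg := (mreg s1)(rHd := mreg s1 rCnt, rP := Suc (fst (rhead R)), rM := 0)\<rparr>"
        using ip1' False by (simp add: s2_def b tl1_def)
      then show ?thesis
        using W f1 False cl
        by (intro wp_seq[where c="asg _ _"] wp_asg wp_seq[where c="cond _ _ _"] wp_cond wp_seq[where c=body_code])
          (auto intro!: wp_skip wp_seq[where c=body_code])
    qed
  qed
  then show ?thesis unfolding rule_code_def by (intro wp_seq[where c=atom_code])
qed

lemma wp_rules:
  assumes "rinv s Occ J" "minp s = concat (map (enc_rule fl) Rs) @ rest" "(mreg s rFlag \<noteq> 0) = fl"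
    "\<forall>R\<in>set Rs. rule_ok fl k R" "mreg s rNr = length Rs"
  shows "wp rules_code (\<lambda>n s'. n \<le> (33 * k + 92) * length Rs + 1 \<and> minp s' = rest \<and>
    rinv s' (Occ @ concat (map occs_of Rs)) (J \<union> (\<Union>R\<in>set Rs. jset R)) \<and>
    same (insert rNr Wr) Rr s (s'\<lparr>minp := minp s\<rparr>)) s"
    (is "wp _ (?Q s Occ J Rs) _")
  using assms
proof (induction Rs arbitrary: s Occ J)
  case Nil
  then show ?case unfolding rules_code_def by (intro wp_loop_0) (auto simp: same_def)
next
  case (Cons R Rs)
  define s1 where "s1 = s\<lparr>mreg := (mreg s)(rNr := length Rs)\<rparr>"
  have sm1: "same {rNr} {} s (s1\<lparr>minp := minp s\<rparr>)" by (simp add: s1_def same_def)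
  have J: "\<forall>c. marr s aIDB c \<noteq> 0 \<longleftrightarrow> c \<in> J" and z: "\<forall>x>mreg s rCnt. marr s aTAG x = 0"
    using Cons.prems(1) by (auto simp: rinv_def static_def)
  have I1: "rinv s1 Occ J"
    by (rule rinv_grow[OF Cons.prems(1) grow_same[OF sm1] sm1]) (use J z in \<open>auto simp: s1_def\<close>)
  have W: "wp rule_code (\<lambda>n s'. n \<le> 33 * k + 90 \<and> minp s' = concat (map (enc_rule fl) Rs) @ rest \<and>
    rinv s' (Occ @ occs_of R) (J \<union> jset R) \<and> same Wr Rr s1 (s'\<lparr>minp := minp s1\<rparr>)) s1"
    by (rule wp_rule[OF I1]) (use Cons.prems in \<open>auto simp: s1_def\<close>)
  have "wp rule_code (\<lambda>n. wp rules_code (\<lambda>m. ?Q s Occ J (R # Rs) (2 + n + m))) s1"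
  proof (rule wp_conseq[OF W], elim conjE)
    fix n s2
    assume n: "n \<le> 33 * k + 90" and ip2: "minp s2 = concat (map (enc_rule fl) Rs) @ rest"
      and I2: "rinv s2 (Occ @ occs_of R) (J \<union> jset R)" and sm2: "same Wr Rr s1 (s2\<lparr>minp := minp s1\<rparr>)"
    have f2: "(mreg s2 rFlag \<noteq> 0) = fl" "mreg s2 rNr = length Rs" using sm2 Cons.prems(3) by (auto simp: same_def s1_def)
    have "wp rules_code (?Q s2 (Occ @ occs_of R) (J \<union> jset R) Rs) s2"
      by (rule Cons.IH[OF I2 ip2 f2(1) _ f2(2)]) (use Cons.prems(4) in simp)
    then show "wp rules_code (\<lambda>m. ?Q s Occ J (R # Rs) (2 + n + m)) s2"
    proof (rule wp_conseq, elim conjE, intro conjI)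
      fix m s3
      assume h: "m \<le> (33 * k + 92) * length Rs + 1" "minp s3 = rest"
        "rinv s3 ((Occ @ occs_of R) @ concat (map occs_of Rs)) ((J \<union> jset R) \<union> (\<Union>R\<in>set Rs. jset R))"
        "same (insert rNr Wr) Rr s2 (s3\<lparr>minp := minp s2\<rparr>)"
      show "2 + n + m \<le> (33 * k + 92) * length (R # Rs) + 1" using n h(1) by (simp add: algebra_simps)
      show "minp s3 = rest" by fact
      show "rinv s3 (Occ @ concat (map occs_of (R # Rs))) (J \<union> (\<Union>R\<in>set (R # Rs). jset R))"
        using h(3) by (simp add: Un_assoc)
      show "same (insert rNr Wr) Rr s (s3\<lparr>minp := minp s\<rparr>)" using sm1 sm2 h(4) by (auto simp: same_def)
    qed
  qed
  note W' = this
  show ?case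
    apply (subst rules_code_def)
    apply (rule wp_loop_step)
      apply simp
    subgoal using Cons.prems(5) by simp
    unfolding rules_code_def[symmetric]
    apply (intro wp_seq[where c="asg _ _"] wp_asg wp_seq[where c=rule_code])
     apply simp
    using W' Cons.prems(5) by (simp add: s1_def)
qed

text \<open>No list is stored before the whole input is read, since \<open>rBd\<close> has to be
  final. The queue then starts with the empty list: fresh memory already contains node 0 in its
  first cell, and processing it fires all rules with empty body, the database facts among
  them.\<close>

definition datalog_machine :: ram where
  "datalog_machine = asg rBd (Num 1) ;; asg rFlag (Num 1) ;; rd rNr ;; rules_code ;;
     asg rFlag (Num 0) ;; rd rNr ;; rules_code ;;
     asg rQc (Num 1) ;; sto aQL (Num 0) (Num 1) ;; sto aKNOWN (Num 0) (Num 1) ;; main_code"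

definition fact_rule :: "fact \<Rightarrow> rule" where
  "fact_rule f = Rule (fst f, map Cst (snd f)) []"

lemma enc_fact_rule: "enc_rule False (fact_rule f) = encode_fact f"
  by (simp add: enc_rule_def fact_rule_def enc_atom_def enc_args_def encode_fact_def comp_def)

lemma enc_rule_True: "enc_rule True = encode_rule"
proof -
  have "enc_atom True = encode_atom" by (rule ext) (simp add: enc_atom_def enc_args_def encode_atom_def)
  then show ?thesis unfolding fun_eq_iff[of "enc_rule True"] enc_rule_def encode_rule_def by simp
qed

lemma (in worklist) datalog_machine_exec:
  assumes Occ: "Occ = concat (map occs_of (Rs @ map fact_rule Ds))" and J: "J = (\<Union>R\<in>set Rs. jset R)"
    and ok: "\<forall>R\<in>set Rs. rule_ok True k R" "\<forall>f\<in>set Ds. length (snd f) \<le> k"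
  shows "\<exists>t s Q. ram_exec datalog_machine (initial_state (encode_input Rs Ds)) t s \<and>
    t \<le> 200 * ((33 * k + 92) * (length Rs + length Ds) + (\<Sum>f\<in>L. fcost f) + 20) \<and>
    distinct Q \<and> set Q \<subseteq> L \<and> [] \<in> set Q \<and> out s = concat (filter (\<lambda>f. fcls f \<in> J) Q) \<and>
    (\<forall>a b h \<theta>. (a, b, h) \<in> set Occ \<longrightarrow> map (ground_trm \<theta>) a \<in> set Q \<longrightarrow>
        map (ground_trm \<theta>) b \<in> set Q \<longrightarrow> map (ground_trm \<theta>) h \<in> set Q)"
proof -
  define S where "S = initial_state (encode_input Rs Ds)"
  define s0 where "s0 = abs_state S"
  have s0: "mreg s0 = (\<lambda>_. 0)" "marr s0 = (\<lambda>_ _. 0)" "minp s0 = encode_input Rs Ds" "mout s0 = []"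
    by (simp_all add: s0_def S_def abs_state_def initial_state_def)
  define Ds' where "Ds' = map fact_rule Ds"
  have ipe: "minp s0 = length Rs # concat (map (enc_rule True) Rs) @ length Ds # concat (map (enc_rule False) Ds')"
    unfolding s0 by (simp add: encode_input_def enc_rule_True Ds'_def comp_def enc_fact_rule)
  define s1 where "s1 = s0\<lparr>mreg := (mreg s0)(rBd := 1, rFlag := 1, rNr := length Rs),
    minp := concat (map (enc_rule True) Rs) @ length Ds # concat (map (enc_rule False) Ds')\<rparr>"
  have I1: "rinv s1 [] {}"
    by (simp add: rinv_def static_def s1_def s0 cells_def)
  have ok2: "\<forall>R\<in>set Ds'. rule_ok False k R"
    using ok(2) by (auto simp: Ds'_def fact_rule_def rule_ok_def readable_def)
  have lD: "length Ds' = length Ds" by (simp add: Ds'_def)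
  define post where "post = (\<lambda>n s. n \<le> (33 * k + 92) * (length Rs + length Ds) + (\<Sum>f\<in>L. fcost f) + 20 \<and>
     (\<exists>Q. minv s Q (length Q)))"
  have R1: "wp rules_code (\<lambda>n s'. n \<le> (33 * k + 92) * length Rs + 1 \<and>
      minp s' = length Ds # concat (map (enc_rule False) Ds') \<and>
    rinv s' ([] @ concat (map occs_of Rs)) ({} \<union> (\<Union>R\<in>set Rs. jset R)) \<and>
    same (insert rNr Wr) Rr s1 (s'\<lparr>minp := minp s1\<rparr>)) s1"
    by (rule wp_rules[OF I1 _ _ ok(1)]) (simp_all add: s1_def)
  have "wp rules_code (\<lambda>n. wp (asg rFlag (Num 0) ;; rd rNr ;; rules_code ;;
     asg rQc (Num 1) ;; sto aQL (Num 0) (Num 1) ;; sto aKNOWN (Num 0) (Num 1) ;; main_code)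
     (\<lambda>m. post (3 + (n + m)))) s1"
  proof (rule wp_conseq[OF R1], elim conjE)
    fix n2 :: nat and s2
    assume n2: "n2 \<le> (33 * k + 92) * length Rs + 1" and ip2: "minp s2 = length Ds # concat (map (enc_rule False) Ds')"
      and I2: "rinv s2 ([] @ concat (map occs_of Rs)) ({} \<union> (\<Union>R\<in>set Rs. jset R))"
      and sm2: "same (insert rNr Wr) Rr s1 (s2\<lparr>minp := minp s1\<rparr>)"
    define s3 where "s3 = s2\<lparr>mreg := (mreg s2)(rFlag := 0, rNr := length Ds), minp := concat (map (enc_rule False) Ds')\<rparr>"
    have sm3: "same {rFlag, rNr} {} s2 (s3\<lparr>minp := minp s2\<rparr>)" by (simp add: s3_def same_def)
    have J2: "\<forall>c. marr s2 aIDB c \<noteq> 0 \<longleftrightarrow> c \<in> J" and z: "\<forall>x>mreg s2 rCnt. marr s2 aTAG x = 0"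
      using I2 by (auto simp: rinv_def static_def J)
    have I3: "rinv s3 (concat (map occs_of Rs)) J"
      by (rule rinv_grow[OF I2[unfolded append_Nil] grow_same[OF sm3] sm3]) (use J2 z in \<open>auto simp: s3_def\<close>)
    have R3: "wp rules_code (\<lambda>n s'. n \<le> (33 * k + 92) * length Ds' + 1 \<and> minp s' = [] \<and>
      rinv s' (concat (map occs_of Rs) @ concat (map occs_of Ds')) (J \<union> (\<Union>R\<in>set Ds'. jset R)) \<and>
      same (insert rNr Wr) Rr s3 (s'\<lparr>minp := minp s3\<rparr>)) s3"
      by (rule wp_rules[OF I3 _ _ ok2]) (simp_all add: s3_def lD)
    have occ3: "concat (map occs_of Rs) @ concat (map occs_of Ds') = Occ" by (simp add: Occ Ds'_def)
    have J3: "J \<union> (\<Union>R\<in>set Ds'. jset R) = J" by (auto simp: Ds'_def fact_rule_def jset_def)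
    have W3: "wp rules_code (\<lambda>n. wp (asg rQc (Num 1) ;; sto aQL (Num 0) (Num 1) ;; sto aKNOWN (Num 0) (Num 1) ;; main_code)
     (\<lambda>m. post (5 + (n2 + (n + m))))) s3"
    proof (rule wp_conseq[OF R3], unfold occ3 J3, elim conjE)
      fix n4 :: nat and s4
      assume n4: "n4 \<le> (33 * k + 92) * length Ds' + 1" and I4: "rinv s4 Occ J"
        and sm4: "same (insert rNr Wr) Rr s3 (s4\<lparr>minp := minp s3\<rparr>)"
      define s5 where "s5 = s4\<lparr>mreg := (mreg s4)(rQc := 1),
        marr := (marr s4)(aQL := (marr s4 aQL)(0 := 1), aKNOWN := (marr s4 aKNOWN)(0 := 1))\<rparr>"
      have sm: "same (insert rFlag (insert rNr Wr)) Rr s1 (s4\<lparr>minp := minp s1\<rparr>)"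
        using sm2 sm3 sm4 by (simp add: same_def)
      have zr: "mreg s4 rNn = 0" "mreg s4 rQp = 0" "mreg s4 rSt = 0"
        using same_rg[OF sm, of rNn] same_rg[OF sm, of rQp] same_rg[OF sm, of rSt] by (simp_all add: s1_def s0)
      have za: "marr s4 a = (\<lambda>_. 0)" if "a \<notin> Rr" for a
        using same_ar[OF sm that] by (simp add: s1_def s0)
      have op4: "mout s4 = []" using sm by (simp add: same_def s1_def s0)
      have st5: "static s5 Occ J"
        using static_same[of "{rQc}" "{aQL, aKNOWN}" s4 s5] I4 by (simp add: rinv_def s5_def same_def)
      \<comment> \<open>\<open>rNn\<close> is still 0, so the empty list is the only node and the
        invariants of the store reduce to blank memory.\<close>
      have nodes: "isnode s5 x \<longleftrightarrow> x = 0" for x by (auto simp: isnode_def s5_def zr)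
      have tr: "trie s5"
        unfolding trie_def nodes using I4 zr za by (auto simp: s5_def rinv_def)
      have fi: "finv s5 [[]]"
        unfolding finv_def nodes using tr za by (auto simp: s5_def cells_def)
      have mi: "minv s5 [[]] 0"
        unfolding minv_def using st5 fi nil za zr op4 by (simp add: stamps_def s5_def)
      have "wp main_code (\<lambda>m. post (8 + (n2 + (n4 + m)))) s5"
        by (rule wp_conseq[OF wp_main[OF mi]]) (use n2 n4 lD in \<open>auto simp: post_def algebra_simps\<close>)
      then show "wp (asg rQc (Num 1) ;; sto aQL (Num 0) (Num 1) ;; sto aKNOWN (Num 0) (Num 1) ;; main_code)
         (\<lambda>m. post (5 + (n2 + (n4 + m)))) s4"
        by (intro wp_seq wp_asg wp_sto) (simp_all add: s5_def)
    qed
    show "wp (asg rFlag (Num 0) ;; rd rNr ;; rules_code ;;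
       asg rQc (Num 1) ;; sto aQL (Num 0) (Num 1) ;; sto aKNOWN (Num 0) (Num 1) ;; main_code)
      (\<lambda>m. post (3 + (n2 + m))) s2"
      apply (intro wp_seq[where c="asg rFlag _"] wp_asg wp_seq[where c="rd _"])
       apply simp
      apply (rule wp_rd)
       apply (simp add: ip2)
      apply (rule wp_seq)
      using W3 by (simp add: s3_def)
  qed
  then have "wp datalog_machine post s0"
    unfolding datalog_machine_def
    apply (intro wp_seq[where c="asg _ _"] wp_asg wp_seq[where c="rd _"])
      apply simp
     apply simp
    apply (rule wp_rd)
     apply (simp add: ipe)
    apply (rule wp_seq)
    by (simp add: s1_def numeral_3_eq_3)
  then obtain n s' where n: "runs datalog_machine s0 n s'" "post n s'" unfolding wp_def by blast
  obtain t s where ts: "ram_exec datalog_machine S t s" "t \<le> 200 * n" "abs_state s = s'"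
    using n(1) unfolding runs_def s0_def by blast
  obtain Q where Q: "minv s' Q (length Q)" using n(2) by (auto simp: post_def)
  have os: "out s = mout s'" using ts(3) by (auto simp: abs_state_def)
  have "t \<le> 200 * ((33 * k + 92) * (length Rs + length Ds) + (\<Sum>f\<in>L. fcost f) + 20)"
    using order_trans[OF ts(2) mult_le_mono2] n(2) unfolding post_def by blast
  moreover have "distinct Q" using Q finvD(3) unfolding minv_def by blast
  moreover have "set Q \<subseteq> L" "[] \<in> set Q" "mout s' = concat (filter (\<lambda>f. fcls f \<in> J) Q)"
    "\<forall>a b h \<theta>. (a, b, h) \<in> set Occ \<longrightarrow> map (ground_trm \<theta>) a \<in> set Q \<longrightarrow>
        map (ground_trm \<theta>) b \<in> set Q \<longrightarrow> map (ground_trm \<theta>) h \<in> set Q"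
    using Q unfolding minv_def take_all[OF order_refl] by blast+
  ultimately show ?thesis
    using ts(1) unfolding S_def
    by (intro exI[of _ t] exI[of _ s] exI[of _ Q] conjI) (assumption | simp only: os)+
qed

section \<open>Correctness and running time\<close>

text \<open>Exchange of summation: facts pay for the occurrences of their class, so an occurrence is
  paid for by each fact of its class. The two relation sizes thus appear as a product.\<close>

lemma (in worklist) total_cost:
  "(\<Sum>f\<in>L. fcost f) = (\<Sum>j<length Occ. rel (pcls (fst (Occ ! j))) * ocost j) + card L * (3 * m + 10)"
proof -
  have "(\<Sum>f\<in>L. fcost f) =
    (\<Sum>f\<in>L. \<Sum>j<length Occ. if pcls (fst (Occ ! j)) = fcls f then ocost j else 0) + card L * (3 * m + 10)"
  proof -
    have "sum_list (map ocost (filter (\<lambda>j. P j) [0..<n])) = (\<Sum>j<n. if P j then ocost j else 0)" for P n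
      by (induction n) auto
    then show ?thesis by (simp add: fcost_def sum.distrib add_mult_distrib2)
  qed
  also have "(\<Sum>f\<in>L. \<Sum>j<length Occ. if pcls (fst (Occ ! j)) = fcls f then ocost j else 0) =
    (\<Sum>j<length Occ. \<Sum>f\<in>L. if pcls (fst (Occ ! j)) = fcls f then ocost j else 0)" by (rule sum.swap)
  also have "\<dots> = (\<Sum>j<length Occ. rel (pcls (fst (Occ ! j))) * ocost j)"
  proof (rule sum.cong[OF refl])
    fix j
    have "(\<Sum>f\<in>L. if pcls (fst (Occ ! j)) = fcls f then ocost j else 0) = (\<Sum>f\<in>{f\<in>L. pcls (fst (Occ ! j)) = fcls f}. ocost j)"
      by (rule sum.inter_filter[OF finL, symmetric])
    then show "(\<Sum>f\<in>L. if pcls (fst (Occ ! j)) = fcls f then ocost j else 0) = rel (pcls (fst (Occ ! j))) * ocost j"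
      by (simp add: rel_def eq_commute)
  qed
  finally show ?thesis .
qed

lemma encode_fact_inj [simp]: "encode_fact f = encode_fact g \<longleftrightarrow> f = g"
  by (cases f; cases g) (auto simp: encode_fact_def)

lemma encode_fact_neq [simp]: "encode_fact f \<noteq> []"
  by (simp add: encode_fact_def)

lemma ground_pat: "map (ground_trm \<theta>) (pat a) = encode_fact (ground_atom \<theta> a)"
  by (simp add: pat_def encode_fact_def ground_atom_def)

lemma pat_vars: "args_vars (pat a) = args_vars (snd a)"
  by (simp add: args_vars_def pat_def)

lemma ground_fact_rule: "ground_atom \<theta> (rhead (fact_rule f)) = f"
  by (simp add: ground_atom_def fact_rule_def comp_def)

lemma least_fixpoint_arity:
  assumes "datalog_program ar \<Pi>" "database ar \<Pi> D" "f \<in> least_fixpoint \<Pi> D"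
  shows "fst f \<in> predicates \<Pi> \<and> length (snd f) = ar (fst f)"
  using assms(3)
proof cases
  case database_fact
  then show ?thesis using assms(2) by (auto simp: database_def edb_def)
next
  case (rule_instance R \<theta>)
  then show ?thesis using assms(1) by (auto simp: datalog_program_def ground_atom_def predicates_def)
qed

lemma card_predicates:
  assumes "finite \<Pi>" "simple_chain \<Pi>"
  shows "card (predicates \<Pi>) \<le> 3 * card \<Pi>"
proof -
  have "card (fst ` set (rhead R # rbody R)) \<le> 3" if "R \<in> \<Pi>" for R
  proof -
    have "card (fst ` set (rhead R # rbody R)) \<le> length (rhead R # rbody R)"
      by (metis card_image_le card_length finite_set le_trans)
    then show ?thesis using that assms(2) by (auto simp: simple_chain_def)
  qed
  then have "(\<Sum>R\<in>\<Pi>. card (fst ` set (rhead R # rbody R))) \<le> (\<Sum>R\<in>\<Pi>. 3)" by (intro sum_mono)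
  then show ?thesis
    unfolding predicates_def using card_UN_le[OF assms(1), of "\<lambda>R. fst ` set (rhead R # rbody R)"] by simp
qed

lemma sum_list_le:
  fixes g :: "'a \<Rightarrow> nat"
  shows "(\<And>x. x \<in> set xs \<Longrightarrow> g x \<le> b) \<Longrightarrow> sum_list (map g xs) \<le> length xs * b"
  by (induction xs) (auto intro: add_mono)

text \<open>The queue stays inside \<open>L\<close>; at the end it is closed and contains the empty
  list, hence by induction every encoded fact of the least fixpoint. Up to the arity factor a
  program rule costs \<open>M\<^sup>2\<close> and a database fact a constant, and there are at most
  \<open>3 * card \<Pi> * M\<close> facts because a rule has at most three predicates.\<close>

lemma datalog_machine_correct:
  assumes prog: "datalog_program ar \<Pi>" and sc: "simple_chain \<Pi>" and k: "\<forall>p\<in>predicates \<Pi>. ar p \<le> k"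
    and db: "database ar \<Pi> D"
    and rel: "\<forall>p\<in>predicates \<Pi>. finite {xs. (p, xs) \<in> least_fixpoint \<Pi> D} \<and> card {xs. (p, xs) \<in> least_fixpoint \<Pi> D} \<le> M"
    and M1: "1 \<le> M"
    and lists: "distinct Rs" "set Rs = \<Pi>" "distinct Ds" "set Ds = D"
  shows "\<exists>t s fs. ram_exec datalog_machine (initial_state (encode_input Rs Ds)) t s \<and>
    t \<le> 200 * (1200 * (k + 1)) * ((1 + card \<Pi>) * M\<^sup>2) \<and>
    distinct fs \<and> set fs = idb_facts \<Pi> D \<and> out s = concat (map encode_fact fs)"
proof -
  have M: "p \<in> predicates \<Pi> \<Longrightarrow> card {xs. (p, xs) \<in> least_fixpoint \<Pi> D} \<le> M" "1 \<le> M"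
    and fin: "p \<in> predicates \<Pi> \<Longrightarrow> finite {xs. (p, xs) \<in> least_fixpoint \<Pi> D}" for p
    using rel M1 by blast+
  define F where "F = least_fixpoint \<Pi> D"
  define L where "L = insert [] (encode_fact ` F)"
  define Rs' where "Rs' = Rs @ map fact_rule Ds"
  define Occ where "Occ = concat (map occs_of Rs')"
  define J where "J = (\<Union>R\<in>set Rs. jset R)"
  define m where "m = k + 2"
  have fP: "finite \<Pi>" using prog by (simp add: datalog_program_def)
  have J: "J = Suc ` idb \<Pi>" by (auto simp: J_def jset_def idb_def lists(2))
  have F: "fst f \<in> predicates \<Pi>" "length (snd f) = ar (fst f)" if "f \<in> F" for f
    using least_fixpoint_arity[OF prog db] that by (auto simp: F_def)
  have Fsub: "F \<subseteq> (\<Union>p\<in>predicates \<Pi>. Pair p ` {xs. (p, xs) \<in> F})"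
    using F(1) by fastforce
  have fpr: "finite (predicates \<Pi>)" by (rule finite_predicates[OF fP])
  have fF: "finite F" using Fsub fin fpr unfolding F_def[symmetric] by (meson finite_UN_I finite_imageI finite_subset)
  have cF: "card F \<le> 3 * card \<Pi> * M"
  proof -
    have "card F \<le> card (\<Union>p\<in>predicates \<Pi>. Pair p ` {xs. (p, xs) \<in> F})"
      using Fsub fin fpr unfolding F_def[symmetric] by (intro card_mono) auto
    also have "\<dots> \<le> (\<Sum>p\<in>predicates \<Pi>. card (Pair p ` {xs. (p, xs) \<in> F}))" by (rule card_UN_le[OF fpr])
    also have "\<dots> \<le> (\<Sum>p\<in>predicates \<Pi>. M)"
      using M(1) unfolding F_def[symmetric] by (intro sum_mono) (simp add: card_image inj_on_def)
    also have "\<dots> \<le> 3 * card \<Pi> * M" using card_predicates[OF fP sc] by (simp add: mult_le_mono1)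
    finally show ?thesis .
  qed
  have R: "length (rbody R) \<le> 2" "\<And>a. a \<in> set (rhead R # rbody R) \<Longrightarrow> length (snd a) \<le> k"
    "\<And>a. a \<in> set (rbody R) \<Longrightarrow> length (snd a) = ar (fst a)"
    "args_vars (snd (rhead R)) \<subseteq> (\<Union>a\<in>set (rbody R). args_vars (snd a))"
    "\<And>\<theta>. \<forall>a\<in>set (rbody R). ground_atom \<theta> a \<in> F \<Longrightarrow> ground_atom \<theta> (rhead R) \<in> F" if RR: "R \<in> set Rs'" for R
  proof -
    consider "R \<in> \<Pi>" | f where "f \<in> D" "R = fact_rule f" using RR lists by (auto simp: Rs'_def)
    then have "length (rbody R) \<le> 2 \<and> (\<forall>a\<in>set (rhead R # rbody R). length (snd a) \<le> k) \<and>
      (\<forall>a\<in>set (rbody R). length (snd a) = ar (fst a)) \<and>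
      args_vars (snd (rhead R)) \<subseteq> (\<Union>a\<in>set (rbody R). args_vars (snd a)) \<and>
      (\<forall>\<theta>. (\<forall>a\<in>set (rbody R). ground_atom \<theta> a \<in> F) \<longrightarrow> ground_atom \<theta> (rhead R) \<in> F)"
    proof cases
      case 1
      have l: "length (snd a) = ar (fst a)" "ar (fst a) \<le> k" if "a \<in> set (rhead R # rbody R)" for a
      proof -
        show "length (snd a) = ar (fst a)" using prog 1 that by (auto simp: datalog_program_def)
        have "fst a \<in> predicates \<Pi>" using 1 that unfolding predicates_def by blast
        then show "ar (fst a) \<le> k" using k by blast
      qed
      show ?thesis
      proof (intro conjI ballI allI impI)
        show "length (rbody R) \<le> 2" using sc 1 by (simp add: simple_chain_def)
        show "args_vars (snd (rhead R)) \<subseteq> (\<Union>a\<in>set (rbody R). args_vars (snd a))" using prog 1 by (simp add: datalog_program_def)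
        show "ground_atom \<theta> (rhead R) \<in> F" if "\<forall>a\<in>set (rbody R). ground_atom \<theta> a \<in> F" for \<theta>
          using least_fixpoint.rule_instance[OF 1] that by (simp add: F_def)
        show "length (snd a) \<le> k" if "a \<in> set (rhead R # rbody R)" for a using l[OF that] by simp
        show "length (snd a) = ar (fst a)" if "a \<in> set (rbody R)" for a using l(1)[of a] that by simp
      qed
    next
      case 2
      have "f \<in> F" using 2(1) by (simp add: F_def least_fixpoint.database_fact)
      then have "length (snd f) \<le> k" using F[of f] k by fastforce
      then show ?thesis using \<open>f \<in> F\<close> ground_fact_rule[of _ f] by (auto simp: 2(2) fact_rule_def args_vars_def)
    qed
    then show "length (rbody R) \<le> 2" "\<And>a. a \<in> set (rhead R # rbody R) \<Longrightarrow> length (snd a) \<le> k"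
      "\<And>a. a \<in> set (rbody R) \<Longrightarrow> length (snd a) = ar (fst a)"
      "args_vars (snd (rhead R)) \<subseteq> (\<Union>a\<in>set (rbody R). args_vars (snd a))"
      "\<And>\<theta>. \<forall>a\<in>set (rbody R). ground_atom \<theta> a \<in> F \<Longrightarrow> ground_atom \<theta> (rhead R) \<in> F" by blast+
  qed
  have occE: "\<exists>R\<in>set Rs'. h = pat (rhead R) \<and> (a, b) \<in> {body_pats (rbody R), prod.swap (body_pats (rbody R))}"
    if o: "(a, b, h) \<in> set Occ" for a b h
  proof -
    obtain Ra where Ra: "Ra \<in> set Rs'" "(a, b, h) \<in> set (occs_of Ra)" using o by (auto simp: Occ_def)
    obtain x y where "body_pats (rbody Ra) = (x, y)" by fastforce
    then show ?thesis using Ra by (intro bexI[of _ Ra]) (auto simp: occs_of_def Let_def)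
  qed
  have occI: "(fst (body_pats (rbody R)), snd (body_pats (rbody R)), pat (rhead R)) \<in> set Occ" if "R \<in> set Rs'" for R
  proof -
    have "(fst (body_pats (rbody R)), snd (body_pats (rbody R)), pat (rhead R)) \<in> set (occs_of R)"
      by (cases "body_pats (rbody R)") (simp add: occs_of_def Let_def)
    then show ?thesis unfolding Occ_def using that by auto
  qed
  have body_cases: "rbody R = [] \<or> (\<exists>x. rbody R = [x]) \<or> (\<exists>x y. rbody R = [x, y])" if "R \<in> set Rs'" for R
    using R(1)[OF that] by (cases "rbody R" rule: body_pats.cases) auto
  have inL: "encode_fact f \<in> L \<longleftrightarrow> f \<in> F" for f by (auto simp: L_def)
  have part: "c = [] \<or> (\<exists>x\<in>set (rbody R). c = pat x)" if "R \<in> set Rs'" "c = fst (body_pats (rbody R)) \<or> c = snd (body_pats (rbody R))" for R c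
    using body_cases[OF that(1)] that(2) by auto
  have occ_part: "\<exists>R\<in>set Rs'. h = pat (rhead R) \<and> (\<forall>c\<in>{a, b}. c = [] \<or> (\<exists>x\<in>set (rbody R). c = pat x)) \<and>
      (\<forall>x\<in>set (rbody R). pat x \<in> {a, b})" if o: "(a, b, h) \<in> set Occ" for a b h
  proof -
    obtain Ra where Ra: "Ra \<in> set Rs'" "h = pat (rhead Ra)" "(a, b) \<in> {body_pats (rbody Ra), prod.swap (body_pats (rbody Ra))}"
      using occE[OF o] by blast
    show ?thesis using body_cases[OF Ra(1)] Ra by (intro bexI[of _ Ra]) auto
  qed
  interpret W: worklist Occ L m J
  proof
    fix a b h \<theta>
    assume o: "(a, b, h) \<in> set Occ"
    obtain Ra where Ra: "Ra \<in> set Rs'" "h = pat (rhead Ra)" "\<forall>c\<in>{a, b}. c = [] \<or> (\<exists>x\<in>set (rbody Ra). c = pat x)"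
      "\<forall>x\<in>set (rbody Ra). pat x \<in> {a, b}" using occ_part[OF o] by blast
    { assume "map (ground_trm \<theta>) a \<in> L" "map (ground_trm \<theta>) b \<in> L"
      then have "ground_atom \<theta> x \<in> F" if "x \<in> set (rbody Ra)" for x
        using Ra(4) that inL[of "ground_atom \<theta> x"] ground_pat[of \<theta> x] by auto
      then have "ground_atom \<theta> (rhead Ra) \<in> F" using R(5)[OF Ra(1)] by blast
      then show "map (ground_trm \<theta>) h \<in> L" by (simp add: Ra(2) ground_pat inL) }
    have lp: "length (pat x) \<le> m" if "x \<in> set (rhead Ra # rbody Ra)" for x
      using R(2)[OF Ra(1) that] by (simp add: pat_def m_def)
    have lc: "length c \<le> m" if "c \<in> {a, b}" for c using Ra(3) that lp by fastforce
    show "length a \<le> m \<and> length b \<le> m \<and> length h \<le> m" using lc lp[of "rhead Ra"] Ra(2) by simp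
    show "fcls (map (ground_trm \<theta>) a) = pcls a"
      using Ra(3) by (auto simp: ground_pat encode_fact_def ground_atom_def)
    \<comment> \<open>The class reveals the predicate of a fact and thereby its arity, so a pattern
      only ever meets lists of its own length.\<close>
    show "length f = length a" if f: "f \<in> L" "fcls f = pcls a" for f
    proof (cases "a = []")
      case True
      then show ?thesis using f(2) by (cases f) auto
    next
      case False
      then obtain x where x: "x \<in> set (rbody Ra)" "a = pat x" using Ra(3) by blast
      then obtain g where g: "g \<in> F" "f = encode_fact g" using f by (auto simp: L_def pat_def)
      then have "fst g = fst x" using f(2) x(2) by (simp add: encode_fact_def)
      then show ?thesis using R(3)[OF Ra(1) x(1)] F(2)[OF g(1)] g(2) x(2) by (simp add: encode_fact_def pat_def)
    qed
    show "(b, a, h) \<in> set Occ"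
    proof -
      obtain Rb where Rb: "Rb \<in> set Rs'" "(a, b, h) \<in> set (occs_of Rb)" using o by (auto simp: Occ_def)
      then have "(b, a, h) \<in> set (occs_of Rb)"
        by (cases "body_pats (rbody Rb)") (auto simp: occs_of_def Let_def)
      then show ?thesis unfolding Occ_def using Rb(1) by auto
    qed
    show "args_vars h \<subseteq> args_vars a \<union> args_vars b"
    proof
      fix v assume "v \<in> args_vars h"
      then obtain x where "x \<in> set (rbody Ra)" "v \<in> args_vars (pat x)"
        using R(4)[OF Ra(1)] by (auto simp: Ra(2) pat_vars)
      then show "v \<in> args_vars a \<union> args_vars b" using Ra(4) by auto
    qed
  next
    show "[] \<in> L" "finite L" using fF by (simp_all add: L_def)
    show "length f \<le> m" if "f \<in> L" for f
    proof (cases "f = []")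
      case False
      then obtain g where g: "g \<in> F" "f = encode_fact g" using \<open>f \<in> L\<close> by (auto simp: L_def)
      have "ar (fst g) \<le> k" using k F(1)[OF g(1)] by blast
      then show ?thesis using F(2)[OF g(1)] g(2) by (simp add: encode_fact_def m_def)
    qed simp
  qed
  have ok1: "\<forall>Ra\<in>set Rs. rule_ok True k Ra"
  proof
    fix Ra assume "Ra \<in> set Rs"
    then have "Ra \<in> set Rs'" by (simp add: Rs'_def)
    from R(1)[OF this] R(2)[OF this] show "rule_ok True k Ra" unfolding rule_ok_def readable_def by blast
  qed
  have ok2: "\<forall>f\<in>set Ds. length (snd f) \<le> k"
  proof
    fix f assume "f \<in> set Ds"
    then have "fact_rule f \<in> set Rs'" by (simp add: Rs'_def)
    from R(2)[OF this, of "rhead (fact_rule f)"] show "length (snd f) \<le> k" by (simp add: fact_rule_def)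
  qed
  obtain t s Q where ts: "ram_exec datalog_machine (initial_state (encode_input Rs Ds)) t s"
    "t \<le> 200 * ((33 * k + 92) * (length Rs + length Ds) + (\<Sum>f\<in>L. W.fcost f) + 20)"
    and Q: "distinct Q" "set Q \<subseteq> L" "[] \<in> set Q" "out s = concat (filter (\<lambda>f. fcls f \<in> J) Q)"
      "\<forall>a b h \<theta>. (a, b, h) \<in> set Occ \<longrightarrow> map (ground_trm \<theta>) a \<in> set Q \<longrightarrow>
        map (ground_trm \<theta>) b \<in> set Q \<longrightarrow> map (ground_trm \<theta>) h \<in> set Q"
    using W.datalog_machine_exec[OF Occ_def[unfolded Rs'_def] J_def ok1 ok2] by blast
  have step: "encode_fact (ground_atom \<theta> (rhead Ra)) \<in> set Q"
    if "Ra \<in> set Rs'" "\<forall>x\<in>set (rbody Ra). encode_fact (ground_atom \<theta> x) \<in> set Q" for Ra \<theta>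
  proof -
    have "map (ground_trm \<theta>) c \<in> set Q" if c: "c = fst (body_pats (rbody Ra)) \<or> c = snd (body_pats (rbody Ra))" for c
      using part[OF \<open>Ra \<in> set Rs'\<close> c] Q(3) \<open>\<forall>x\<in>set (rbody Ra). _ x\<close> by (auto simp: ground_pat)
    then have "map (ground_trm \<theta>) (pat (rhead Ra)) \<in> set Q" using Q(5) occI[OF that(1)] by blast
    then show ?thesis by (simp add: ground_pat)
  qed
  have "encode_fact f \<in> set Q" if "f \<in> least_fixpoint \<Pi> D" for f
    using that
  proof induction
    case (database_fact f)
    then have "fact_rule f \<in> set Rs'" using lists by (simp add: Rs'_def)
    from step[OF this, of "\<lambda>_. 0"] show ?case unfolding ground_fact_rule by (simp add: fact_rule_def)
  next
    case (rule_instance Ra \<theta>)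
    have "Ra \<in> set Rs'" using rule_instance lists by (simp add: Rs'_def)
    from step[OF this] show ?case using rule_instance by blast
  qed
  then have QL: "set Q = L" using Q(2,3) by (auto simp: L_def F_def)
  \<comment> \<open>Inverts the encoding by keeping the predicate and skipping the arity.\<close>
  define dec where "dec l = (hd l, drop 2 l)" for l :: "nat list"
  have dec: "dec (encode_fact f) = f" for f by (simp add: dec_def encode_fact_def)
  define Qi where "Qi = filter (\<lambda>f. fcls f \<in> J) Q"
  have Qi: "set Qi = encode_fact ` idb_facts \<Pi> D"
  proof -
    have "fcls (encode_fact f) \<in> J \<longleftrightarrow> fst f \<in> idb \<Pi>" for f by (auto simp: J encode_fact_def)
    then show ?thesis unfolding Qi_def using J by (auto simp: QL L_def F_def idb_facts_def)
  qed
  define fs where "fs = map dec Qi"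
  have "distinct fs"
    using Q(1) dec Qi by (auto simp: fs_def distinct_map Qi_def[symmetric] inj_on_def) (simp add: Qi_def)
  moreover have "set fs = idb_facts \<Pi> D" using dec by (simp add: fs_def Qi image_image)
  moreover have "map encode_fact fs = Qi"
    unfolding fs_def map_map using Qi dec by (intro map_idI) auto
  then have "out s = concat (map encode_fact fs)" using Q(4) by (simp add: Qi_def)
  moreover have "t \<le> 200 * (1200 * (k + 1)) * ((1 + card \<Pi>) * M\<^sup>2)"
  proof -
    define P where "P = card \<Pi>"
    have M2: "1 \<le> M\<^sup>2" "M \<le> M\<^sup>2" using M(2) by (simp_all add: power2_eq_square)
    have rel: "W.rel c \<le> M" for c
    proof (cases c)
      case 0
      have "{g \<in> L. fcls g = c} \<subseteq> {[]}" by (auto simp: 0 L_def encode_fact_def)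
      then have "W.rel c \<le> card {[] :: nat list}" unfolding W.rel_def by (intro card_mono) auto
      then show ?thesis using M(2) by simp
    next
      case (Suc p)
      have e: "{g \<in> L. fcls g = c} = (\<lambda>xs. encode_fact (p, xs)) ` {xs. (p, xs) \<in> F}"
      proof -
        have "fcls (encode_fact f) = Suc (fst f)" for f by (simp add: encode_fact_def)
        then show ?thesis by (auto simp: Suc L_def)
      qed
      show ?thesis
      proof (cases "p \<in> predicates \<Pi>")
        case True
        have "W.rel c \<le> card {xs. (p, xs) \<in> F}" unfolding W.rel_def e using fin[OF True] by (intro card_image_le) (simp add: F_def)
        also have "\<dots> \<le> M" using M(1)[OF True] by (simp add: F_def)
        finally show ?thesis .
      next
        case False
        then have "{xs. (p, xs) \<in> F} = {}" using F(1) by fastforce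
        then show ?thesis unfolding W.rel_def e by simp
      qed
    qed
    have rel0: "W.rel 0 \<le> 1"
    proof -
      have "{g \<in> L. fcls g = 0} \<subseteq> {[]}" by (auto simp: L_def encode_fact_def)
      then have "W.rel 0 \<le> card {[] :: nat list}" unfolding W.rel_def by (intro card_mono) auto
      then show ?thesis by simp
    qed
    define A where "A = 30 * m + 38"
    \<comment> \<open>The cost as a function of the occurrence instead of its position, so that the
      sum splits into program and database.\<close>
    define g :: "occ \<Rightarrow> nat" where "g = (\<lambda>(a, b, h). W.rel (pcls a) * ((30 * m + 33) * W.rel (pcls b) + 5))"
    have g1: "g x \<le> A * M\<^sup>2" for x
    proof -
      obtain a b h where x: "x = (a, b, h)" by (cases x)
      have "(30 * m + 33) * W.rel (pcls b) + 5 \<le> (30 * m + 33) * M + 5 * M"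
        using rel M(2) by (intro add_mono mult_le_mono) auto
      then have "g x \<le> M * ((30 * m + 33) * M + 5 * M)" unfolding x g_def using rel by (auto intro: mult_le_mono)
      then show ?thesis by (simp add: A_def power2_eq_square algebra_simps)
    qed
    \<comment> \<open>The empty list is alone in class 0, so a rule with empty body costs a
      constant. This prevents the many database facts from each contributing a factor
      \<open>M\<^sup>2\<close>.\<close>
    have g0: "g ([], [], h) \<le> A" for h
    proof -
      have "g ([], [], h) \<le> 1 * ((30 * m + 33) * 1 + 5)" unfolding g_def prod.case pcls.simps using rel0 by (intro mult_le_mono add_mono) auto
      then show ?thesis by (simp add: A_def)
    qed
    have "(\<Sum>j<length Occ. W.rel (pcls (fst (Occ ! j))) * W.ocost j) = (\<Sum>j<length Occ. g (Occ ! j))"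
      by (rule sum.cong) (auto simp: g_def W.ocost_def split: prod.splits)
    also have "\<dots> = sum_list (map g Occ)" by (simp add: sum_list_sum_nth atLeast0LessThan)
    also have "\<dots> = sum_list (map (\<lambda>R. sum_list (map g (occs_of R))) Rs) + sum_list (map (\<lambda>f. sum_list (map g (occs_of (fact_rule f)))) Ds)"
    proof -
      have "sum_list (map g (concat xss)) = sum_list (map (\<lambda>xs. sum_list (map g xs)) xss)" for xss
        by (induction xss) auto
      then show ?thesis by (simp add: Occ_def Rs'_def comp_def)
    qed
    also have "\<dots> \<le> length Rs * (2 * (A * M\<^sup>2)) + length Ds * (2 * A)"
    proof (intro add_mono sum_list_le)
      fix Ra
      have "sum_list (map g (occs_of Ra)) \<le> length (occs_of Ra) * (A * M\<^sup>2)" by (rule sum_list_le) (rule g1)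
      then show "sum_list (map g (occs_of Ra)) \<le> 2 * (A * M\<^sup>2)" by (simp add: occs_of_def Let_def split: prod.splits)
    next
      fix f
      show "sum_list (map g (occs_of (fact_rule f))) \<le> 2 * A"
        using g0[of "pat (rhead (fact_rule f))"] by (simp add: occs_of_def Let_def fact_rule_def)
    qed
    finally have S: "(\<Sum>j<length Occ. W.rel (pcls (fst (Occ ! j))) * W.ocost j) \<le> length Rs * (2 * (A * M\<^sup>2)) + length Ds * (2 * A)" .
    have lR: "length Rs = P" using lists distinct_card unfolding P_def by metis
    \<comment> \<open>The database is part of the least fixpoint, whose size is already bounded; the
      estimate by \<open>P * M\<^sup>2\<close> is generous.\<close>
    have lD: "length Ds \<le> 3 * (P * M\<^sup>2)"
    proof -
      have "length Ds = card D" using lists distinct_card by metis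
      also have "\<dots> \<le> card F" using fF by (intro card_mono) (auto simp: F_def intro: least_fixpoint.database_fact)
      also have "\<dots> \<le> 3 * (P * M)" using cF by (simp add: P_def algebra_simps)
      also have "\<dots> \<le> 3 * (P * M\<^sup>2)" using M2 by simp
      finally show ?thesis .
    qed
    have cL: "card L \<le> 1 + 3 * (P * M\<^sup>2)"
    proof -
      have "card L \<le> Suc (card (encode_fact ` F))" unfolding L_def using fF by (simp add: card_insert_if)
      also have "card (encode_fact ` F) \<le> card F" by (rule card_image_le[OF fF])
      also have "card F \<le> 3 * (P * M)" using cF by (simp add: P_def algebra_simps)
      also have "3 * (P * M) \<le> 3 * (P * M\<^sup>2)" using M2 by simp
      finally show ?thesis by simp
    qed
    define Y where "Y = P * M\<^sup>2"
    have PY: "P \<le> Y" using M2(1) by (simp add: Y_def)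
    have "t \<le> 200 * ((33 * k + 92) * (P + length Ds) + (P * (2 * (A * M\<^sup>2)) + length Ds * (2 * A) + card L * (3 * m + 10)) + 20)"
      by (rule order_trans[OF ts(2)[unfolded W.total_cost lR]])
        (intro mult_le_mono2 add_mono order_refl S[unfolded lR])
    also have "\<dots> \<le> 200 * ((33 * k + 92) * (Y + 3 * Y) + (Y * (2 * A) + (3 * Y) * (2 * A) + (1 + 3 * Y) * (3 * m + 10)) + 20)"
    proof -
      have "P * (2 * (A * M\<^sup>2)) = Y * (2 * A)" by (simp add: Y_def)
      then show ?thesis
        using PY lD[folded Y_def] cL[folded Y_def] by (simp only:) (intro mult_le_mono add_mono order_refl; assumption)
    qed
    also have "\<dots> = 200 * ((33 * k + 92) * 4 * Y + (8 * (30 * (k + 2) + 38) * Y + (3 * k + 16) + 3 * (3 * k + 16) * Y) + 20)"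
      by (simp add: A_def m_def algebra_simps)
    \<comment> \<open>For \<open>k = 0\<close> the coefficient of \<open>Y\<close> is 368 + 784 +
      48, which is 1200; all other coefficients are smaller.\<close>
    also have "\<dots> \<le> 200 * (1200 * (k + 1) * (1 + Y))" by (simp add: algebra_simps)
    also have "\<dots> \<le> 200 * (1200 * (k + 1)) * ((1 + card \<Pi>) * M\<^sup>2)"
    proof -
      have "1 + Y \<le> (1 + card \<Pi>) * M\<^sup>2" using M2 by (simp add: Y_def P_def algebra_simps)
      from mult_le_mono2[OF this, of "200 * (1200 * (k + 1))"] show ?thesis by (simp only: mult.assoc)
    qed
    finally show ?thesis .
  qed
  ultimately show ?thesis using ts(1) by blast
qed

text \<open>One machine serves all programs and databases; only the constant depends on the arity
  bound \<open>k\<close>.\<close>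

theorem corollary7p5:
  shows "\<exists>M. \<forall>k. \<exists>c::real. \<forall>ar \<Pi> D (N::nat).
    datalog_program ar \<Pi> \<and> simple_chain \<Pi> \<and> (\<forall>p\<in>predicates \<Pi>. ar p \<le> k) \<and>
    database ar \<Pi> D \<and> 1 \<le> N \<and> (\<forall>e\<in>edb \<Pi>. card (edb_relation \<Pi> D e) \<le> N) \<longrightarrow>
      (1 \<le> ew \<Pi> \<longrightarrow>
        evaluates_in_time M \<Pi> D
          (c * ((real (max_adornments \<Pi>))\<^sup>2 * real (card \<Pi>) * real N powr (2 * ew \<Pi>)))) \<and>
      (ew \<Pi> < 1 \<longrightarrow>
        evaluates_in_time M \<Pi> D
          (c * ((real (max_adornments \<Pi>))\<^sup>2 * real (card \<Pi>) * real N powr (2 * ew \<Pi>)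
                + real (1 + card \<Pi>) * (real N)\<^sup>2)))"
proof (rule exI[of _ datalog_machine], rule allI)
  fix k
  define K where "K = 200 * (1200 * (real k + 1))"
  have K: "0 \<le> K" by (simp add: K_def)
  show "\<exists>c::real. \<forall>ar \<Pi> D (N::nat).
    datalog_program ar \<Pi> \<and> simple_chain \<Pi> \<and> (\<forall>p\<in>predicates \<Pi>. ar p \<le> k) \<and>
    database ar \<Pi> D \<and> 1 \<le> N \<and> (\<forall>e\<in>edb \<Pi>. card (edb_relation \<Pi> D e) \<le> N) \<longrightarrow>
      (1 \<le> ew \<Pi> \<longrightarrow>
        evaluates_in_time datalog_machine \<Pi> D
          (c * ((real (max_adornments \<Pi>))\<^sup>2 * real (card \<Pi>) * real N powr (2 * ew \<Pi>)))) \<and>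
      (ew \<Pi> < 1 \<longrightarrow>
        evaluates_in_time datalog_machine \<Pi> D
          (c * ((real (max_adornments \<Pi>))\<^sup>2 * real (card \<Pi>) * real N powr (2 * ew \<Pi>)
                + real (1 + card \<Pi>) * (real N)\<^sup>2)))"
  \<comment> \<open>The factor 2 pays for replacing \<open>1 + P\<close> by \<open>2 * P\<close>
    when the program is nonempty.\<close>
  proof (rule exI[of _ "2 * K"], intro allI impI, elim conjE)
    fix ar \<Pi> D and N :: nat
    assume prog: "datalog_program ar \<Pi>" and sc: "simple_chain \<Pi>" and k: "\<forall>p\<in>predicates \<Pi>. ar p \<le> k"
      and db: "database ar \<Pi> D" and N: "1 \<le> N" and E: "\<forall>e\<in>edb \<Pi>. card (edb_relation \<Pi> D e) \<le> N"
    define P where "P = real (card \<Pi>)"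
    define f where "f = real (max_adornments \<Pi>)"
    define b where "b = f * real N powr ew \<Pi>"
    \<comment> \<open>EDB relations are bounded by \<open>N\<close> and IDB relations by
      \<open>b\<close>; the machine bound takes one natural number for all predicates.\<close>
    define M where "M = max N (nat \<lfloor>b\<rfloor>)"
    have fin: "finite \<Pi>" "finite D" using prog db by (auto simp: datalog_program_def database_def)
    have b0: "0 \<le> b" by (simp add: b_def f_def)
    have b2: "b\<^sup>2 = f\<^sup>2 * real N powr (2 * ew \<Pi>)" by (simp add: b_def power_mult_distrib power2_eq_square powr_add[symmetric])
    have rel: "finite {xs. (p, xs) \<in> least_fixpoint \<Pi> D} \<and> card {xs. (p, xs) \<in> least_fixpoint \<Pi> D} \<le> M"
      if "p \<in> predicates \<Pi>" for p
    proof (cases "p \<in> idb \<Pi>")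
      case True
      note i = idb_relation_bound[OF prog db N E[rule_format] True]
      have "card {xs. (p, xs) \<in> least_fixpoint \<Pi> D} \<le> nat \<lfloor>b\<rfloor>"
        using i(2) by (simp add: b_def f_def le_nat_floor)
      then show ?thesis using i(1) by (simp add: M_def)
    next
      case False
      then have e: "p \<in> edb \<Pi>" using that by (simp add: edb_def)
      have sub: "{xs. (p, xs) \<in> least_fixpoint \<Pi> D} \<subseteq> edb_relation \<Pi> D p" using edb_fact[OF prog] False by fastforce
      then have "card {xs. (p, xs) \<in> least_fixpoint \<Pi> D} \<le> card (edb_relation \<Pi> D p)"
        by (rule card_mono[OF finite_edb_relation[OF fin]])
      then show ?thesis using finite_subset[OF sub finite_edb_relation[OF fin]] E e by (force simp: M_def)
    qed
    have M1: "1 \<le> M" using N by (simp add: M_def)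
    have relM: "\<forall>p\<in>predicates \<Pi>. finite {xs. (p, xs) \<in> least_fixpoint \<Pi> D} \<and> card {xs. (p, xs) \<in> least_fixpoint \<Pi> D} \<le> M"
      using rel by blast
    have ev: "evaluates_in_time datalog_machine \<Pi> D T" if T: "K * ((1 + P) * (real M)\<^sup>2) \<le> T" for T
      unfolding evaluates_in_time_def
    proof (intro allI impI, elim conjE)
      fix Rs Ds assume l: "distinct Rs" "set Rs = \<Pi>" "distinct Ds" "set Ds = D"
      obtain t s fs where h: "ram_exec datalog_machine (initial_state (encode_input Rs Ds)) t s"
        "t \<le> 200 * (1200 * (k + 1)) * ((1 + card \<Pi>) * M\<^sup>2)"
        "distinct fs" "set fs = idb_facts \<Pi> D" "out s = concat (map encode_fact fs)"
        using datalog_machine_correct[OF prog sc k db relM M1 l] by (elim exE conjE)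
      have "real t \<le> real (200 * (1200 * (k + 1)) * ((1 + card \<Pi>) * M\<^sup>2))" using h(2) by (rule of_nat_mono)
      also have "\<dots> = K * ((1 + P) * (real M)\<^sup>2)" by (simp add: K_def P_def algebra_simps)
      finally have "real t \<le> T" using T by linarith
      then show "\<exists>t s fs. ram_exec datalog_machine (initial_state (encode_input Rs Ds)) t s \<and> real t \<le> T \<and>
          distinct fs \<and> set fs = idb_facts \<Pi> D \<and> out s = concat (map encode_fact fs)"
        using h by blast
    qed
    have Mr: "real M \<le> max (real N) b" using b0 by (simp add: M_def max_def) linarith
    have P1: "1 \<le> P" if "\<Pi> \<noteq> {}" using fin that by (simp add: P_def Suc_le_eq card_gt_0_iff)
    show "(1 \<le> ew \<Pi> \<longrightarrow>
        evaluates_in_time datalog_machine \<Pi> D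
          (2 * K * ((real (max_adornments \<Pi>))\<^sup>2 * real (card \<Pi>) * real N powr (2 * ew \<Pi>)))) \<and>
      (ew \<Pi> < 1 \<longrightarrow>
        evaluates_in_time datalog_machine \<Pi> D
          (2 * K * ((real (max_adornments \<Pi>))\<^sup>2 * real (card \<Pi>) * real N powr (2 * ew \<Pi>)
                + real (1 + card \<Pi>) * (real N)\<^sup>2)))"
    proof (intro conjI impI ev)
      assume ew: "1 \<le> ew \<Pi>"
      have f1: "1 \<le> f" and ne: "\<Pi> \<noteq> {}" using adornment_exists[OF prog ew] by (simp_all add: f_def)
      have "real N \<le> real N powr ew \<Pi>" using powr_mono[of 1 "ew \<Pi>" "real N"] ew N by simp
      also have "\<dots> \<le> b" unfolding b_def using f1 mult_right_mono[of 1 f "real N powr ew \<Pi>"] by simp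
      finally have "real M \<le> b" using Mr by simp
      then have "(real M)\<^sup>2 \<le> b\<^sup>2" by (intro power_mono) auto
      then have "(1 + P) * (real M)\<^sup>2 \<le> (2 * P) * b\<^sup>2" using P1[OF ne] by (intro mult_mono) auto
      from mult_left_mono[OF this K]
      show "K * ((1 + P) * (real M)\<^sup>2) \<le> 2 * K * ((real (max_adornments \<Pi>))\<^sup>2 * real (card \<Pi>) * real N powr (2 * ew \<Pi>))"
        unfolding b2 by (simp add: P_def f_def mult_ac)
    next
      have "(real M)\<^sup>2 \<le> (max (real N) b)\<^sup>2" using Mr by (intro power_mono) auto
      also have "\<dots> \<le> (real N)\<^sup>2 + b\<^sup>2" by (simp add: max_def)
      finally have "(1 + P) * (real M)\<^sup>2 \<le> (1 + P) * ((real N)\<^sup>2 + b\<^sup>2)" by (intro mult_left_mono) (simp_all add: P_def)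
      also have "(1 + P) * b\<^sup>2 \<le> 2 * P * b\<^sup>2"
      proof (cases "\<Pi> = {}")
        case True
        \<comment> \<open>Without rules the maximum over the IDB predicates is its default element
          0, so both sides vanish.\<close>
        then have "f = 0" by (simp add: f_def max_adornments_def idb_def)
        then show ?thesis by (simp add: b_def)
      next
        case False
        then show ?thesis using P1 by (intro mult_right_mono) auto
      qed
      then have "(1 + P) * ((real N)\<^sup>2 + b\<^sup>2) \<le> 2 * (P * b\<^sup>2 + (1 + P) * (real N)\<^sup>2)"
        by (simp add: algebra_simps P_def) (smt (verit) mult_nonneg_nonneg of_nat_0_le_iff zero_le_power2)
      finally have "(1 + P) * (real M)\<^sup>2 \<le> 2 * (P * b\<^sup>2 + (1 + P) * (real N)\<^sup>2)" .
      from mult_left_mono[OF this K]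
      show "K * ((1 + P) * (real M)\<^sup>2) \<le> 2 * K * ((real (max_adornments \<Pi>))\<^sup>2 * real (card \<Pi>) * real N powr (2 * ew \<Pi>)
                + real (1 + card \<Pi>) * (real N)\<^sup>2)"
        unfolding b2 by (simp add: P_def f_def mult_ac)
    qed
  qed
qed

end
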